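(* Let $\mathfrak g$ be a homotopy Lie algebra. There is a dg-category $\mathsf{Rep}(\mathfrak g)$ (a category enriched in cochain complexes over $\mathbb K$) with: (i) objects the representations $V=(V,\rho_V)$ of $\mathfrak g$; (ii) morphisms the intertwiners, where the degree $n$ part of the hom-complex from $U$ to $V$ is the space of intertwiners $U\rightsquigarrow V[n]$; (iii) composition given by juxtaposition $(g,f)\mapsto gf$ and hom differential given by $f\mapsto[\![\rho,f]\!]:=\rho_Vf-(-1)^{|f|}f\rho_U-\varrho_f\ell_U$; (iv) units given by the identity intertwiners $\mathbf 1_U$.
   Context: Conventions. $\mathbb K$ is a field of characteristic $0$; graded vector spaces are $\mathbb Z$-graded over $\mathbb K$; $V[n]^m:=V^{m+n}$; a homogeneous linear map $V\to W$ of degree $n$ is written as a graded linear map $V\to W[n]$ (this notation introduces no extra signs). Koszul rule: $s_{V,W}(v\otimes w)=(-1)^{|v||w|}w\otimes v$, $(f\otimes g)(v\otimes w)=(-1)^{|g||v|}f(v)\otimes g(w)$. Tensor products are treated as strictly associative and unital. For an integer $i$, $\tilde i:=i-1$. $1_U$ is the identity of $U$, $1_n$ the identity of $\mathfrak g^{\otimes n}$. For $i,j\ge 0$ let $\mathrm S_{i,j}\subseteq \mathrm S_{i+j}$ be the permutations with $\sigma(1)<\dots<\sigma(i)$ and $\sigma(i+1)<\dots<\sigma(i+j)$, and $\Sigma_{i,j}:\mathfrak g^{\otimes i}\otimes\mathfrak g^{\otimes j}\to\mathfrak g^{\otimes(i+j)}$, $x_1\otimes\cdots\otimes x_{i+j}\mapsto\sum_{\sigma\in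 \mathrm S_{i,j}}\varepsilon_\sigma x_{\sigma(1)}\otimes\cdots\otimes x_{\sigma(i+j)}$, where $\varepsilon_\sigma$ is $\mathrm{sgn}(\sigma)$ times the Koszul sign of permuting the graded elements. Homotopy Lie algebra: a graded vector space $\mathfrak g$ with graded skew-symmetric maps $\ell^i:\bigwedge^i\mathfrak g\to\mathfrak g[2-i]$, $i\ge1$, such that for all $i\ge 1$: $\sum_{\tilde j+k=i}(-1)^{\tilde j}\ell^j(\ell^k\otimes 1_{\tilde j})\Sigma_{k,\tilde j}=0$ ($j,k\ge1$). Intertwiners. For graded vector spaces $U,V$, an intertwiner $f:U\rightsquigarrow V[n]$ of degree $|f|=n$ is a family of fully graded skew-symmetric graded linear maps $\{f^i:\mathfrak g^{\otimes\tilde i}\otimes U\to V[n-\tilde i]\}_{i\ge 1}$: skew-symmetric in the $\mathfrak g$-entries, and (by convention) the entry of $U$ is moved to other positions by the same rule, e.g. $f^i(\dots,x,u)=-(-1)^{|x||u|}f^i(\dots,u,x)$. The identity intertwiner $\mathbf 1_U$ has $(\mathbf 1_U)^1=1_U$ and other components $0$. $\ell_U:U\rightsquigarrow(\mathfrak g\otimes U)[2]$ has $\ell_U^i:=\ell^{\tilde i}\otimes 1_U$ for $i\ge2$, $\ell_U^1:=0$. For $f:U\rightsquigarrow V[|f|]$, $\varrho_f:\mathfrak g\otimes U\rightsquigarrow V[|f|-1]$ is $\varrho_f^i:=(-1)^if^{i+1}$. Juxtaposition of $f:U\rightsquigarrow V[|f|]$ and $g:V\rightsquigarrow W[|g|]$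 is $gf:U\rightsquigarrow W[|g|+|f|]$, $(gf)^i:=\sum_{\tilde j+k=i}(-1)^{(|g|-\tilde j)\tilde k}g^j[1_{\tilde j}\otimes f^k][\Sigma_{\tilde j,\tilde k}\otimes 1_U]$ ($j,k\ge1$). A representation of $\mathfrak g$ is a graded vector space $V$ with an intertwiner $\rho_V:V\rightsquigarrow V[1]$ such that $\rho_V\rho_V=\varrho_{\rho_V}\ell_V$. A dg-category has hom cochain complexes, units that are $0$-cocycles, and associative unital composition maps that are cochain maps out of the tensor product of hom-complexes. *)

theory Defs
  imports "HOL-Algebra.AbelCoset" "HOL-Algebra.Module" "HOL-Combinatorics.Permutations"
begin

section \<open>Graded vector spaces\<close>

text \<open>
  A graded vector space is the family of its homogeneous components.  A homogeneous element is a
  pair of a degree and an element of the component of that degree, and a list of homogeneous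
  elements stands for their tensor product.  A linear map out of a tensor product is given by the
  corresponding multilinear function of homogeneous elements.
\<close>

type_synonym ('k, 'v) graded = "int \<Rightarrow> ('k, 'v) module"
type_synonym 'v homogeneous = "int \<times> 'v"

definition graded_vector_space :: "('k, 'm) ring_scheme \<Rightarrow> ('k, 'v) graded \<Rightarrow> bool" where
  "graded_vector_space K V \<longleftrightarrow> field K \<and> (\<forall>m. module K (V m))"

definition homogs :: "('k, 'v) graded \<Rightarrow> 'v homogeneous set" where
  "homogs V = (SIGMA m:UNIV. carrier (V m))"

definition shift :: "('k, 'v) graded \<Rightarrow> int \<Rightarrow> ('k, 'v) graded" where
  "shift V n = (\<lambda>m. V (m + n))"

definition degs :: "'v homogeneous list \<Rightarrow> int" where
  "degs xs = sum_list (map fst xs)"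

text \<open>\<open>neg1 n\<close> is $(-1)^n$; a sign acts on a vector as an integer multiple \<open>[s] \<cdot> x\<close>.\<close>

definition neg1 :: "int \<Rightarrow> int" where
  "neg1 n = (if even n then 1 else - 1)"

definition linear_maps ::
    "('k, 'm) ring_scheme \<Rightarrow> ('k, 'u) module \<Rightarrow> ('k, 'v) module \<Rightarrow> ('u \<Rightarrow> 'v) set" where
  "linear_maps K M N = {h \<in> carrier M \<rightarrow> carrier N.
     (\<forall>x\<in>carrier M. \<forall>y\<in>carrier M. h (x \<oplus>\<^bsub>M\<^esub> y) = h x \<oplus>\<^bsub>N\<^esub> h y) \<and>
     (\<forall>c\<in>carrier K. \<forall>x\<in>carrier M. h (c \<odot>\<^bsub>M\<^esub> x) = c \<odot>\<^bsub>N\<^esub> h x)}"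

text \<open>Graded skew-symmetric maps \<open>h : \<gg>\<^sup>\<otimes>\<^sup>i \<rightarrow> W\<close>, that is, graded linear maps on the \<open>i\<close>-th exterior
  power of \<open>\<gg>\<close>.  Only the values of \<open>h\<close> on lists of length \<open>i\<close> are constrained.\<close>

definition skew_multilinear ::
    "('k, 'm) ring_scheme \<Rightarrow> ('k, 'g) graded \<Rightarrow> nat \<Rightarrow> ('k, 'v) graded \<Rightarrow>
     ('g homogeneous list \<Rightarrow> 'v) \<Rightarrow> bool" where
  "skew_multilinear K \<gg> i W h \<longleftrightarrow>
     (\<forall>as\<in>lists (homogs \<gg>). \<forall>bs\<in>lists (homogs \<gg>). length as + 1 + length bs = i \<longrightarrow>
        (\<forall>p. (\<lambda>x. h (as @ (p, x) # bs)) \<in> linear_maps K (\<gg> p) (W (degs as + p + degs bs)))) \<and>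
     (\<forall>as\<in>lists (homogs \<gg>). \<forall>bs\<in>lists (homogs \<gg>). \<forall>x\<in>homogs \<gg>. \<forall>y\<in>homogs \<gg>.
        length as + 2 + length bs = i \<longrightarrow>
        h (as @ x # y # bs) =
          [(- neg1 (fst x * fst y))] \<cdot>\<^bsub>W (degs as + fst x + fst y + degs bs)\<^esub> h (as @ y # x # bs))"

section \<open>Shuffles\<close>

definition shuffle_perms :: "nat \<Rightarrow> nat \<Rightarrow> (nat \<Rightarrow> nat) set" where
  "shuffle_perms i j = {\<sigma>. \<sigma> permutes {..<i + j} \<and>
     strict_mono_on {..<i} \<sigma> \<and> strict_mono_on {i..<i + j} \<sigma>}"

text \<open>The sign \<open>\<epsilon>\<^sub>\<sigma>\<close> of passing from \<open>xs\<close> to \<open>permute_list \<sigma> xs\<close>: the Koszul sign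
  collects a factor for every pair of entries whose order is reversed.\<close>

definition perm_sign :: "(nat \<Rightarrow> nat) \<Rightarrow> 'g homogeneous list \<Rightarrow> int" where
  "perm_sign \<sigma> xs = sign \<sigma> *
     (\<Prod>(i, j) \<in> {(i, j). i < j \<and> j < length xs \<and> \<sigma> j < \<sigma> i}.
        neg1 (fst (xs ! \<sigma> i) * fst (xs ! \<sigma> j)))"

text \<open>The value at \<open>xs\<close> of \<open>h \<circ> \<Sigma>\<^sub>i\<^sub>,\<^sub>j\<close>, where \<open>h\<close> takes its values in \<open>M\<close>.\<close>

definition shuffle_sum ::
    "('k, 'v) module \<Rightarrow> nat \<Rightarrow> nat \<Rightarrow> ('g homogeneous list \<Rightarrow> 'v) \<Rightarrow> 'g homogeneous list \<Rightarrow> 'v" where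
  "shuffle_sum M i j h xs =
     (\<Oplus>\<^bsub>M\<^esub>\<sigma>\<in>shuffle_perms i j. [perm_sign \<sigma> xs] \<cdot>\<^bsub>M\<^esub> h (permute_list \<sigma> xs))"

section \<open>Homotopy Lie algebras\<close>

text \<open>The bracket \<open>\<ell>\<^sup>i\<close> is the restriction of \<open>l\<close> to lists of length \<open>i\<close>; the value of \<open>l\<close> on the
  empty list plays no role.  In the relation for \<open>i = n\<close>, the indices of the brackets are
  \<open>k\<close> and \<open>n - k + 1\<close>, and the sum lies in \<open>\<gg>[3 - n]\<close>.\<close>

definition homotopy_lie_algebra ::
    "('k, 'm) ring_scheme \<Rightarrow> ('k, 'g) graded \<Rightarrow> ('g homogeneous list \<Rightarrow> 'g) \<Rightarrow> bool" where
  "homotopy_lie_algebra K \<gg> l \<longleftrightarrow>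
     graded_vector_space K \<gg> \<and>
     (\<forall>i\<ge>1. skew_multilinear K \<gg> i (shift \<gg> (2 - int i)) l) \<and>
     (\<forall>n\<ge>1. \<forall>xs\<in>lists (homogs \<gg>). length xs = n \<longrightarrow>
        (let M = shift \<gg> (3 - int n) (degs xs)
         in (\<Oplus>\<^bsub>M\<^esub>k\<in>{1..n}. [neg1 (int (n - k))] \<cdot>\<^bsub>M\<^esub>
               shuffle_sum M k (n - k)
                 (\<lambda>ys. l ((2 - int k + degs (take k ys), l (take k ys)) # drop k ys)) xs)
            = \<zero>\<^bsub>M\<^esub>))"

section \<open>Tensor product of two graded vector spaces\<close>

definition tensor_basis ::
    "('k, 'u) graded \<Rightarrow> ('k, 'v) graded \<Rightarrow> int \<Rightarrow> ('u homogeneous \<times> 'v homogeneous) set" where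
  "tensor_basis U V n = {(x, y). x \<in> homogs U \<and> y \<in> homogs V \<and> fst x + fst y = n}"

definition free_module :: "('k, 'm) ring_scheme \<Rightarrow> 'b set \<Rightarrow> ('k, 'b \<Rightarrow> 'k) module" where
  "free_module K B =
     \<lparr>carrier = {\<phi>. range \<phi> \<subseteq> carrier K \<and> finite {b. \<phi> b \<noteq> \<zero>\<^bsub>K\<^esub>} \<and> {b. \<phi> b \<noteq> \<zero>\<^bsub>K\<^esub>} \<subseteq> B},
      monoid.mult = undefined, one = undefined,
      zero = (\<lambda>_. \<zero>\<^bsub>K\<^esub>), add = (\<lambda>\<phi> \<psi> b. \<phi> b \<oplus>\<^bsub>K\<^esub> \<psi> b),
      smult = (\<lambda>c \<phi> b. c \<otimes>\<^bsub>K\<^esub> \<phi> b)\<rparr>"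

definition free_gen :: "('k, 'm) ring_scheme \<Rightarrow> 'b \<Rightarrow> 'b \<Rightarrow> 'k" where
  "free_gen K b = (\<lambda>b'. if b' = b then \<one>\<^bsub>K\<^esub> else \<zero>\<^bsub>K\<^esub>)"

abbreviation tensor_free ::
    "('k, 'm) ring_scheme \<Rightarrow> ('k, 'u) graded \<Rightarrow> ('k, 'v) graded \<Rightarrow> int \<Rightarrow>
     ('k, 'u homogeneous \<times> 'v homogeneous \<Rightarrow> 'k) module" where
  "tensor_free K U V n \<equiv> free_module K (tensor_basis U V n)"

definition tensor_relators ::
    "('k, 'm) ring_scheme \<Rightarrow> ('k, 'u) graded \<Rightarrow> ('k, 'v) graded \<Rightarrow> int \<Rightarrow>
     ('u homogeneous \<times> 'v homogeneous \<Rightarrow> 'k) set" where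
  "tensor_relators K U V n = (let F = tensor_free K U V n; e = free_gen K in
     {e ((p, x \<oplus>\<^bsub>U p\<^esub> x'), (q, y)) \<ominus>\<^bsub>F\<^esub> (e ((p, x), (q, y)) \<oplus>\<^bsub>F\<^esub> e ((p, x'), (q, y))) | p q x x' y.
        p + q = n \<and> x \<in> carrier (U p) \<and> x' \<in> carrier (U p) \<and> y \<in> carrier (V q)} \<union>
     {e ((p, x), (q, y \<oplus>\<^bsub>V q\<^esub> y')) \<ominus>\<^bsub>F\<^esub> (e ((p, x), (q, y)) \<oplus>\<^bsub>F\<^esub> e ((p, x), (q, y'))) | p q x y y'.
        p + q = n \<and> x \<in> carrier (U p) \<and> y \<in> carrier (V q) \<and> y' \<in> carrier (V q)} \<union>
     {e ((p, c \<odot>\<^bsub>U p\<^esub> x), (q, y)) \<ominus>\<^bsub>F\<^esub> (c \<odot>\<^bsub>F\<^esub> e ((p, x), (q, y))) | p q c x y.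
        p + q = n \<and> c \<in> carrier K \<and> x \<in> carrier (U p) \<and> y \<in> carrier (V q)} \<union>
     {e ((p, x), (q, c \<odot>\<^bsub>V q\<^esub> y)) \<ominus>\<^bsub>F\<^esub> (c \<odot>\<^bsub>F\<^esub> e ((p, x), (q, y))) | p q c x y.
        p + q = n \<and> c \<in> carrier K \<and> x \<in> carrier (U p) \<and> y \<in> carrier (V q)})"

definition tensor_null ::
    "('k, 'm) ring_scheme \<Rightarrow> ('k, 'u) graded \<Rightarrow> ('k, 'v) graded \<Rightarrow> int \<Rightarrow>
     ('u homogeneous \<times> 'v homogeneous \<Rightarrow> 'k) set" where
  "tensor_null K U V n =
     \<Inter>{N. submodule N K (tensor_free K U V n) \<and> tensor_relators K U V n \<subseteq> N}"

definition tensor ::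
    "('k, 'm) ring_scheme \<Rightarrow> ('k, 'u) graded \<Rightarrow> ('k, 'v) graded \<Rightarrow>
     ('k, ('u homogeneous \<times> 'v homogeneous \<Rightarrow> 'k) set) graded" where
  "tensor K U V n = (let F = tensor_free K U V n; N = tensor_null K U V n in
     \<lparr>carrier = a_rcosets\<^bsub>F\<^esub> N, monoid.mult = undefined, one = undefined,
      zero = N, add = (\<lambda>S T. S <+>\<^bsub>F\<^esub> T),
      smult = (\<lambda>c S. \<Union>\<phi>\<in>S. N +>\<^bsub>F\<^esub> (c \<odot>\<^bsub>F\<^esub> \<phi>))\<rparr>)"

definition pure_tensor ::
    "('k, 'm) ring_scheme \<Rightarrow> ('k, 'u) graded \<Rightarrow> ('k, 'v) graded \<Rightarrow>
     'u homogeneous \<Rightarrow> 'v homogeneous \<Rightarrow> ('u homogeneous \<times> 'v homogeneous \<Rightarrow> 'k) set" where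
  "pure_tensor K U V x y = (let n = fst x + fst y in
     tensor_null K U V n +>\<^bsub>tensor_free K U V n\<^esub> free_gen K (x, y))"

text \<open>The linear map induced by a bilinear \<open>h\<close> with values in \<open>M\<close>: all representatives of the
  class \<open>t\<close> give the same value.\<close>

definition tensor_lift ::
    "('k, 'm) ring_scheme \<Rightarrow> ('k, 'w) module \<Rightarrow> ('u homogeneous \<Rightarrow> 'v homogeneous \<Rightarrow> 'w) \<Rightarrow>
     ('u homogeneous \<times> 'v homogeneous \<Rightarrow> 'k) set \<Rightarrow> 'w" where
  "tensor_lift K M h t =
     the_elem ((\<lambda>\<phi>. \<Oplus>\<^bsub>M\<^esub>b\<in>{b. \<phi> b \<noteq> \<zero>\<^bsub>K\<^esub>}. \<phi> b \<odot>\<^bsub>M\<^esub> h (fst b) (snd b)) ` t)"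

section \<open>Intertwiners\<close>

text \<open>An intertwiner \<open>f\<close> maps \<open>(xs, u)\<close> to \<open>f\<^sup>i(xs \<otimes> u)\<close> with \<open>i = length xs + 1\<close>, so the family of
  its components is a single function, required to be \<open>undefined\<close> outside its domain in order
  that equality of intertwiners is equality of components.  The entry from \<open>U\<close> always comes last;
  the convention for moving it elsewhere is not needed.\<close>

type_synonym ('g, 'u, 'v) itw = "'g homogeneous list \<times> 'u homogeneous \<Rightarrow> 'v"

definition itw_dom ::
    "('k, 'g) graded \<Rightarrow> ('k, 'u) graded \<Rightarrow> ('g homogeneous list \<times> 'u homogeneous) set" where
  "itw_dom \<gg> U = lists (homogs \<gg>) \<times> homogs U"

text \<open>The component of \<open>V[n - (i - 1)]\<close> that contains \<open>f\<^sup>i(xs \<otimes> u)\<close> if \<open>f\<close> has degree \<open>n\<close>.\<close>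

definition itw_target ::
    "('k, 'v) graded \<Rightarrow> int \<Rightarrow> 'g homogeneous list \<Rightarrow> int \<Rightarrow> ('k, 'v) module" where
  "itw_target V n xs m = shift V (n - int (length xs)) (degs xs + m)"

definition intertwiners ::
    "('k, 'm) ring_scheme \<Rightarrow> ('k, 'g) graded \<Rightarrow> ('k, 'u) graded \<Rightarrow> ('k, 'v) graded \<Rightarrow> int \<Rightarrow>
     ('g, 'u, 'v) itw set" where
  "intertwiners K \<gg> U V n =
     {f \<in> (\<Pi>\<^sub>E (xs, u) \<in> itw_dom \<gg> U. carrier (itw_target V n xs (fst u))).
        (\<forall>u\<in>homogs U. \<forall>i\<ge>1.
           skew_multilinear K \<gg> (i - 1) (shift V (n - int (i - 1) + fst u)) (\<lambda>xs. f (xs, u))) \<and>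
        (\<forall>xs\<in>lists (homogs \<gg>). \<forall>m.
           (\<lambda>y. f (xs, (m, y))) \<in> linear_maps K (U m) (itw_target V n xs m))}"

definition itw_space ::
    "('k, 'm) ring_scheme \<Rightarrow> ('k, 'g) graded \<Rightarrow> ('k, 'u) graded \<Rightarrow> ('k, 'v) graded \<Rightarrow>
     ('k, ('g, 'u, 'v) itw) graded" where
  "itw_space K \<gg> U V n =
     \<lparr>carrier = intertwiners K \<gg> U V n, monoid.mult = undefined, one = undefined,
      zero = (\<lambda>(xs, u)\<in>itw_dom \<gg> U. \<zero>\<^bsub>itw_target V n xs (fst u)\<^esub>),
      add = (\<lambda>f f'. \<lambda>(xs, u)\<in>itw_dom \<gg> U. f (xs, u) \<oplus>\<^bsub>itw_target V n xs (fst u)\<^esub> f' (xs, u)),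
      smult = (\<lambda>c f. \<lambda>(xs, u)\<in>itw_dom \<gg> U. c \<odot>\<^bsub>itw_target V n xs (fst u)\<^esub> f (xs, u))\<rparr>"

definition itw_id :: "('k, 'g) graded \<Rightarrow> ('k, 'u) graded \<Rightarrow> ('g, 'u, 'u) itw" where
  "itw_id \<gg> U = (\<lambda>(xs, u)\<in>itw_dom \<gg> U.
     if xs = [] then snd u else \<zero>\<^bsub>itw_target U 0 xs (fst u)\<^esub>)"

text \<open>The intertwiner \<open>\<ell>\<^sub>U : U \<leadsto> (\<gg> \<otimes> U)[2]\<close>.\<close>

definition itw_ell ::
    "('k, 'm) ring_scheme \<Rightarrow> ('k, 'g) graded \<Rightarrow> ('g homogeneous list \<Rightarrow> 'g) \<Rightarrow> ('k, 'u) graded \<Rightarrow>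
     ('g, 'u, ('g homogeneous \<times> 'u homogeneous \<Rightarrow> 'k) set) itw" where
  "itw_ell K \<gg> l U = (\<lambda>(xs, u)\<in>itw_dom \<gg> U.
     if xs = [] then \<zero>\<^bsub>itw_target (tensor K \<gg> U) 2 xs (fst u)\<^esub>
     else pure_tensor K \<gg> U (2 - int (length xs) + degs xs, l xs) u)"

text \<open>The intertwiner $\varrho_f$ from \<open>\<gg> \<otimes> U\<close> to \<open>V[n - 1]\<close> associated with \<open>f : U \<leadsto> V[n]\<close>; its
  component \<open>i\<close> at \<open>xs \<otimes> (x \<otimes> u)\<close> is $(-1)^i$ times \<open>f\<^sup>i\<^sup>+\<^sup>1(xs \<otimes> x \<otimes> u)\<close>.\<close>

definition itw_varrho ::
    "('k, 'm) ring_scheme \<Rightarrow> ('k, 'g) graded \<Rightarrow> ('k, 'u) graded \<Rightarrow> ('k, 'v) graded \<Rightarrow> int \<Rightarrow>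
     ('g, 'u, 'v) itw \<Rightarrow> ('g, ('g homogeneous \<times> 'u homogeneous \<Rightarrow> 'k) set, 'v) itw" where
  "itw_varrho K \<gg> U V n f = (\<lambda>(xs, t)\<in>itw_dom \<gg> (tensor K \<gg> U).
     let M = itw_target V (n - 1) xs (fst t)
     in [neg1 (int (length xs + 1))] \<cdot>\<^bsub>M\<^esub> tensor_lift K M (\<lambda>x u. f (xs @ [x], u)) (snd t))"

text \<open>The juxtaposition of \<open>f : U \<leadsto> V[q]\<close> and \<open>g : V \<leadsto> W[p]\<close>.  In the summand, \<open>a\<close> and
  \<open>b\<close> are the numbers of \<open>\<gg>\<close>-entries of the components \<open>g\<^sup>a\<^sup>+\<^sup>1\<close> and \<open>f\<^sup>b\<^sup>+\<^sup>1\<close>, so that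
  $(-1)^{(p - a)b}$ is the sign in the definition of the juxtaposition, while
  $(-1)^{(q - b)(|y_1| + \cdots + |y_a|)}$ is the Koszul sign of \<open>1\<^sub>a \<otimes> f\<^sup>b\<^sup>+\<^sup>1\<close>, a map of degree \<open>q - b\<close>.\<close>

definition juxt ::
    "('k, 'g) graded \<Rightarrow> ('k, 'u) graded \<Rightarrow> ('k, 'w) graded \<Rightarrow> int \<Rightarrow> int \<Rightarrow>
     ('g, 'v, 'w) itw \<Rightarrow> ('g, 'u, 'v) itw \<Rightarrow> ('g, 'u, 'w) itw" where
  "juxt \<gg> U W p q g f = (\<lambda>(xs, u)\<in>itw_dom \<gg> U.
     let M = itw_target W (p + q) xs (fst u)
     in \<Oplus>\<^bsub>M\<^esub>a\<in>{..length xs}. let b = length xs - a in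
          [neg1 ((p - int a) * int b)] \<cdot>\<^bsub>M\<^esub>
          shuffle_sum M a b
            (\<lambda>ys. [neg1 ((q - int b) * degs (take a ys))] \<cdot>\<^bsub>M\<^esub>
                  g (take a ys, (q - int b + degs (drop a ys) + fst u, f (drop a ys, u)))) xs)"

section \<open>Representations\<close>

type_synonym ('k, 'g, 'v) rep = "('k, 'v) graded \<times> ('g, 'v, 'v) itw"

definition representation ::
    "('k, 'm) ring_scheme \<Rightarrow> ('k, 'g) graded \<Rightarrow> ('g homogeneous list \<Rightarrow> 'g) \<Rightarrow>
     ('k, 'g, 'v) rep \<Rightarrow> bool" where
  "representation K \<gg> l = (\<lambda>(V, \<rho>).
     graded_vector_space K V \<and> \<rho> \<in> intertwiners K \<gg> V V 1 \<and>
     juxt \<gg> V V 1 1 \<rho> \<rho> = juxt \<gg> V V 0 2 (itw_varrho K \<gg> V V 1 \<rho>) (itw_ell K \<gg> l V))"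

text \<open>The three terms below are intertwiners of degree \<open>1 + n = n + 1 = (n - 1) + 2\<close>.\<close>

definition itw_diff ::
    "('k, 'm) ring_scheme \<Rightarrow> ('k, 'g) graded \<Rightarrow> ('g homogeneous list \<Rightarrow> 'g) \<Rightarrow>
     ('k, 'g, 'u) rep \<Rightarrow> ('k, 'g, 'v) rep \<Rightarrow> int \<Rightarrow> ('g, 'u, 'v) itw \<Rightarrow> ('g, 'u, 'v) itw" where
  "itw_diff K \<gg> l = (\<lambda>(U, \<rho>\<^sub>U) (V, \<rho>\<^sub>V) n f. let H = itw_space K \<gg> U V (n + 1) in
     juxt \<gg> U V 1 n \<rho>\<^sub>V f
       \<ominus>\<^bsub>H\<^esub> ([neg1 n] \<cdot>\<^bsub>H\<^esub> juxt \<gg> U V n 1 f \<rho>\<^sub>U)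
       \<ominus>\<^bsub>H\<^esub> juxt \<gg> U V (n - 1) 2 (itw_varrho K \<gg> U V n f) (itw_ell K \<gg> l U))"

section \<open>Differential graded categories\<close>

definition cochain_complex ::
    "('k, 'm) ring_scheme \<Rightarrow> ('k, 'c) graded \<Rightarrow> (int \<Rightarrow> 'c \<Rightarrow> 'c) \<Rightarrow> bool" where
  "cochain_complex K C d \<longleftrightarrow>
     graded_vector_space K C \<and>
     (\<forall>n. d n \<in> linear_maps K (C n) (C (n + 1))) \<and>
     (\<forall>n. \<forall>x\<in>carrier (C n). d (n + 1) (d n x) = \<zero>\<^bsub>C (n + 1 + 1)\<^esub>)"

text \<open>\<open>dg_comp C X Y Z p q g f\<close> is the composite of \<open>f : X \<rightarrow> Y\<close> of degree \<open>q\<close> and \<open>g : Y \<rightarrow> Z\<close> of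
  degree \<open>p\<close>.\<close>

record ('k, 'o, 'f) dg_cat =
  dg_obj :: "'o set"
  dg_hom :: "'o \<Rightarrow> 'o \<Rightarrow> ('k, 'f) graded"
  dg_diff :: "'o \<Rightarrow> 'o \<Rightarrow> int \<Rightarrow> 'f \<Rightarrow> 'f"
  dg_comp :: "'o \<Rightarrow> 'o \<Rightarrow> 'o \<Rightarrow> int \<Rightarrow> int \<Rightarrow> 'f \<Rightarrow> 'f \<Rightarrow> 'f"
  dg_unit :: "'o \<Rightarrow> 'f"

text \<open>A cochain map out of the tensor product of two hom-complexes is a family of bilinear maps
  satisfying the Leibniz rule.\<close>

locale dg_category =
  fixes K :: "('k, 'm) ring_scheme" and C :: "('k, 'o, 'f) dg_cat"
  assumes hom_complex: "\<lbrakk>X \<in> dg_obj C; Y \<in> dg_obj C\<rbrakk> \<Longrightarrow>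
      cochain_complex K (dg_hom C X Y) (dg_diff C X Y)"
    and comp_linear_left: "\<lbrakk>X \<in> dg_obj C; Y \<in> dg_obj C; Z \<in> dg_obj C;
      f \<in> carrier (dg_hom C X Y q)\<rbrakk> \<Longrightarrow>
      (\<lambda>g. dg_comp C X Y Z p q g f) \<in> linear_maps K (dg_hom C Y Z p) (dg_hom C X Z (p + q))"
    and comp_linear_right: "\<lbrakk>X \<in> dg_obj C; Y \<in> dg_obj C; Z \<in> dg_obj C;
      g \<in> carrier (dg_hom C Y Z p)\<rbrakk> \<Longrightarrow>
      (\<lambda>f. dg_comp C X Y Z p q g f) \<in> linear_maps K (dg_hom C X Y q) (dg_hom C X Z (p + q))"
    and leibniz: "\<lbrakk>X \<in> dg_obj C; Y \<in> dg_obj C; Z \<in> dg_obj C;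
      g \<in> carrier (dg_hom C Y Z p); f \<in> carrier (dg_hom C X Y q)\<rbrakk> \<Longrightarrow>
      dg_diff C X Z (p + q) (dg_comp C X Y Z p q g f) =
        dg_comp C X Y Z (p + 1) q (dg_diff C Y Z p g) f
          \<oplus>\<^bsub>dg_hom C X Z (p + q + 1)\<^esub>
        ([neg1 p] \<cdot>\<^bsub>dg_hom C X Z (p + q + 1)\<^esub>
           dg_comp C X Y Z p (q + 1) g (dg_diff C X Y q f))"
    and comp_assoc: "\<lbrakk>X \<in> dg_obj C; Y \<in> dg_obj C; Z \<in> dg_obj C; T \<in> dg_obj C;
      h \<in> carrier (dg_hom C Z T r); g \<in> carrier (dg_hom C Y Z p);
      f \<in> carrier (dg_hom C X Y q)\<rbrakk> \<Longrightarrow>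
      dg_comp C X Y T (r + p) q (dg_comp C Y Z T r p h g) f =
        dg_comp C X Z T r (p + q) h (dg_comp C X Y Z p q g f)"
    and unit_closed: "X \<in> dg_obj C \<Longrightarrow> dg_unit C X \<in> carrier (dg_hom C X X 0)"
    and unit_cocycle: "X \<in> dg_obj C \<Longrightarrow>
      dg_diff C X X 0 (dg_unit C X) = \<zero>\<^bsub>dg_hom C X X 1\<^esub>"
    and comp_unit_left: "\<lbrakk>X \<in> dg_obj C; Y \<in> dg_obj C; f \<in> carrier (dg_hom C X Y q)\<rbrakk> \<Longrightarrow>
      dg_comp C X Y Y 0 q (dg_unit C Y) f = f"
    and comp_unit_right: "\<lbrakk>X \<in> dg_obj C; Y \<in> dg_obj C; f \<in> carrier (dg_hom C X Y q)\<rbrakk> \<Longrightarrow>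
      dg_comp C X X Y q 0 f (dg_unit C X) = f"

text \<open>All representations whose homogeneous components have their elements in the type \<open>'v\<close> are
  objects; the type \<open>'v\<close> takes the role of a universe.\<close>

definition Rep ::
    "('k, 'm) ring_scheme \<Rightarrow> ('k, 'g) graded \<Rightarrow> ('g homogeneous list \<Rightarrow> 'g) \<Rightarrow>
     ('k, ('k, 'g, 'v) rep, ('g, 'v, 'v) itw) dg_cat" where
  "Rep K \<gg> l =
     \<lparr>dg_obj = {V. representation K \<gg> l V},
      dg_hom = (\<lambda>U V. itw_space K \<gg> (fst U) (fst V)),
      dg_diff = itw_diff K \<gg> l,
      dg_comp = (\<lambda>U V W p q g f. juxt \<gg> (fst U) (fst W) p q g f),
      dg_unit = (\<lambda>U. itw_id \<gg> (fst U))\<rparr>"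

end

theory Submission
  imports Defs
begin

text \<open>
  An intertwiner of degree \<open>n\<close> from \<open>U\<close> to \<open>V\<close> is a linear map from the exterior coalgebra of \<open>\<gg>\<close>,
  tensored with \<open>U\<close>, to \<open>V\<close>, and both operations of the category come from this coalgebra.

  The coproduct distributes the entries of a list over two lists in all ways that keep their order
  (\<open>unshuffle_sum\<close>), and the juxtaposition \<open>gf\<close> is \<open>g\<close> after \<open>1 \<otimes> f\<close> after the coproduct.  It is
  therefore associative because the coproduct is coassociative (\<open>unshuffle_sum_coassoc\<close>,
  \<open>juxt_assoc\<close>), and \<open>itw_id\<close> is a unit because the projection to the empty list is a counit.

  The brackets, applied to one factor of the coproduct and followed by the product with the other
  factor, form a coderivation of the coalgebra.  Up to signs, the term of the hom differential that
  involves the brackets, \<open>\<delta>f = ell_action f\<close>, is the composite of \<open>f\<close> with this coderivation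
  (\<open>ell_action_apply\<close>).  Two facts about \<open>\<delta>\<close> carry the proof.
  \<^item> \<open>\<delta>(gf) = (\<delta>g)f + (-1)\<^sup>p g(\<delta>f)\<close> for \<open>g\<close> of degree \<open>p\<close>, since a bracketed sublist ends up in
    one of the two factors of the coproduct (\<open>ell_action_juxt\<close>).
  \<^item> \<open>\<delta>\<delta>f = 0\<close>: terms with nested brackets cancel by the homotopy Jacobi identities, and terms with
    two disjoint brackets cancel in pairs because the two brackets anticommute
    (\<open>ell_action_square\<close>).

  A representation satisfies \<open>\<rho>\<rho> = \<delta>\<rho>\<close>, and the differential of \<open>f\<close>, of degree \<open>n\<close>, is
  \<open>\<rho>f - (-1)\<^sup>n f\<rho> - \<delta>f\<close>.  Leibniz rule and vanishing square are now identities between a few elements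
  of the abelian groups of intertwiners (\<open>leibniz_identity\<close>, \<open>differential_square_identity\<close>).

  The signs in sums over unshuffles have the form \<open>neg1 e\<close>, and identities between them are checked
  by comparing exponents modulo 2.  The values of an intertwiner lie in different components of the
  target, depending on the arguments; the index of the component is therefore usually a variable
  that is only determined by an equation.
\<close>

section \<open>Signs and linear maps\<close>

lemma neg1_mult: "neg1 a * neg1 b = neg1 (a + b)"
  by (simp add: neg1_def)

lemma neg1_cong: "even (a - b) \<Longrightarrow> neg1 a = neg1 b"
  by (auto simp: neg1_def)

lemma minus_neg1: "- neg1 a = neg1 (a + 1)"
  by (simp add: neg1_def)

lemma neg1_0 [simp]: "neg1 0 = 1"
  by (simp add: neg1_def)

lemma degs_simps [simp]:
  "degs [] = 0" "degs (x # xs) = fst x + degs xs" "degs (xs @ ys) = degs xs + degs ys"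
  by (simp_all add: degs_def)

context abelian_group
begin

lemma int_mult_mult: "x \<in> carrier G \<Longrightarrow> [a] \<cdot> ([(b::int)] \<cdot> x) = [(a * b)] \<cdot> x"
  by (simp add: add.int_pow_pow mult.commute)

lemma neg1_act_act: "x \<in> carrier G \<Longrightarrow> [(neg1 a)] \<cdot> ([(neg1 b)] \<cdot> x) = [(neg1 (a + b))] \<cdot> x"
  by (simp add: int_mult_mult neg1_mult)

lemma int_mult_add:
  "x \<in> carrier G \<Longrightarrow> y \<in> carrier G \<Longrightarrow> [(k::int)] \<cdot> (x \<oplus> y) = [k] \<cdot> x \<oplus> [k] \<cdot> y"
  by (simp add: add.int_pow_distrib)

lemma int_mult_zero: "[(k::int)] \<cdot> \<zero> = \<zero>"
  by simp

lemma neg1_act_odd: "x \<in> carrier G \<Longrightarrow> odd a \<Longrightarrow> [(neg1 a)] \<cdot> x = \<ominus> x"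
  by (simp add: neg1_def add.int_pow_neg)

lemma neg1_act_even: "x \<in> carrier G \<Longrightarrow> even a \<Longrightarrow> [(neg1 a)] \<cdot> x = x"
  by (simp add: neg1_def)

end

lemma linear_mapsI:
  assumes "\<And>x. x \<in> carrier M \<Longrightarrow> h x \<in> carrier N"
    and "\<And>x y. x \<in> carrier M \<Longrightarrow> y \<in> carrier M \<Longrightarrow> h (x \<oplus>\<^bsub>M\<^esub> y) = h x \<oplus>\<^bsub>N\<^esub> h y"
    and "\<And>c x. c \<in> carrier K \<Longrightarrow> x \<in> carrier M \<Longrightarrow> h (c \<odot>\<^bsub>M\<^esub> x) = c \<odot>\<^bsub>N\<^esub> h x"
  shows "h \<in> linear_maps K M N"
  using assms by (auto simp: linear_maps_def)

lemma linear_mapsD: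
  assumes "h \<in> linear_maps K M N"
  shows "x \<in> carrier M \<Longrightarrow> h x \<in> carrier N"
    and "x \<in> carrier M \<Longrightarrow> y \<in> carrier M \<Longrightarrow> h (x \<oplus>\<^bsub>M\<^esub> y) = h x \<oplus>\<^bsub>N\<^esub> h y"
    and "c \<in> carrier K \<Longrightarrow> x \<in> carrier M \<Longrightarrow> h (c \<odot>\<^bsub>M\<^esub> x) = c \<odot>\<^bsub>N\<^esub> h x"
  using assms by (auto simp: linear_maps_def)

lemma group_map_int_mult:
  assumes "abelian_group M" "abelian_group N"
    and "\<And>x. x \<in> carrier M \<Longrightarrow> h x \<in> carrier N"
    and "\<And>x y. x \<in> carrier M \<Longrightarrow> y \<in> carrier M \<Longrightarrow> h (x \<oplus>\<^bsub>M\<^esub> y) = h x \<oplus>\<^bsub>N\<^esub> h y"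
    and "x \<in> carrier M"
  shows "h ([(k::int)] \<cdot>\<^bsub>M\<^esub> x) = [k] \<cdot>\<^bsub>N\<^esub> h x"
proof -
  interpret M: abelian_group M by fact
  interpret N: abelian_group N by fact
  have "h \<in> hom (add_monoid M) (add_monoid N)"
    using assms by (auto simp: hom_def)
  from hom_int_pow[OF this _ M.a_group N.a_group] show ?thesis
    using assms(5) by (simp add: add_pow_def)
qed

lemma smult_int_mult:
  assumes "module K M" "c \<in> carrier K" "x \<in> carrier M"
  shows "c \<odot>\<^bsub>M\<^esub> ([(k::int)] \<cdot>\<^bsub>M\<^esub> x) = [k] \<cdot>\<^bsub>M\<^esub> (c \<odot>\<^bsub>M\<^esub> x)"
proof -
  interpret module K M by fact
  show ?thesis
    by (rule group_map_int_mult) (use assms in \<open>auto simp: smult_r_distr M.abelian_group_axioms\<close>)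
qed

lemma linear_maps_int_mult_commute:
  assumes "h \<in> linear_maps K M N" "module K M" "module K N" "x \<in> carrier M"
  shows "h ([(k::int)] \<cdot>\<^bsub>M\<^esub> x) = [k] \<cdot>\<^bsub>N\<^esub> h x"
  using assms by (intro group_map_int_mult) (auto dest: linear_mapsD module.axioms)

lemma linear_maps_zero_value:
  assumes "h \<in> linear_maps K M N" "module K M" "module K N"
  shows "h \<zero>\<^bsub>M\<^esub> = \<zero>\<^bsub>N\<^esub>"
proof -
  interpret M: module K M by fact
  interpret N: module K N by fact
  show ?thesis
    using linear_mapsD(3)[OF assms(1), of "\<zero>\<^bsub>K\<^esub>" "\<zero>\<^bsub>M\<^esub>"] linear_mapsD(1)[OF assms(1), of "\<zero>\<^bsub>M\<^esub>"]
        by simp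
qed

lemma linear_maps_add:
  assumes "module K N" "h \<in> linear_maps K M N" "h' \<in> linear_maps K M N"
  shows "(\<lambda>x. h x \<oplus>\<^bsub>N\<^esub> h' x) \<in> linear_maps K M N"
proof -
  interpret N: module K N by fact
  show ?thesis
    by (rule linear_mapsI)
      (simp_all add: linear_mapsD[OF assms(2)] linear_mapsD[OF assms(3)] N.M.add.m_ac
          N.smult_r_distr)
qed

lemma linear_maps_int_mult:
  assumes "module K N" "h \<in> linear_maps K M N"
  shows "(\<lambda>x. [(k::int)] \<cdot>\<^bsub>N\<^esub> h x) \<in> linear_maps K M N"
proof -
  interpret N: module K N by fact
  show ?thesis
    by (rule linear_mapsI)
      (simp_all add: linear_mapsD[OF assms(2)] N.M.int_mult_add smult_int_mult[OF assms(1)])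
qed

lemma linear_maps_smult:
  assumes "module K N" "h \<in> linear_maps K M N" "c \<in> carrier K"
  shows "(\<lambda>x. c \<odot>\<^bsub>N\<^esub> h x) \<in> linear_maps K M N"
proof -
  interpret N: module K N by fact
  show ?thesis
    by (rule linear_mapsI)
      (simp_all add: linear_mapsD[OF assms(2)] assms(3) N.smult_r_distr N.smult_assoc1[symmetric]
          N.R.m_comm)
qed

lemma linear_maps_zero:
  assumes "module K N"
  shows "(\<lambda>x. \<zero>\<^bsub>N\<^esub>) \<in> linear_maps K M N"
proof -
  interpret N: module K N by fact
  show ?thesis by (rule linear_mapsI) simp_all
qed

lemma linear_maps_comp:
  assumes "h \<in> linear_maps K M N" "h' \<in> linear_maps K N P"
  shows "(\<lambda>x. h' (h x)) \<in> linear_maps K M P"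
  by (rule linear_mapsI) (simp_all add: linear_mapsD[OF assms(1)] linear_mapsD[OF assms(2)])

lemma linear_maps_cong:
  assumes "module K M" "h \<in> linear_maps K M N" "\<And>x. x \<in> carrier M \<Longrightarrow> h x = h' x"
  shows "h' \<in> linear_maps K M N"
proof -
  interpret module K M by fact
  show ?thesis
    by (rule linear_mapsI) (simp_all add: linear_mapsD[OF assms(2)] assms(3)[symmetric])
qed

section \<open>Sums over unshuffles\<close>

text \<open>
  The coproduct of the exterior coalgebra, followed by \<open>F\<close>: the sum of \<open>\<plusminus>F ys zs\<close> over all ways of
  distributing the entries of a list over \<open>ys\<close> and \<open>zs\<close> without changing their order.  In the
  recursion the first entry \<open>x\<close> goes either to \<open>ys\<close>, or to \<open>zs\<close> and then past all entries \<open>y\<close> of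
  \<open>ys\<close>, each of which contributes the factor \<open>-(-1)\<^bsup>|x||y|\<^esup>\<close>.
\<close>

primrec unshuffle_sum :: "('v, 'm) ring_scheme \<Rightarrow>
    ('g homogeneous list \<Rightarrow> 'g homogeneous list \<Rightarrow> 'v) \<Rightarrow> 'g homogeneous list \<Rightarrow> 'v" where
  "unshuffle_sum M F [] = F [] []"
| "unshuffle_sum M F (x # xs) =
     unshuffle_sum M (\<lambda>ys zs. F (x # ys) zs) xs \<oplus>\<^bsub>M\<^esub>
     unshuffle_sum M
       (\<lambda>ys zs. [(neg1 (int (length ys) + fst x * degs ys))] \<cdot>\<^bsub>M\<^esub> F ys (x # zs)) xs"

text \<open>
  The equation between multisets holds for more pairs than the distributions of \<open>xs\<close>, but it is
  stable under the recursion, and it determines the sums of the lengths and of the degrees, hence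
  the component of a graded space in which \<open>F ys zs\<close> lies.
\<close>

lemma unshuffle_sum_cong:
  assumes "\<And>ys zs. mset ys + mset zs = mset xs \<Longrightarrow> F ys zs = F' ys zs"
  shows "unshuffle_sum M F xs = unshuffle_sum M F' xs"
  using assms
proof (induction xs arbitrary: F F')
  case (Cons x xs)
  have "unshuffle_sum M (\<lambda>ys zs. F (x # ys) zs) xs = unshuffle_sum M (\<lambda>ys zs. F' (x # ys) zs) xs"
    by (rule Cons.IH, rule Cons.prems) auto
  moreover have "unshuffle_sum M (\<lambda>ys zs. [(neg1 (int (length ys) + fst x * degs ys))] \<cdot>\<^bsub>M\<^esub>
      F ys (x # zs)) xs
    = unshuffle_sum M (\<lambda>ys zs. [(neg1 (int (length ys) + fst x * degs ys))] \<cdot>\<^bsub>M\<^esub> F' ys (x # zs)) xs"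
    by (rule Cons.IH, subst Cons.prems) auto
  ultimately show ?case by simp
qed simp

lemma splits_lists:
  "mset ys + mset zs = mset xs \<Longrightarrow> xs \<in> lists A \<Longrightarrow> ys \<in> lists A \<and> zs \<in> lists A"
  unfolding in_lists_conv_set
  by (metis UnI1 UnI2 set_mset_mset set_mset_union)

lemma splits_length: "mset ys + mset zs = mset xs \<Longrightarrow> length xs = length ys + length zs"
  by (metis size_mset size_union)

lemma splits_degs: "mset ys + mset zs = mset xs \<Longrightarrow> degs xs = degs ys + degs zs"
  unfolding degs_def by (metis image_mset_union mset_map sum_mset.union sum_mset_sum_list)

context abelian_group
begin

lemma unshuffle_sum_closed:
  assumes "\<And>ys zs. mset ys + mset zs = mset xs \<Longrightarrow> F ys zs \<in> carrier G"
  shows "unshuffle_sum G F xs \<in> carrier G"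
  using assms
proof (induction xs arbitrary: F)
  case (Cons x xs)
  show ?case
    by (auto intro!: Cons.IH add.int_pow_closed Cons.prems)
qed simp

lemma unshuffle_sum_add:
  assumes "\<And>ys zs. mset ys + mset zs = mset xs \<Longrightarrow> F ys zs \<in> carrier G"
    and "\<And>ys zs. mset ys + mset zs = mset xs \<Longrightarrow> F' ys zs \<in> carrier G"
  shows "unshuffle_sum G (\<lambda>ys zs. F ys zs \<oplus> F' ys zs) xs =
    unshuffle_sum G F xs \<oplus> unshuffle_sum G F' xs"
  using assms
proof (induction xs arbitrary: F F')
  case (Cons x xs)
  let ?s = "\<lambda>ys. neg1 (int (length ys) + fst x * degs ys)"
  have c: "F (x # ys) zs \<in> carrier G" "F' (x # ys) zs \<in> carrier G"
    "F ys (x # zs) \<in> carrier G" "F' ys (x # zs) \<in> carrier G" if "mset ys + mset zs = mset xs"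
        for ys zs
    using that by (auto intro!: Cons.prems)
  have 1: "unshuffle_sum G (\<lambda>ys zs. F (x # ys) zs \<oplus> F' (x # ys) zs) xs =
      unshuffle_sum G (\<lambda>ys zs. F (x # ys) zs) xs \<oplus> unshuffle_sum G (\<lambda>ys zs. F' (x # ys) zs) xs"
    by (rule Cons.IH) (auto simp: c)
  have "unshuffle_sum G (\<lambda>ys zs. [(?s ys)] \<cdot> (F ys (x # zs) \<oplus> F' ys (x # zs))) xs =
      unshuffle_sum G (\<lambda>ys zs. [(?s ys)] \<cdot> F ys (x # zs) \<oplus> [(?s ys)] \<cdot> F' ys (x # zs)) xs"
    by (rule unshuffle_sum_cong) (simp add: c int_mult_add)
  also have "\<dots> = unshuffle_sum G (\<lambda>ys zs. [(?s ys)] \<cdot> F ys (x # zs)) xs \<oplus>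
      unshuffle_sum G (\<lambda>ys zs. [(?s ys)] \<cdot> F' ys (x # zs)) xs"
    by (rule Cons.IH) (auto simp: c)
  finally have 2: "unshuffle_sum G (\<lambda>ys zs. [(?s ys)] \<cdot> (F ys (x # zs) \<oplus> F' ys (x # zs))) xs = \<dots>" .
  have "a \<oplus> b \<oplus> (c \<oplus> d) = a \<oplus> c \<oplus> (b \<oplus> d)"
    if "a \<in> carrier G" "b \<in> carrier G" "c \<in> carrier G" "d \<in> carrier G" for a b c d
    using that by (simp add: add.m_ac)
  then show ?case
    by (simp add: 1 2 unshuffle_sum_closed c)
qed simp

end

lemma unshuffle_sum_hom:
  assumes "abelian_group M" "abelian_group N"
    and h: "h \<in> carrier M \<rightarrow> carrier N"
    and add: "\<And>x y. x \<in> carrier M \<Longrightarrow> y \<in> carrier M \<Longrightarrow> h (x \<oplus>\<^bsub>M\<^esub> y) = h x \<oplus>\<^bsub>N\<^esub> h y"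
    and "\<And>ys zs. mset ys + mset zs = mset xs \<Longrightarrow> F ys zs \<in> carrier M"
  shows "h (unshuffle_sum M F xs) = unshuffle_sum N (\<lambda>ys zs. h (F ys zs)) xs"
  using assms(5)
proof (induction xs arbitrary: F)
  case (Cons x xs)
  interpret M: abelian_group M by fact
  interpret N: abelian_group N by fact
  have hom: "h ([(k::int)] \<cdot>\<^bsub>M\<^esub> x) = [k] \<cdot>\<^bsub>N\<^esub> h x" if "x \<in> carrier M" for x k
    by (rule group_map_int_mult[OF M.abelian_group_axioms N.abelian_group_axioms _ add that]) (use
        h in auto)
  let ?s = "\<lambda>ys. neg1 (int (length ys) + fst x * degs ys)"
  have c: "F (x # ys) zs \<in> carrier M" "F ys (x # zs) \<in> carrier M"
    if "mset ys + mset zs = mset xs" for ys zs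
    using that by (auto intro!: Cons.prems)
  have "h (unshuffle_sum M F (x # xs)) = h (unshuffle_sum M (\<lambda>ys zs. F (x # ys) zs) xs) \<oplus>\<^bsub>N\<^esub>
     h (unshuffle_sum M (\<lambda>ys zs. [(?s ys)] \<cdot>\<^bsub>M\<^esub> F ys (x # zs)) xs)"
    by (simp add: add M.unshuffle_sum_closed c)
  also have "\<dots> = unshuffle_sum N (\<lambda>ys zs. h (F (x # ys) zs)) xs \<oplus>\<^bsub>N\<^esub>
     unshuffle_sum N (\<lambda>ys zs. h ([(?s ys)] \<cdot>\<^bsub>M\<^esub> F ys (x # zs))) xs"
    by (subst (1 2) Cons.IH) (auto simp: c)
  also have "\<dots> = unshuffle_sum N (\<lambda>ys zs. h (F ys zs)) (x # xs)"
    by (simp add: hom c cong: unshuffle_sum_cong)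
  finally show ?case .
qed simp

context abelian_group
begin

lemma unshuffle_sum_int_mult:
  assumes "\<And>ys zs. mset ys + mset zs = mset xs \<Longrightarrow> F ys zs \<in> carrier G"
  shows "unshuffle_sum G (\<lambda>ys zs. [(k::int)] \<cdot> F ys zs) xs = [k] \<cdot> unshuffle_sum G F xs"
  by (rule unshuffle_sum_hom[symmetric]) (auto simp: assms int_mult_add abelian_group_axioms)

lemma unshuffle_sum_zero: "unshuffle_sum G (\<lambda>ys zs. \<zero>) xs = \<zero>"
  by (induction xs) simp_all

text \<open>
  Both sides run over the distributions of \<open>xs\<close> over three lists.  The induction compares the three
  destinations of the first entry; the sign picked up on the way to the third list is the product of
  the signs from passing the first and the second one.
\<close>

lemma unshuffle_sum_coassoc:
  assumes "\<And>as bs cs. mset as + mset bs + mset cs = mset xs \<Longrightarrow> F as bs cs \<in> carrier G"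
  shows "unshuffle_sum G (\<lambda>ys cs. unshuffle_sum G (\<lambda>as bs. F as bs cs) ys) xs =
    unshuffle_sum G (\<lambda>as zs. unshuffle_sum G (\<lambda>bs cs. F as bs cs) zs) xs"
  using assms
proof (induction xs arbitrary: F)
  case (Cons x xs)
  let ?s = "\<lambda>ys. neg1 (int (length ys) + fst x * degs ys)"
  let ?F1 = "\<lambda>as bs cs. F (x # as) bs cs"
  let ?F2 = "\<lambda>as bs cs. [(?s as)] \<cdot> F as (x # bs) cs"
  let ?F3 = "\<lambda>as bs cs. [(?s as)] \<cdot> ([(?s bs)] \<cdot> F as bs (x # cs))"
  have c: "F (x # as) bs cs \<in> carrier G" "F as (x # bs) cs \<in> carrier G"
    "F as bs (x # cs) \<in> carrier G" if "mset as + mset bs + mset cs = mset xs" for as bs cs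
    using that by (auto intro!: Cons.prems)
  have assoc: "mset as + (mset bs + mset cs) = mset as + mset bs + mset cs"
      for as bs cs :: "(int \<times> 'f) list"
    by (simp add: add.assoc)
  let ?L = "\<lambda>F. unshuffle_sum G (\<lambda>ys cs. unshuffle_sum G (\<lambda>as bs. F as bs cs) ys) xs"
  let ?R = "\<lambda>F. unshuffle_sum G (\<lambda>as zs. unshuffle_sum G (\<lambda>bs cs. F as bs cs) zs) xs"
  have cl: "?L ?F1 \<in> carrier G" "?L ?F2 \<in> carrier G" "?L ?F3 \<in> carrier G"
    by (auto intro!: unshuffle_sum_closed c add.int_pow_closed)
  have "unshuffle_sum G (\<lambda>ys cs. unshuffle_sum G (\<lambda>as bs. F as bs cs) ys) (x # xs) =
     unshuffle_sum G (\<lambda>ys cs. unshuffle_sum G (\<lambda>as bs. ?F1 as bs cs) ys \<oplus>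
        unshuffle_sum G (\<lambda>as bs. ?F2 as bs cs) ys) xs \<oplus>
     unshuffle_sum G (\<lambda>ys cs. [(?s ys)] \<cdot> (unshuffle_sum G (\<lambda>as bs. F as bs (x # cs)) ys)) xs"
    by simp
  also have "unshuffle_sum G (\<lambda>ys cs. [(?s ys)] \<cdot> (unshuffle_sum G (\<lambda>as bs. F as bs (x # cs)) ys))
      xs
    = ?L ?F3"
  proof (intro unshuffle_sum_cong, goal_cases)
    case (1 ys cs)
    have "[(?s ys)] \<cdot> (unshuffle_sum G (\<lambda>as bs. F as bs (x # cs)) ys) =
      unshuffle_sum G (\<lambda>as bs. [(?s ys)] \<cdot> F as bs (x # cs)) ys"
      using 1 by (subst unshuffle_sum_int_mult) (auto intro!: c)
    also have "\<dots> = unshuffle_sum G (\<lambda>as bs. ?F3 as bs cs) ys"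
    proof (intro unshuffle_sum_cong, goal_cases)
      case (1 as bs)
      then show ?case using \<open>mset ys + mset cs = _\<close>
        by (simp add: neg1_act_act c splits_degs[OF 1] splits_length[OF 1] algebra_simps)
    qed
    finally show ?case .
  qed
  also have "unshuffle_sum G (\<lambda>ys cs. unshuffle_sum G (\<lambda>as bs. ?F1 as bs cs) ys \<oplus>
        unshuffle_sum G (\<lambda>as bs. ?F2 as bs cs) ys) xs = ?L ?F1 \<oplus> ?L ?F2"
    by (rule unshuffle_sum_add) (auto intro!: unshuffle_sum_closed c add.int_pow_closed)
  also have "?L ?F1 \<oplus> ?L ?F2 \<oplus> ?L ?F3 = ?L ?F1 \<oplus> (?L ?F2 \<oplus> ?L ?F3)"
    using cl by (rule a_assoc)
  also have "\<dots> = ?R ?F1 \<oplus> (?R ?F2 \<oplus> ?R ?F3)"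
    by (subst (1 2 3) Cons.IH) (auto intro!: c add.int_pow_closed)
  also have "?R ?F2 \<oplus> ?R ?F3 = unshuffle_sum G (\<lambda>as zs. unshuffle_sum G (\<lambda>bs cs. ?F2 as bs cs) zs \<oplus>
        unshuffle_sum G (\<lambda>bs cs. ?F3 as bs cs) zs) xs"
    by (rule unshuffle_sum_add[symmetric])
       (auto intro!: unshuffle_sum_closed c add.int_pow_closed simp: assoc add.assoc)
  also have "\<dots> = unshuffle_sum G (\<lambda>as zs. [(?s as)] \<cdot> (unshuffle_sum G (\<lambda>bs cs. F as bs cs) (x #
      zs))) xs"
  proof (intro unshuffle_sum_cong, goal_cases)
    case (1 as zs)
    have cc: "F as (x # bs) cs \<in> carrier G" "F as bs (x # cs) \<in> carrier G"
      if "mset bs + mset cs = mset zs" for bs cs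
      using that 1 by (auto intro!: c simp: add.assoc)
    show ?case
      by (simp add: int_mult_add unshuffle_sum_closed cc unshuffle_sum_int_mult)
  qed
  finally show ?case by simp
qed simp

text \<open>
  Graded cocommutativity: exchanging the two lists costs the sign of moving one past the other.
\<close>

lemma unshuffle_sum_cocomm:
  assumes "\<And>ys zs. mset ys + mset zs = mset xs \<Longrightarrow> F ys zs \<in> carrier G"
  shows "unshuffle_sum G F xs = unshuffle_sum G (\<lambda>ys zs.
    [(neg1 (int (length ys * length zs) + degs ys * degs zs))] \<cdot> F zs ys) xs"
  using assms
proof (induction xs arbitrary: F)
  case (Cons x xs)
  let ?s = "\<lambda>ys. neg1 (int (length ys) + fst x * degs ys)"
  let ?t = "\<lambda>ys zs. neg1 (int (length ys * length zs) + degs ys * degs zs)"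
  have c: "F (x # ys) zs \<in> carrier G" "F ys (x # zs) \<in> carrier G"
    "F (x # zs) ys \<in> carrier G" "F zs (x # ys) \<in> carrier G"
    if "mset ys + mset zs = mset xs" for ys zs
    using that by (auto intro!: Cons.prems simp: union_ac)
  have 1: "unshuffle_sum G (\<lambda>ys zs. F (x # ys) zs) xs =
    unshuffle_sum G (\<lambda>ys zs. [(?s ys)] \<cdot> ([(?t ys (x # zs))] \<cdot> F (x # zs) ys)) xs"
  proof -
    have "unshuffle_sum G (\<lambda>ys zs. F (x # ys) zs) xs =
        unshuffle_sum G (\<lambda>ys zs. [(?t ys zs)] \<cdot> F (x # zs) ys) xs"
      by (rule Cons.IH) (simp add: c)
    also have "\<dots> = unshuffle_sum G (\<lambda>ys zs. [(?s ys)] \<cdot> ([(?t ys (x # zs))] \<cdot> F (x # zs) ys)) xs"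
      by (rule unshuffle_sum_cong, simp add: c neg1_act_act,
          rule arg_cong[where f="\<lambda>k. [k] \<cdot> _"], rule neg1_cong) (simp add: algebra_simps)
    finally show ?thesis .
  qed
  have 2: "unshuffle_sum G (\<lambda>ys zs. [(?s ys)] \<cdot> F ys (x # zs)) xs =
    unshuffle_sum G (\<lambda>ys zs. [?t (x # ys) zs] \<cdot> F zs (x # ys)) xs"
  proof -
    have "unshuffle_sum G (\<lambda>ys zs. [(?s ys)] \<cdot> F ys (x # zs)) xs =
        unshuffle_sum G (\<lambda>ys zs. [(?t ys zs)] \<cdot> ([(?s zs)] \<cdot> F zs (x # ys))) xs"
      by (rule Cons.IH) (simp add: c)
    also have "\<dots> = unshuffle_sum G (\<lambda>ys zs. [(?t (x # ys) zs)] \<cdot> F zs (x # ys)) xs"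
      by (rule unshuffle_sum_cong, simp add: c neg1_act_act,
          rule arg_cong[where f="\<lambda>k. [k] \<cdot> _"], rule neg1_cong) (simp add: algebra_simps)
    finally show ?thesis .
  qed
  show ?case
    by (simp only: unshuffle_sum.simps 1 2, rule a_comm)
      (auto intro!: unshuffle_sum_closed add.int_pow_closed c)
qed simp

end

lemma linear_maps_unshuffle_sum:
  assumes "module K N"
    and "\<And>ys zs. mset ys + mset zs = mset xs \<Longrightarrow> (\<lambda>x. G x ys zs) \<in> linear_maps K M N"
  shows "(\<lambda>x. unshuffle_sum N (G x) xs) \<in> linear_maps K M N"
  using assms(2)
proof (induction xs arbitrary: G)
  case (Cons x xs)
  show ?case
    unfolding unshuffle_sum.simps
    by (intro linear_maps_add assms Cons.IH linear_maps_int_mult Cons.prems) auto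
qed simp

section \<open>Shuffle permutations\<close>

text \<open>
  The permutation of \<open>n + 1\<close> numbers that takes the value \<open>0\<close> at position \<open>a\<close> and elsewhere follows
  \<open>\<tau>\<close>, shifted by one.  Permuting \<open>x # xs\<close> by it means permuting \<open>xs\<close> by \<open>\<tau>\<close> and inserting \<open>x\<close> at
  position \<open>a\<close>.
\<close>

definition insert_zero :: "nat \<Rightarrow> (nat \<Rightarrow> nat) \<Rightarrow> nat \<Rightarrow> nat" where
  "insert_zero a \<tau> i = (if i < a then Suc (\<tau> i) else if i = a then 0 else Suc (\<tau> (i - 1)))"

lemma insert_zero_Suc: "insert_zero (Suc a) \<tau> = insert_zero a \<tau> \<circ> Transposition.transpose a (Suc a)"
  by (rule ext) (auto simp: insert_zero_def Transposition.transpose_def less_Suc_eq)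

text \<open>
  Raising \<open>a\<close> by one composes the permutation with an adjacent transposition; for \<open>a = 0\<close> it is a
  relabelling of \<open>\<tau>\<close>.
\<close>

lemma insert_zero_permutes_sign:
  assumes "\<tau> permutes {..<n}" "a \<le> n"
  shows "insert_zero a \<tau> permutes {..<Suc n} \<and> sign (insert_zero a \<tau>) = sign \<tau> * neg1 (int a)"
  using assms(2)
proof (induction a)
  case 0
  have inj: "inj_on Suc {..<n}" by simp
  have Suc_image: "bij_betw Suc {..<n} {1..n}"
    by (simp add: bij_betw_def lessThan_atLeast0 atLeastLessThanSuc_atLeastAtMost)
  have eq: "insert_zero 0 \<tau> = map_permutation {..<n} Suc \<tau>"
  proof
    fix i
    show "insert_zero 0 \<tau> i = map_permutation {..<n} Suc \<tau> i"
    proof (cases "i \<in> Suc ` {..<n}")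
      case True
      then show ?thesis
        using map_permutation_apply[OF inj] by (auto simp: insert_zero_def)
    next
      case False
      then have "i = 0 \<or> i > n"
        by (cases i) auto
      then show ?thesis
        using False permutes_not_in[OF assms(1), of "i - 1"]
        by (auto simp: map_permutation_def insert_zero_def restrict_id_def)
    qed
  qed
  have "insert_zero 0 \<tau> permutes {1..n}"
    unfolding eq by (rule map_permutation_permutes[OF Suc_image assms(1)])
  then have "insert_zero 0 \<tau> permutes {..<Suc n}"
    by (rule permutes_subset) auto
  moreover have "sign (insert_zero 0 \<tau>) = sign \<tau>"
    unfolding eq by (rule sign_map_permutation) (auto simp: assms)
  ultimately show ?case by simp
next
  case (Suc a)
  then have IH: "insert_zero a \<tau> permutes {..<Suc n}"
    "sign (insert_zero a \<tau>) = sign \<tau> * neg1 (int a)" by auto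
  have t: "Transposition.transpose a (Suc a) permutes {..<Suc n}"
    using Suc.prems by (intro permutes_swap_id) auto
  have "permutation (insert_zero a \<tau>)" "permutation (Transposition.transpose a (Suc a))"
    using IH(1) t by (meson permutes_imp_permutation finite_lessThan)+
  then have "sign (insert_zero (Suc a) \<tau>) = sign (insert_zero a \<tau>) * sign (Transposition.transpose
      a (Suc a))"
    unfolding insert_zero_Suc by (rule sign_compose)
  moreover have "insert_zero (Suc a) \<tau> permutes {..<Suc n}"
    unfolding insert_zero_Suc by (rule permutes_compose[OF t IH(1)])
  ultimately show ?case
    by (simp add: IH(2) sign_swap_id neg1_def)
qed

lemma permute_list_insert_zero:
  assumes "\<tau> permutes {..<length xs}" "a \<le> length xs"
  shows "permute_list (insert_zero a \<tau>) (x # xs) =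
    take a (permute_list \<tau> xs) @ x # drop a (permute_list \<tau> xs)"
proof (rule nth_equalityI)
  fix i assume "i < length (permute_list (insert_zero a \<tau>) (x # xs))"
  then have i: "i < Suc (length xs)" by simp
  then show "permute_list (insert_zero a \<tau>) (x # xs) ! i =
      (take a (permute_list \<tau> xs) @ x # drop a (permute_list \<tau> xs)) ! i"
    using assms(2)
    by (auto simp: permute_list_def insert_zero_def nth_append min_def nth_Cons' simp del: upt_Suc)
qed (use assms(2) in simp)

text \<open>
  The inversions of \<open>insert_zero a \<tau>\<close> are those of \<open>\<tau>\<close> and the pairs of a position before \<open>a\<close> with
  \<open>a\<close> itself.
\<close>

lemma perm_sign_insert_zero:
  assumes \<tau>: "\<tau> permutes {..<length xs}" and a: "a \<le> length xs"
  shows "perm_sign (insert_zero a \<tau>) (x # xs) =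
    neg1 (int a + fst x * degs (take a (permute_list \<tau> xs))) * perm_sign \<tau> xs"
proof -
  let ?\<sigma> = "insert_zero a \<tau>"
  let ?skip = "\<lambda>i. if i < a then i else Suc i"
  let ?P = "{(i, j). i < j \<and> j < length xs \<and> \<tau> j < \<tau> i}"
  let ?N = "\<lambda>(i, j). neg1 (fst ((x # xs) ! ?\<sigma> i) * fst ((x # xs) ! ?\<sigma> j))"
  let ?sk = "\<lambda>(i, j). (?skip i, ?skip j)"
  have fin: "finite ?P"
    by (rule finite_subset[of _ "{..<length xs} \<times> {..<length xs}"]) auto
  have skip: "?\<sigma> (?skip i) = Suc (\<tau> i)" for i
    by (auto simp: insert_zero_def)
  (* The map skip enumerates the positions other than a. *)
  have "{(i, j). i < j \<and> j < length (x # xs) \<and> ?\<sigma> j < ?\<sigma> i} = (\<lambda>i. (i, a)) ` {..<a} \<union> ?sk ` ?P"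
    (is "?L = ?A \<union> ?B")
  proof (intro equalityI subsetI)
    fix p assume "p \<in> ?L"
    then obtain i j where p: "p = (i, j)" "i < j" "j < Suc (length xs)" "?\<sigma> j < ?\<sigma> i" by auto
    have ia: "i \<noteq> a" using p(4) by (auto simp: insert_zero_def)
    show "p \<in> ?A \<union> ?B"
    proof (cases "j = a")
      case True
      then show ?thesis using p by auto
    next
      case False
      obtain i' where i': "i = ?skip i'"
        by (rule that[of "if i < a then i else i - 1"]) (use ia in auto)
      obtain j' where j': "j = ?skip j'"
        by (rule that[of "if j < a then j else j - 1"]) (use False in auto)
      have "(i', j') \<in> ?P"
        using p(2,3,4) a unfolding i' j' skip by (auto split: if_splits)
      then show ?thesis
        using i' j' p(1) by (intro UnI2 image_eqI[of _ _ "(i', j')"]) auto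
    qed
  next
    fix p assume "p \<in> ?A \<union> ?B"
    then show "p \<in> ?L"
    proof
      assume "p \<in> ?A"
      then show ?thesis using a by (auto simp: insert_zero_def)
    next
      assume "p \<in> ?B"
      then obtain i j where ij: "p = (?skip i, ?skip j)" "(i, j) \<in> ?P" by auto
      then have "?skip i < ?skip j" "?skip j < Suc (length xs)" by auto
      moreover have "?\<sigma> (?skip j) < ?\<sigma> (?skip i)" using ij(2) by (simp only: skip) simp
      ultimately show ?thesis using ij(1) by auto
    qed
  qed
  then have "(\<Prod>p\<in>?L. ?N p) = (\<Prod>p\<in>?A. ?N p) * (\<Prod>p\<in>?B. ?N p)"
    by (simp only:) (rule prod.union_disjoint, use fin in \<open>auto split: if_splits\<close>)
  moreover have "(\<Prod>p\<in>?B. ?N p) = (\<Prod>p\<in>?P. ?N (?sk p))"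
    by (rule prod.reindex_cong[of ?sk]) (auto simp: inj_on_def split: if_splits)
  moreover have "(\<Prod>p\<in>?P. ?N (?sk p)) = (\<Prod>(i, j)\<in>?P. neg1 (fst (xs ! \<tau> i) * fst (xs ! \<tau> j)))"
    by (rule prod.cong) (auto simp only: skip case_prod_conv nth_Cons_Suc)
  moreover have "(\<Prod>p\<in>?A. ?N p) = (\<Prod>i<a. neg1 (fst (xs ! \<tau> i) * fst x))"
    by (subst prod.reindex) (auto simp: inj_on_def insert_zero_def intro!: prod.cong)
  moreover have "(\<Prod>i<k. neg1 (fst (xs ! \<tau> i) * fst x)) = neg1 (fst x * degs (take k (permute_list
      \<tau> xs)))"
    if "k \<le> length xs" for k
    using that
  proof (induction k)
    case (Suc k)
    then show ?case
      by (simp add: take_Suc_conv_app_nth permute_list_def neg1_mult algebra_simps)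
  qed simp
  ultimately show ?thesis
    using insert_zero_permutes_sign[OF \<tau> a] a
    by (simp add: perm_sign_def neg1_mult[symmetric])
qed

lemma insert_zero_inj: "insert_zero a \<tau> = insert_zero a \<tau>' \<Longrightarrow> \<tau> = \<tau>'"
proof
  fix i assume eq: "insert_zero a \<tau> = insert_zero a \<tau>'"
  show "\<tau> i = \<tau>' i"
    using fun_cong[OF eq, of i] fun_cong[OF eq, of "Suc i"]
    by (auto simp: insert_zero_def split: if_splits)
qed

lemma insert_zero_surj:
  assumes \<sigma>: "\<sigma> permutes {..<Suc n}" and a: "a \<le> n" "\<sigma> a = 0"
  obtains \<tau> where "\<tau> permutes {..<n}" "\<sigma> = insert_zero a \<tau>"
proof
  let ?skip = "\<lambda>i. if i < a then i else Suc i"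
  let ?\<tau> = "\<lambda>i. \<sigma> (?skip i) - 1"
  have inj: "inj \<sigma>" using \<sigma> by (rule permutes_inj)
  have pos: "\<sigma> i > 0" if "i \<noteq> a" for i
    using that a(2) inj by (metis injD neq0_conv)
  have skip: "\<sigma> (?skip i) > 0" for i
    by (rule pos) auto
  show "\<sigma> = insert_zero a ?\<tau>"
    by (rule ext) (use pos a(2) in \<open>auto simp: insert_zero_def\<close>)
  show "?\<tau> permutes {..<n}"
  proof (rule inj_imp_permutes)
    have "inj ?\<tau>"
    proof (rule injI)
      fix i j assume "?\<tau> i = ?\<tau> j"
      then have "\<sigma> (?skip i) = \<sigma> (?skip j)" using skip[of i] skip[of j] by linarith
      then have "?skip i = ?skip j" using inj by (simp only: inj_eq)
      then show "i = j" by (auto split: if_splits)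
    qed
    then show "inj_on ?\<tau> {..<n}" by (rule inj_on_subset) simp
    show "?\<tau> i \<in> {..<n}" if "i \<in> {..<n}" for i
    proof -
      have "\<sigma> (?skip i) \<in> {..<Suc n}"
        using that by (subst permutes_in_image[OF \<sigma>]) auto
      then show ?thesis using skip[of i] by (auto simp del: if_split)
    qed
    show "?\<tau> i = i" if "i \<notin> {..<n}" for i
      using that a permutes_not_in[OF \<sigma>, of "Suc i"] by auto
  qed simp
qed

lemma strict_mono_on_Suc_image:
  fixes f g :: "nat \<Rightarrow> nat"
  assumes "\<And>i. i \<in> S \<Longrightarrow> f (Suc i) = Suc (g i)"
  shows "strict_mono_on (Suc ` S) f \<longleftrightarrow> strict_mono_on S g"
proof -
  have "strict_mono_on (Suc ` S) f \<longleftrightarrow>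
      (\<forall>r\<in>S. \<forall>s\<in>S. Suc r < Suc s \<longrightarrow> f (Suc r) < f (Suc s))"
    unfolding strict_mono_on_def by blast
  then show ?thesis
    using assms by (simp add: strict_mono_on_def) blast
qed

lemma strict_mono_on_insert_least:
  fixes f :: "nat \<Rightarrow> nat"
  assumes "\<And>i. i \<in> S \<Longrightarrow> m < i \<and> f m < f i"
  shows "strict_mono_on (insert m S) f \<longleftrightarrow> strict_mono_on S f"
  using assms by (fastforce simp: strict_mono_on_def)

lemma insert_zero_0_mem_shuffle_perms:
  assumes "\<tau> permutes {..<a + b}"
  shows "insert_zero 0 \<tau> \<in> shuffle_perms (Suc a) b \<longleftrightarrow> \<tau> \<in> shuffle_perms a b"
proof -
  have "strict_mono_on {..<Suc a} (insert_zero 0 \<tau>) \<longleftrightarrow> strict_mono_on (Suc ` {..<a}) (insert_zero 0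
      \<tau>)"
    unfolding lessThan_Suc_eq_insert_0
    by (rule strict_mono_on_insert_least) (auto simp: insert_zero_def)
  moreover have "strict_mono_on (Suc ` S) (insert_zero 0 \<tau>) \<longleftrightarrow> strict_mono_on S \<tau>" for S
    by (rule strict_mono_on_Suc_image) (simp add: insert_zero_def)
  ultimately show ?thesis
    using insert_zero_permutes_sign[OF assms, of 0] assms
    by (simp add: shuffle_perms_def flip: image_Suc_atLeastLessThan)
qed

lemma insert_zero_mem_shuffle_perms:
  assumes "\<tau> permutes {..<a + b}"
  shows "insert_zero a \<tau> \<in> shuffle_perms a (Suc b) \<longleftrightarrow> \<tau> \<in> shuffle_perms a b"
proof -
  have "strict_mono_on {..<a} (insert_zero a \<tau>) \<longleftrightarrow> strict_mono_on {..<a} \<tau>"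
    by (auto simp: strict_mono_on_def insert_zero_def)
  moreover have "strict_mono_on {a..<a + Suc b} (insert_zero a \<tau>) \<longleftrightarrow> strict_mono_on {a..<a + b} \<tau>"
  proof -
    have "{a..<a + Suc b} = insert a (Suc ` {a..<a + b})"
      by (auto simp: image_Suc_atLeastLessThan)
    then have "strict_mono_on {a..<a + Suc b} (insert_zero a \<tau>) \<longleftrightarrow>
        strict_mono_on (Suc ` {a..<a + b}) (insert_zero a \<tau>)"
      by (simp only:) (rule strict_mono_on_insert_least, auto simp: insert_zero_def)
    also have "\<dots> \<longleftrightarrow> strict_mono_on {a..<a + b} \<tau>"
      by (rule strict_mono_on_Suc_image) (simp add: insert_zero_def)
    finally show ?thesis .
  qed
  ultimately show ?thesis
    using insert_zero_permutes_sign[OF assms, of a] assms by (simp add: shuffle_perms_def)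
qed

text \<open>
  A shuffle takes the value \<open>0\<close> at the start of one of its two increasing blocks.
\<close>

lemma shuffle_perms_rec:
  assumes n: "a + b = Suc n"
  shows "shuffle_perms a b =
    (if a > 0 then insert_zero 0 ` shuffle_perms (a - 1) b else {}) \<union>
    (if b > 0 then insert_zero a ` shuffle_perms a (b - 1) else {})"
proof (intro equalityI subsetI)
  fix \<sigma> assume \<sigma>: "\<sigma> \<in> shuffle_perms a b"
  then have p: "\<sigma> permutes {..<Suc n}" and m: "strict_mono_on {..<a} \<sigma>" "strict_mono_on {a..<a +
      b} \<sigma>"
    by (auto simp: shuffle_perms_def n)
  obtain i where i: "\<sigma> i = 0" "i < Suc n"
    by (metis p lessThan_iff permutes_def zero_less_Suc permutes_in_image)
  show "\<sigma> \<in> (if a > 0 then insert_zero 0 ` shuffle_perms (a - 1) b else {}) \<union>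
    (if b > 0 then insert_zero a ` shuffle_perms a (b - 1) else {})"
  proof (cases "i < a")
    case True
    then obtain a' where a': "a = Suc a'" by (cases a) auto
    have "i = 0"
      using strict_mono_onD[OF m(1), of 0 i] True i by (cases "i = 0") auto
    then obtain \<tau> where "\<tau> permutes {..<a' + b}" "\<sigma> = insert_zero 0 \<tau>"
      using insert_zero_surj[OF p, of 0] i a' n by auto
    with insert_zero_0_mem_shuffle_perms[OF this(1)] \<sigma> show ?thesis by (auto simp: a')
  next
    case False
    then obtain b' where b': "b = Suc b'" using i n by (cases b) auto
    have "i = a"
      using strict_mono_onD[OF m(2), of a i] False i n by (cases "i = a") auto
    then obtain \<tau> where "\<tau> permutes {..<a + b'}" "\<sigma> = insert_zero a \<tau>"
      using insert_zero_surj[OF p, of a] i b' n by auto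
    with insert_zero_mem_shuffle_perms[OF this(1)] \<sigma> show ?thesis by (auto simp: b')
  qed
next
  fix \<sigma> assume "\<sigma> \<in> (if a > 0 then insert_zero 0 ` shuffle_perms (a - 1) b else {}) \<union>
    (if b > 0 then insert_zero a ` shuffle_perms a (b - 1) else {})"
  then consider a' \<tau> where "a = Suc a'" "\<sigma> = insert_zero 0 \<tau>" "\<tau> \<in> shuffle_perms a' b"
    | b' \<tau> where "b = Suc b'" "\<sigma> = insert_zero a \<tau>" "\<tau> \<in> shuffle_perms a b'"
    by (cases a; cases b) (auto split: if_splits)
  then show "\<sigma> \<in> shuffle_perms a b"
  proof cases
    case 1
    then have "\<tau> permutes {..<a' + b}" by (simp add: shuffle_perms_def)
    from insert_zero_0_mem_shuffle_perms[OF this] 1 show ?thesis by simp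
  next
    case 2
    then have "\<tau> permutes {..<a + b'}" by (simp add: shuffle_perms_def)
    from insert_zero_mem_shuffle_perms[OF this] 2 show ?thesis by simp
  qed
qed

lemma finite_shuffle_perms: "finite (shuffle_perms a b)"
  by (rule finite_subset[OF _ finite_permutations[of "{..<a + b}"]]) (auto simp: shuffle_perms_def)

context abelian_group
begin

text \<open>
  The shuffles with the first entry in the first block and those with the first entry in the second
  block yield the two summands in the recursion of \<open>unshuffle_sum\<close>.
\<close>

lemma shuffle_sum_Cons:
  fixes h :: "'g homogeneous list \<Rightarrow> 'a"
  assumes n: "a + b = Suc (length xs)"
    and h: "\<And>zs. mset zs = mset (x # xs) \<Longrightarrow> h zs \<in> carrier G"
  shows "(\<Oplus>\<sigma>\<in>shuffle_perms a b. [(perm_sign \<sigma> (x # xs))] \<cdot> h (permute_list \<sigma> (x # xs))) =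
    (if a > 0 then \<Oplus>\<sigma>\<in>shuffle_perms (a - 1) b. [(perm_sign \<sigma> xs)] \<cdot> h (x # permute_list \<sigma> xs) else
        \<zero>) \<oplus>
    (if b > 0 then \<Oplus>\<sigma>\<in>shuffle_perms a (b - 1). [(perm_sign \<sigma> xs)] \<cdot>
       ([(neg1 (int (length (take a (permute_list \<sigma> xs))) + fst x * degs (take a (permute_list \<sigma>
           xs))))] \<cdot>
        h (take a (permute_list \<sigma> xs) @ x # drop a (permute_list \<sigma> xs))) else \<zero>)"
proof -
  let ?t = "\<lambda>\<sigma>. [(perm_sign \<sigma> (x # xs))] \<cdot> h (permute_list \<sigma> (x # xs))"
  let ?A = "if a > 0 then insert_zero 0 ` shuffle_perms (a - 1) b else {}"
  let ?B = "if b > 0 then insert_zero a ` shuffle_perms a (b - 1) else {}"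
  have p1: "\<tau> permutes {..<length xs}" if "\<tau> \<in> shuffle_perms (a - 1) b" "a > 0" for \<tau>
  proof -
    have "a - 1 + b = length xs" using n that by simp
    then show ?thesis using that by (simp add: shuffle_perms_def)
  qed
  have p2: "\<tau> permutes {..<length xs}" if "\<tau> \<in> shuffle_perms a (b - 1)" "b > 0" for \<tau>
  proof -
    have "a + (b - 1) = length xs" using n that by simp
    then show ?thesis using that by (simp add: shuffle_perms_def)
  qed
  have cl: "?t \<sigma> \<in> carrier G" if "\<sigma> \<in> shuffle_perms a b" for \<sigma>
  proof -
    have "\<sigma> permutes {..<length (x # xs)}" using that by (simp add: shuffle_perms_def n)
    then have "mset (permute_list \<sigma> (x # xs)) = mset (x # xs)" by (rule mset_permute_list)
    then show ?thesis by (intro add.int_pow_closed h)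
  qed
  have disj: "?A \<inter> ?B = {}"
  proof -
    have False if "insert_zero 0 \<tau> = insert_zero a \<tau>'" "a > 0" for \<tau> \<tau>'
      using fun_cong[OF that(1), of 0] that(2) by (simp add: insert_zero_def)
    then show ?thesis by auto
  qed
  have fin: "finite ?A" "finite ?B" by (simp_all add: finite_shuffle_perms)
  have AB: "shuffle_perms a b = ?A \<union> ?B" by (rule shuffle_perms_rec[OF n])
  have clA: "?t \<in> ?A \<rightarrow> carrier G" and clB: "?t \<in> ?B \<rightarrow> carrier G" using cl AB by blast+
  have "(\<Oplus>\<sigma>\<in>shuffle_perms a b. ?t \<sigma>) = (\<Oplus>\<sigma>\<in>?A. ?t \<sigma>) \<oplus> (\<Oplus>\<sigma>\<in>?B. ?t \<sigma>)"
    unfolding AB by (rule finsum_Un_disjoint[OF fin disj clA clB])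
  also have "(\<Oplus>\<sigma>\<in>?A. ?t \<sigma>) = (if a > 0 then \<Oplus>\<sigma>\<in>shuffle_perms (a - 1) b.
      [(perm_sign \<sigma> xs)] \<cdot> h (x # permute_list \<sigma> xs) else \<zero>)"
  proof (cases "a > 0")
    case True
    have "(\<Oplus>\<sigma>\<in>?A. ?t \<sigma>) = (\<Oplus>\<tau>\<in>shuffle_perms (a - 1) b. ?t (insert_zero 0 \<tau>))"
      using True clA insert_zero_inj by (simp only: if_True) (intro finsum_reindex, auto simp:
          inj_on_def)
    also have "\<dots> = (\<Oplus>\<sigma>\<in>shuffle_perms (a - 1) b. [(perm_sign \<sigma> xs)] \<cdot> h (x # permute_list \<sigma> xs))"
    proof (rule finsum_cong')
      fix \<tau> assume \<tau>: "\<tau> \<in> shuffle_perms (a - 1) b"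
      show "?t (insert_zero 0 \<tau>) = [(perm_sign \<tau> xs)] \<cdot> h (x # permute_list \<tau> xs)"
        using p1[OF \<tau> True] by (simp add: perm_sign_insert_zero permute_list_insert_zero)
    qed (use p1 True in \<open>auto intro!: add.int_pow_closed h simp: mset_permute_list\<close>)
    finally show ?thesis using True by simp
  qed simp
  also have "(\<Oplus>\<sigma>\<in>?B. ?t \<sigma>) = (if b > 0 then \<Oplus>\<sigma>\<in>shuffle_perms a (b - 1). [(perm_sign \<sigma> xs)] \<cdot>
       ([(neg1 (int (length (take a (permute_list \<sigma> xs))) + fst x * degs (take a (permute_list \<sigma>
           xs))))] \<cdot>
        h (take a (permute_list \<sigma> xs) @ x # drop a (permute_list \<sigma> xs))) else \<zero>)"
  proof (cases "b > 0")
    case True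
    have m: "mset (take a (permute_list \<tau> xs) @ x # drop a (permute_list \<tau> xs)) = mset (x # xs)"
      if "\<tau> permutes {..<length xs}" for \<tau>
    proof -
      have "mset (take a (permute_list \<tau> xs) @ x # drop a (permute_list \<tau> xs)) =
        mset (take a (permute_list \<tau> xs) @ drop a (permute_list \<tau> xs)) + {#x#}"
        by (simp only: mset_append mset.simps) simp
      also have "\<dots> = mset (permute_list \<tau> xs) + {#x#}"
        by (simp only: append_take_drop_id)
      finally show ?thesis using that by (simp add: mset_permute_list)
    qed
    have "(\<Oplus>\<sigma>\<in>?B. ?t \<sigma>) = (\<Oplus>\<tau>\<in>shuffle_perms a (b - 1). ?t (insert_zero a \<tau>))"
      using True clB insert_zero_inj by (simp only: if_True) (intro finsum_reindex, auto simp: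
          inj_on_def)
    also have "\<dots> = (\<Oplus>\<sigma>\<in>shuffle_perms a (b - 1). [(perm_sign \<sigma> xs)] \<cdot>
       ([(neg1 (int (length (take a (permute_list \<sigma> xs))) + fst x * degs (take a (permute_list \<sigma>
           xs))))] \<cdot>
        h (take a (permute_list \<sigma> xs) @ x # drop a (permute_list \<sigma> xs))))"
    proof (rule finsum_cong')
      fix \<tau> assume \<tau>: "\<tau> \<in> shuffle_perms a (b - 1)"
      have a: "a \<le> length xs" using n True by simp
      note p = p2[OF \<tau> True]
      have "length (take a (permute_list \<tau> xs)) = a" using a by simp
      moreover have "?t (insert_zero a \<tau>) =
        [(perm_sign \<tau> xs * neg1 (int a + fst x * degs (take a (permute_list \<tau> xs))))] \<cdot>
        h (take a (permute_list \<tau> xs) @ x # drop a (permute_list \<tau> xs))"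
        by (simp only: perm_sign_insert_zero[OF p a] permute_list_insert_zero[OF p a] mult.commute)
      ultimately show "?t (insert_zero a \<tau>) = [(perm_sign \<tau> xs)] \<cdot>
       ([(neg1 (int (length (take a (permute_list \<tau> xs))) + fst x * degs (take a (permute_list \<tau>
           xs))))] \<cdot>
        h (take a (permute_list \<tau> xs) @ x # drop a (permute_list \<tau> xs)))"
        by (simp only: int_mult_mult[OF h[OF m[OF p]]])
    next
      show "(\<lambda>\<sigma>. [(perm_sign \<sigma> xs)] \<cdot>
       ([(neg1 (int (length (take a (permute_list \<sigma> xs))) + fst x * degs (take a (permute_list \<sigma>
           xs))))] \<cdot>
        h (take a (permute_list \<sigma> xs) @ x # drop a (permute_list \<sigma> xs))))
          \<in> shuffle_perms a (b - 1) \<rightarrow> carrier G"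
      proof
        fix \<tau> assume "\<tau> \<in> shuffle_perms a (b - 1)"
        from m[OF p2[OF this True]] show "[(perm_sign \<tau> xs)] \<cdot>
       ([(neg1 (int (length (take a (permute_list \<tau> xs))) + fst x * degs (take a (permute_list \<tau>
           xs))))] \<cdot>
        h (take a (permute_list \<tau> xs) @ x # drop a (permute_list \<tau> xs))) \<in> carrier G"
          by (intro add.int_pow_closed h)
      qed
    qed simp
    finally show ?thesis using True by (simp only: if_True)
  qed simp
  finally show ?thesis .
qed

end

lemma shuffle_sum_eq_unshuffle_sum:
  assumes M: "abelian_group M"
    and "a + b = length xs"
    and "\<And>zs. mset zs = mset xs \<Longrightarrow> h zs \<in> carrier M"
  shows "shuffle_sum M a b h xs =
    unshuffle_sum M (\<lambda>ys zs. if length ys = a then h (ys @ zs) else \<zero>\<^bsub>M\<^esub>) xs"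
  using assms(2,3)
proof (induction xs arbitrary: a b h)
  case Nil
  interpret abelian_group M by fact
  have "shuffle_perms 0 0 = {id}"
    by (auto simp: shuffle_perms_def strict_mono_on_def)
  with Nil show ?case
    by (simp add: shuffle_sum_def perm_sign_def)
next
  case (Cons x xs)
  interpret abelian_group M by fact
  let ?S = "\<lambda>F. unshuffle_sum M F xs"
  let ?s = "\<lambda>ys. neg1 (int (length ys) + fst x * degs ys)"
  have cl: "h (x # ys @ zs) \<in> carrier M" "h (ys @ x # zs) \<in> carrier M"
    if "mset ys + mset zs = mset xs" for ys zs
    by (rule Cons.prems(2), simp add: that[symmetric])+
  have "shuffle_sum M a b h (x # xs) =
    (if a > 0 then shuffle_sum M (a - 1) b (\<lambda>ws. h (x # ws)) xs else \<zero>\<^bsub>M\<^esub>) \<oplus>\<^bsub>M\<^esub>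
    (if b > 0 then shuffle_sum M a (b - 1) (\<lambda>ws. [(?s (take a ws))] \<cdot>\<^bsub>M\<^esub>
        h (take a ws @ x # drop a ws)) xs else \<zero>\<^bsub>M\<^esub>)"
    unfolding shuffle_sum_def
  proof (rule shuffle_sum_Cons)
    show "a + b = Suc (length xs)" using Cons.prems(1) by simp
    show "h zs \<in> carrier M" if "mset zs = mset (x # xs)" for zs
      using that by (rule Cons.prems(2))
  qed
  also have "(if a > 0 then shuffle_sum M (a - 1) b (\<lambda>ws. h (x # ws)) xs else \<zero>\<^bsub>M\<^esub>) =
    ?S (\<lambda>ys zs. if length (x # ys) = a then h ((x # ys) @ zs) else \<zero>\<^bsub>M\<^esub>)"
  proof (cases "a > 0")
    case True
    have "shuffle_sum M (a - 1) b (\<lambda>ws. h (x # ws)) xs =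
      ?S (\<lambda>ys zs. if length ys = a - 1 then h (x # (ys @ zs)) else \<zero>\<^bsub>M\<^esub>)"
    proof (rule Cons.IH)
      show "a - 1 + b = length xs" using True Cons.prems(1) by simp
      show "h (x # zs) \<in> carrier M" if "mset zs = mset xs" for zs
        by (rule Cons.prems(2)) (simp add: that)
    qed
    also have "\<dots> = ?S (\<lambda>ys zs. if length (x # ys) = a then h ((x # ys) @ zs) else \<zero>\<^bsub>M\<^esub>)"
      by (rule unshuffle_sum_cong) (use True in auto)
    finally show ?thesis using True by simp
  next
    case False
    then show ?thesis by (simp add: unshuffle_sum_zero)
  qed
  also have "(if b > 0 then shuffle_sum M a (b - 1) (\<lambda>ws. [(?s (take a ws))] \<cdot>\<^bsub>M\<^esub>
        h (take a ws @ x # drop a ws)) xs else \<zero>\<^bsub>M\<^esub>) =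
    ?S (\<lambda>ys zs. [(?s ys)] \<cdot>\<^bsub>M\<^esub> (if length ys = a then h (ys @ x # zs) else \<zero>\<^bsub>M\<^esub>))"
  proof (cases "b > 0")
    case True
    have "shuffle_sum M a (b - 1) (\<lambda>ws. [(?s (take a ws))] \<cdot>\<^bsub>M\<^esub> h (take a ws @ x # drop a ws)) xs =
      ?S (\<lambda>ys zs. if length ys = a then [(?s (take a (ys @ zs)))] \<cdot>\<^bsub>M\<^esub>
         h (take a (ys @ zs) @ x # drop a (ys @ zs)) else \<zero>\<^bsub>M\<^esub>)"
    proof (rule Cons.IH)
      fix zs assume "mset zs = mset xs"
      then have "mset (take a zs) + mset (drop a zs) = mset xs"
        by (metis append_take_drop_id mset_append)
      then show "[(?s (take a zs))] \<cdot>\<^bsub>M\<^esub> h (take a zs @ x # drop a zs) \<in> carrier M"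
        by (intro add.int_pow_closed cl)
    next
      show "a + (b - 1) = length xs" using True Cons.prems(1) by simp
    qed
    also have "\<dots> = ?S (\<lambda>ys zs. [(?s ys)] \<cdot>\<^bsub>M\<^esub> (if length ys = a then h (ys @ x # zs) else \<zero>\<^bsub>M\<^esub>))"
      by (rule unshuffle_sum_cong) simp_all
    finally show ?thesis using True by simp
  next
    case False
    then have a: "a = Suc (length xs)" using Cons.prems(1) by simp
    have "?S (\<lambda>ys zs. [(?s ys)] \<cdot>\<^bsub>M\<^esub> (if length ys = a then h (ys @ x # zs) else \<zero>\<^bsub>M\<^esub>)) =
      ?S (\<lambda>ys zs. \<zero>\<^bsub>M\<^esub>)"
    proof (rule unshuffle_sum_cong)
      fix ys zs assume "mset ys + mset zs = mset xs"
      then have "length ys \<noteq> a" using splits_length[of ys zs xs] a by simp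
      then show "[(?s ys)] \<cdot>\<^bsub>M\<^esub> (if length ys = a then h (ys @ x # zs) else \<zero>\<^bsub>M\<^esub>) = \<zero>\<^bsub>M\<^esub>"
        by simp
    qed
    then show ?thesis using False by (simp add: unshuffle_sum_zero)
  qed
  finally show ?case by (simp only: unshuffle_sum.simps append_Cons)
qed

lemma unshuffle_sum_finsum:
  assumes "abelian_group M" "finite A" "\<And>a ys zs. a \<in> A \<Longrightarrow> mset ys + mset zs = mset xs \<Longrightarrow>
      F a ys zs \<in> carrier M"
  shows "(\<Oplus>\<^bsub>M\<^esub>a\<in>A. unshuffle_sum M (F a) xs) = unshuffle_sum M (\<lambda>ys zs. \<Oplus>\<^bsub>M\<^esub>a\<in>A. F a ys zs) xs"
proof -
  interpret abelian_group M by fact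
  show ?thesis using assms(2,3)
  proof (induction A)
    case empty
    then show ?case by (simp add: unshuffle_sum_zero)
  next
    case (insert a A)
    have "(\<Oplus>\<^bsub>M\<^esub>b\<in>insert a A. unshuffle_sum M (F b) xs) =
      unshuffle_sum M (F a) xs \<oplus>\<^bsub>M\<^esub> (\<Oplus>\<^bsub>M\<^esub>b\<in>A. unshuffle_sum M (F b) xs)"
      using insert by (intro finsum_insert) (auto intro!: unshuffle_sum_closed)
    also have "\<dots> = unshuffle_sum M (F a) xs \<oplus>\<^bsub>M\<^esub> unshuffle_sum M (\<lambda>ys zs. \<Oplus>\<^bsub>M\<^esub>a\<in>A. F a ys zs) xs"
      using insert by simp
    also have "\<dots> = unshuffle_sum M (\<lambda>ys zs. F a ys zs \<oplus>\<^bsub>M\<^esub> (\<Oplus>\<^bsub>M\<^esub>a\<in>A. F a ys zs)) xs"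
      using insert by (intro unshuffle_sum_add[symmetric] finsum_closed) auto
    also have "\<dots> = unshuffle_sum M (\<lambda>ys zs. \<Oplus>\<^bsub>M\<^esub>b\<in>insert a A. F b ys zs) xs"
      using insert by (intro unshuffle_sum_cong finsum_insert[symmetric]) auto
    finally show ?case .
  qed
qed

text \<open>
  In juxtapositions and in the homotopy Jacobi identities, shuffle sums occur for a whole range of
  sizes of the first block; together they make up one sum over unshuffles.
\<close>

lemma finsum_shuffle_sum:
  assumes M: "abelian_group M" and A: "A \<subseteq> {..length xs}"
    and h: "\<And>a zs. a \<in> A \<Longrightarrow> mset zs = mset xs \<Longrightarrow> h a zs \<in> carrier M"
  shows "(\<Oplus>\<^bsub>M\<^esub>a\<in>A. [(c a :: int)] \<cdot>\<^bsub>M\<^esub> shuffle_sum M a (length xs - a) (h a) xs) =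
    unshuffle_sum M (\<lambda>ys zs. if length ys \<in> A then [(c (length ys))] \<cdot>\<^bsub>M\<^esub>
        h (length ys) (ys @ zs) else \<zero>\<^bsub>M\<^esub>) xs"
proof -
  interpret abelian_group M by fact
  have fin: "finite A" using A by (rule finite_subset) simp
  let ?F = "\<lambda>a ys zs. if length ys = a then [(c a)] \<cdot>\<^bsub>M\<^esub> h a (ys @ zs) else \<zero>\<^bsub>M\<^esub>"
  have cl: "h a (ys @ zs) \<in> carrier M" if "a \<in> A" "mset ys + mset zs = mset xs" for a ys zs
    using that by (intro h) auto
  have "(\<Oplus>\<^bsub>M\<^esub>a\<in>A. [(c a)] \<cdot>\<^bsub>M\<^esub> shuffle_sum M a (length xs - a) (h a) xs) =
    (\<Oplus>\<^bsub>M\<^esub>a\<in>A. unshuffle_sum M (?F a) xs)"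
  proof (rule finsum_cong')
    fix a assume a: "a \<in> A"
    then have "[(c a)] \<cdot>\<^bsub>M\<^esub> shuffle_sum M a (length xs - a) (h a) xs = [(c a)] \<cdot>\<^bsub>M\<^esub>
       unshuffle_sum M (\<lambda>ys zs. if length ys = a then h a (ys @ zs) else \<zero>\<^bsub>M\<^esub>) xs"
      using A by (subst shuffle_sum_eq_unshuffle_sum) (auto intro: h M)
    also have "\<dots> = unshuffle_sum M (?F a) xs"
      using a by (subst unshuffle_sum_int_mult[symmetric]) (auto intro!: unshuffle_sum_cong cl)
    finally show "[(c a)] \<cdot>\<^bsub>M\<^esub> shuffle_sum M a (length xs - a) (h a) xs =
        unshuffle_sum M (?F a) xs" .
  qed (auto intro!: unshuffle_sum_closed cl add.int_pow_closed)
  also have "\<dots> = unshuffle_sum M (\<lambda>ys zs. \<Oplus>\<^bsub>M\<^esub>a\<in>A. ?F a ys zs) xs"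
    by (rule unshuffle_sum_finsum[OF M fin]) (auto intro!: cl add.int_pow_closed)
  also have "\<dots> = unshuffle_sum M (\<lambda>ys zs. if length ys \<in> A then [(c (length ys))] \<cdot>\<^bsub>M\<^esub>
      h (length ys) (ys @ zs) else \<zero>\<^bsub>M\<^esub>) xs"
  proof (rule unshuffle_sum_cong)
    fix ys zs assume s: "mset ys + mset zs = mset xs"
    show "(\<Oplus>\<^bsub>M\<^esub>a\<in>A. ?F a ys zs) = (if length ys \<in> A then [(c (length ys))] \<cdot>\<^bsub>M\<^esub>
        h (length ys) (ys @ zs) else \<zero>\<^bsub>M\<^esub>)"
    proof (cases "length ys \<in> A")
      case True
      then show ?thesis
        using finsum_singleton[of "length ys" A "\<lambda>a. [(c a)] \<cdot>\<^bsub>M\<^esub> h a (ys @ zs)"] fin s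
        by (simp add: cl Pi_def)
    next
      case False
      have "(\<Oplus>\<^bsub>M\<^esub>a\<in>A. ?F a ys zs) = (\<Oplus>\<^bsub>M\<^esub>a\<in>A. \<zero>\<^bsub>M\<^esub>)"
        by (rule finsum_cong') (use False in auto)
      then show ?thesis using False by (simp add: finsum_zero)
    qed
  qed
  finally show ?thesis .
qed

section \<open>Skew-symmetric multilinear maps\<close>

lemma graded_module: "graded_vector_space K V \<Longrightarrow> module K (V d)"
  by (simp add: graded_vector_space_def)

lemma graded_abelian_group: "graded_vector_space K V \<Longrightarrow> abelian_group (V d)"
  by (auto simp: graded_vector_space_def dest: module.axioms)

lemma graded_shift: "graded_vector_space K V \<Longrightarrow> graded_vector_space K (shift V n)"
  by (simp add: graded_vector_space_def shift_def)

lemma homogs_iff: "x \<in> homogs V \<longleftrightarrow> snd x \<in> carrier (V (fst x))"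
  by (cases x) (simp add: homogs_def)

lemma skew_multilinear_slot:
  assumes "skew_multilinear K A n W h" "as \<in> lists (homogs A)" "bs \<in> lists (homogs A)"
    "length as + 1 + length bs = n" "d = degs as + p + degs bs"
  shows "(\<lambda>x. h (as @ (p, x) # bs)) \<in> linear_maps K (A p) (W d)"
  using assms(1)[unfolded skew_multilinear_def, THEN conjunct1, rule_format, OF assms(2-4)] assms(5)
  by simp

lemma skew_multilinear_swap:
  assumes "skew_multilinear K A n W h" "as \<in> lists (homogs A)" "bs \<in> lists (homogs A)"
    "x \<in> homogs A" "y \<in> homogs A" "length as + 2 + length bs = n"
    "d = degs as + fst x + fst y + degs bs"
  shows "h (as @ x # y # bs) = [(- neg1 (fst x * fst y))] \<cdot>\<^bsub>W d\<^esub> h (as @ y # x # bs)"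
  using assms(1)[unfolded skew_multilinear_def, THEN conjunct2, rule_format, OF assms(2-6)]
  by (simp only: assms(7))

lemma skew_multilinear_closed:
  assumes h: "skew_multilinear K A n W h" and "n > 0" "xs \<in> lists (homogs A)" "length xs = n"
  shows "h xs \<in> carrier (W (degs xs))"
proof -
  obtain p x ys where xs: "xs = (p, x) # ys" using assms by (cases xs) auto
  have "(\<lambda>x. h ([] @ (p, x) # ys)) \<in> linear_maps K (A p) (W (degs [] + p + degs ys))"
    by (rule skew_multilinear_slot[OF h]) (use assms(3,4) in \<open>simp_all add: xs\<close>)
  from linear_mapsD(1)[OF this, of x] show ?thesis
    using assms(3) by (simp add: xs homogs_iff)
qed

lemma skew_multilinear_cong:
  assumes A: "graded_vector_space K A" and h: "skew_multilinear K A n W h"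
    and eq: "\<And>xs. xs \<in> lists (homogs A) \<Longrightarrow> length xs = n \<Longrightarrow> h xs = h' xs"
  shows "skew_multilinear K A n W h'"
proof -
  have "(\<lambda>x. h' (as @ (p, x) # bs)) \<in> linear_maps K (A p) (W (degs as + p + degs bs))"
    if "as \<in> lists (homogs A)" "bs \<in> lists (homogs A)" "length as + 1 + length bs = n" for as bs p
  proof (rule linear_maps_cong[OF graded_module[OF A]])
    show "(\<lambda>x. h (as @ (p, x) # bs)) \<in> linear_maps K (A p) (W (degs as + p + degs bs))"
      by (rule skew_multilinear_slot[OF h]) (use that in simp_all)
    show "h (as @ (p, x) # bs) = h' (as @ (p, x) # bs)" if "x \<in> carrier (A p)" for x
      using that \<open>as \<in> _\<close> \<open>bs \<in> _\<close> \<open>_ = n\<close> by (intro eq) (simp_all add: homogs_def)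
  qed
  moreover have "h' (as @ x # y # bs) = [(- neg1 (fst x * fst y))] \<cdot>\<^bsub>W (degs as + fst x + fst y +
      degs bs)\<^esub> h' (as @ y # x # bs)"
    if "as \<in> lists (homogs A)" "bs \<in> lists (homogs A)" "x \<in> homogs A" "y \<in> homogs A"
      "length as + 2 + length bs = n" for as bs x y
    using that by (subst (1 2) eq[symmetric]) (auto intro!: skew_multilinear_swap[OF h])
  ultimately show ?thesis
    unfolding skew_multilinear_def by blast
qed

text \<open>
  Linearity and skew symmetry need to be examined only at the front of a list, provided that they
  hold behind any fixed first entry.  This permits induction on the number of arguments.
\<close>

lemma skew_multilinear_Suc:
  "skew_multilinear K A (Suc n) W h \<longleftrightarrow>
    (\<forall>a\<in>homogs A. skew_multilinear K A n (shift W (fst a)) (\<lambda>xs. h (a # xs))) \<and>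
    (\<forall>bs\<in>lists (homogs A). length bs = n \<longrightarrow>
      (\<forall>p. (\<lambda>x. h ((p, x) # bs)) \<in> linear_maps K (A p) (W (p + degs bs)))) \<and>
    (\<forall>bs\<in>lists (homogs A). \<forall>x\<in>homogs A. \<forall>y\<in>homogs A. Suc (length bs) = n \<longrightarrow>
      h (x # y # bs) = [(- neg1 (fst x * fst y))] \<cdot>\<^bsub>W (fst x + fst y + degs bs)\<^esub> h (y # x # bs))"
  (is "?L \<longleftrightarrow> ?R1 \<and> ?R2 \<and> ?R3")
proof (intro iffI conjI)
  assume L: ?L
  show ?R2
    using skew_multilinear_slot[OF L, of "[]"] by simp
  show ?R3
    by (intro ballI impI, rule skew_multilinear_swap[OF L, of "[]", unfolded append_Nil]) simp_all
  show ?R1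
  proof
    fix a assume a: "a \<in> homogs A"
    show "skew_multilinear K A n (shift W (fst a)) (\<lambda>xs. h (a # xs))"
      unfolding skew_multilinear_def
    proof (intro conjI ballI impI allI)
      fix as bs p assume "as \<in> lists (homogs A)" "bs \<in> lists (homogs A)" "length as + 1 + length
          bs = n"
      with a skew_multilinear_slot[OF L, of "a # as" bs]
      show "(\<lambda>x. h (a # as @ (p, x) # bs)) \<in> linear_maps K (A p) (shift W (fst a) (degs as + p +
          degs bs))"
        by (simp add: shift_def ac_simps)
    next
      fix as bs x y assume "as \<in> lists (homogs A)" "bs \<in> lists (homogs A)" "x \<in> homogs A" "y
          \<in> homogs A"
        "length as + 2 + length bs = n"
      with a skew_multilinear_swap[OF L, of "a # as" bs x y]
      show "h (a # as @ x # y # bs) = [(- neg1 (fst x * fst y))] \<cdot>\<^bsub>shift W (fst a) (degs as + fst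
          x + fst y + degs bs)\<^esub>
         h (a # as @ y # x # bs)"
        by (simp add: shift_def ac_simps)
    qed
  qed
next
  assume "?R1 \<and> ?R2 \<and> ?R3"
  then have R1: ?R1 and R2: ?R2 and R3: ?R3 by blast+
  show ?L
    unfolding skew_multilinear_def
  proof (intro conjI ballI impI allI)
    fix as bs p
    assume as: "as \<in> lists (homogs A)" "bs \<in> lists (homogs A)" "length as + 1 + length bs = Suc n"
    show "(\<lambda>x. h (as @ (p, x) # bs)) \<in> linear_maps K (A p) (W (degs as + p + degs bs))"
    proof (cases as)
      case Nil
      then show ?thesis using R2 as by simp
    next
      case (Cons a as')
      then have "skew_multilinear K A n (shift W (fst a)) (\<lambda>xs. h (a # xs))" using as R1 by simp
      then show ?thesis
        using as unfolding skew_multilinear_def Cons by (simp add: shift_def ac_simps)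
    qed
  next
    fix as bs x y
    assume as: "as \<in> lists (homogs A)" "bs \<in> lists (homogs A)" "length as + 2 + length bs = Suc n"
      "x \<in> homogs A" "y \<in> homogs A"
    show "h (as @ x # y # bs) = [(- neg1 (fst x * fst y))] \<cdot>\<^bsub>W (degs as + fst x + fst y + degs bs)\<^esub>
       h (as @ y # x # bs)"
    proof (cases as)
      case Nil
      then have "Suc (length bs) = n" using as(3) by simp
      from R3[rule_format, OF as(2,4,5) this] show ?thesis by (simp add: Nil)
    next
      case (Cons a as')
      then have "skew_multilinear K A n (shift W (fst a)) (\<lambda>xs. h (a # xs))" using as R1 by simp
      from skew_multilinear_swap[OF this, of as' bs x y "degs as' + fst x + fst y + degs bs"] as
      show ?thesis by (simp add: Cons shift_def ac_simps)
    qed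
  qed
qed

lemma skew_multilinear_add:
  assumes W: "graded_vector_space K W"
    and h: "skew_multilinear K A n W h" and h': "skew_multilinear K A n W h'"
  shows "skew_multilinear K A n W (\<lambda>xs. h xs \<oplus>\<^bsub>W (degs xs)\<^esub> h' xs)"
  unfolding skew_multilinear_def
proof (intro conjI ballI impI allI)
  fix as bs p
  assume "as \<in> lists (homogs A)" "bs \<in> lists (homogs A)" "length as + 1 + length bs = n"
  then show "(\<lambda>x. h (as @ (p, x) # bs) \<oplus>\<^bsub>W (degs (as @ (p, x) # bs))\<^esub> h' (as @ (p, x) # bs))
      \<in> linear_maps K (A p) (W (degs as + p + degs bs))"
    by (simp add: add.assoc[symmetric])
      (rule linear_maps_add[OF graded_module[OF W]];
        auto intro!: skew_multilinear_slot[OF h] skew_multilinear_slot[OF h'])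
next
  fix as bs x y
  assume as: "as \<in> lists (homogs A)" "bs \<in> lists (homogs A)" "x \<in> homogs A" "y \<in> homogs A"
      "length as + 2 + length bs = n"
  let ?M = "W (degs as + fst x + fst y + degs bs)"
  interpret abelian_group ?M by (rule graded_abelian_group[OF W])
  have eq: "degs (as @ x # y # bs) = degs as + fst x + fst y + degs bs"
     "degs (as @ y # x # bs) = degs as + fst x + fst y + degs bs" by simp_all
  note closed = skew_multilinear_closed[where xs="as @ y # x # bs" and W=W, unfolded eq]
  have "h (as @ y # x # bs) \<in> carrier ?M" "h' (as @ y # x # bs) \<in> carrier ?M"
    using as by (auto intro!: closed[OF h] closed[OF h'])
  moreover note skew_multilinear_swap[OF h as refl] skew_multilinear_swap[OF h' as refl]
  ultimately show "h (as @ x # y # bs) \<oplus>\<^bsub>W (degs (as @ x # y # bs))\<^esub> h' (as @ x # y # bs) =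
       [(- neg1 (fst x * fst y))] \<cdot>\<^bsub>?M\<^esub>
       (h (as @ y # x # bs) \<oplus>\<^bsub>W (degs (as @ y # x # bs))\<^esub> h' (as @ y # x # bs))"
    unfolding eq by (simp add: int_mult_add)
qed

lemma skew_multilinear_int_mult:
  fixes c :: "nat \<Rightarrow> int \<Rightarrow> int"
  assumes W: "graded_vector_space K W"
    and h: "skew_multilinear K A n W h"
  shows "skew_multilinear K A n W (\<lambda>xs. [(c (length xs) (degs xs))] \<cdot>\<^bsub>W (degs xs)\<^esub> h xs)"
  unfolding skew_multilinear_def
proof (intro conjI ballI impI allI)
  fix as bs p
  assume as: "as \<in> lists (homogs A)" "bs \<in> lists (homogs A)" "length as + 1 + length bs = n"
  have "(\<lambda>x. [(c n (degs as + p + degs bs))] \<cdot>\<^bsub>W (degs as + p + degs bs)\<^esub> h (as @ (p, x) # bs))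
      \<in> linear_maps K (A p) (W (degs as + p + degs bs))"
    by (rule linear_maps_int_mult[OF graded_module[OF W] skew_multilinear_slot[OF h as refl]])
  then show "(\<lambda>x. [(c (length (as @ (p, x) # bs)) (degs (as @ (p, x) # bs)))] \<cdot>\<^bsub>W (degs (as @ (p,
      x) # bs))\<^esub> h (as @ (p, x) # bs))
      \<in> linear_maps K (A p) (W (degs as + p + degs bs))"
    using as(3) by (simp add: add.assoc[symmetric])
next
  fix as bs x y
  assume as: "as \<in> lists (homogs A)" "bs \<in> lists (homogs A)" "x \<in> homogs A" "y \<in> homogs A"
      "length as + 2 + length bs = n"
  let ?M = "W (degs as + fst x + fst y + degs bs)"
  interpret abelian_group ?M by (rule graded_abelian_group[OF W])
  have eq: "degs (as @ x # y # bs) = degs as + fst x + fst y + degs bs"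
     "degs (as @ y # x # bs) = degs as + fst x + fst y + degs bs"
     "length (as @ x # y # bs) = n" "length (as @ y # x # bs) = n" using as by simp_all
  note closed = skew_multilinear_closed[where xs="as @ y # x # bs" and W=W, unfolded eq]
  have "h (as @ y # x # bs) \<in> carrier ?M"
    using as by (auto intro!: closed[OF h])
  moreover note skew_multilinear_swap[OF h as refl]
  ultimately show "[(c (length (as @ x # y # bs)) (degs (as @ x # y # bs)))] \<cdot>\<^bsub>W (degs (as @ x # y
      # bs))\<^esub> h (as @ x # y # bs) =
       [(- neg1 (fst x * fst y))] \<cdot>\<^bsub>?M\<^esub>
       ([(c (length (as @ y # x # bs)) (degs (as @ y # x # bs)))] \<cdot>\<^bsub>W (degs (as @ y # x # bs))\<^esub> h
           (as @ y # x # bs))"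
    unfolding eq by (simp add: int_mult_mult mult.commute)
qed

text \<open>
  Skew symmetry in the first two entries: if both go to the same list, skew symmetry of \<open>F\<close>
  applies, and the two ways of separating them are exchanged by the swap.
\<close>

lemma skew_multilinear_unshuffle_sum:
  assumes A: "graded_vector_space K A" and W: "graded_vector_space K W"
    and l: "\<And>zs. zs \<in> lists (homogs A) \<Longrightarrow> length zs \<le> n \<Longrightarrow>
      skew_multilinear K A (n - length zs) (shift W (degs zs)) (\<lambda>ys. F ys zs)"
    and r: "\<And>ys. ys \<in> lists (homogs A) \<Longrightarrow> length ys \<le> n \<Longrightarrow>
      skew_multilinear K A (n - length ys) (shift W (degs ys)) (\<lambda>zs. F ys zs)"
  shows "skew_multilinear K A n W (\<lambda>xs. unshuffle_sum (W (degs xs)) F xs)"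
  using W l r
proof (induction n arbitrary: W F)
  case 0
  then show ?case by (simp add: skew_multilinear_def)
next
  case (Suc n W F)
  note W = Suc.prems(1)
  have l: "zs \<in> lists (homogs A) \<Longrightarrow> length zs \<le> n \<Longrightarrow>
    skew_multilinear K A (Suc (n - length zs)) (shift W (degs zs)) (\<lambda>ys. F ys zs)" for zs
    using Suc.prems(2)[of zs] by (simp add: Suc_diff_le)
  have r: "ys \<in> lists (homogs A) \<Longrightarrow> length ys \<le> n \<Longrightarrow>
    skew_multilinear K A (Suc (n - length ys)) (shift W (degs ys)) (\<lambda>zs. F ys zs)" for ys
    using Suc.prems(3)[of ys] by (simp add: Suc_diff_le)
  let ?s = "\<lambda>a ys. neg1 (int (length ys) + fst a * degs ys)"
  have closed: "F ys zs \<in> carrier (W d)"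
    if "ys \<in> lists (homogs A)" "zs \<in> lists (homogs A)" "length ys + length zs = Suc n"
      "d = degs ys + degs zs" for ys zs d
  proof (cases "length zs \<le> n")
    case True
    then show ?thesis
      using skew_multilinear_closed[OF l, of zs ys] that by (simp add: shift_def)
  next
    case False
    then have "ys = []" "length zs = Suc n" using that(3) by (cases ys; simp)+
    then show ?thesis
      using skew_multilinear_closed[OF r, of ys zs] that by (simp add: shift_def)
  qed
  have split: "ys \<in> lists (homogs A) \<and> zs \<in> lists (homogs A) \<and> length ys + length zs =
      length xs \<and> degs ys + degs zs = degs xs"
    if "mset ys + mset zs = mset xs" "xs \<in> lists (homogs A)" for ys zs xs
    using splits_lists[OF that] splits_length[OF that(1)] splits_degs[OF that(1)] by simp
  show ?case
    unfolding skew_multilinear_Suc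
  proof (intro conjI ballI impI allI)
    fix a assume a: "a \<in> homogs A"
    let ?W = "shift W (fst a)"
    have W': "graded_vector_space K ?W" by (rule graded_shift[OF W])
    let ?F1 = "\<lambda>ys zs. F (a # ys) zs"
    let ?F2 = "\<lambda>ys zs. [(?s a ys)] \<cdot>\<^bsub>?W (degs ys + degs zs)\<^esub> F ys (a # zs)"
    have shift2: "shift (shift W p) q = shift W (p + q)" for p q
      by (simp add: shift_def ac_simps)
    have s1: "skew_multilinear K A n ?W (\<lambda>xs. unshuffle_sum (?W (degs xs)) ?F1 xs)"
    proof (rule Suc.IH[OF W'])
      fix zs assume "zs \<in> lists (homogs A)" "length zs \<le> n"
      from l[OF this] a show "skew_multilinear K A (n - length zs) (shift ?W (degs zs)) (\<lambda>ys. F (a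
          # ys) zs)"
        unfolding skew_multilinear_Suc by (simp add: shift2 add.commute)
    next
      fix ys assume "ys \<in> lists (homogs A)" "length ys \<le> n"
      with Suc.prems(3)[of "a # ys"] a
      show "skew_multilinear K A (n - length ys) (shift ?W (degs ys)) (F (a # ys))"
        by (simp add: shift2)
    qed
    have s2: "skew_multilinear K A n ?W (\<lambda>xs. unshuffle_sum (?W (degs xs)) ?F2 xs)"
    proof (rule Suc.IH[OF W'])
      fix zs assume "zs \<in> lists (homogs A)" "length zs \<le> n"
      with Suc.prems(2)[of "a # zs"] a
      have "skew_multilinear K A (n - length zs) (shift ?W (degs zs)) (\<lambda>ys. F ys (a # zs))"
        by (simp add: shift2)
      from skew_multilinear_int_mult[OF graded_shift[OF W'] this, of "\<lambda>n d. neg1 (int n + fst a *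
          d)"]
      show "skew_multilinear K A (n - length zs) (shift ?W (degs zs)) (\<lambda>ys. ?F2 ys zs)"
        by (simp add: shift_def ac_simps)
    next
      fix ys assume "ys \<in> lists (homogs A)" "length ys \<le> n"
      from r[OF this] a have "skew_multilinear K A (n - length ys) (shift ?W (degs ys)) (\<lambda>zs. F ys
          (a # zs))"
        unfolding skew_multilinear_Suc by (simp add: shift2 add.commute)
      from skew_multilinear_int_mult[OF graded_shift[OF W'] this, of "\<lambda>_ _. ?s a ys"]
      show "skew_multilinear K A (n - length ys) (shift ?W (degs ys)) (\<lambda>zs. ?F2 ys zs)"
        by (simp add: shift_def ac_simps)
    qed
    show "skew_multilinear K A n ?W (\<lambda>xs. unshuffle_sum (W (degs (a # xs))) F (a # xs))"
    proof (rule skew_multilinear_cong[OF A skew_multilinear_add[OF W' s1 s2]])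
      fix xs assume xs: "xs \<in> lists (homogs A)" "length xs = n"
      have "unshuffle_sum (?W (degs xs)) ?F2 xs =
        unshuffle_sum (?W (degs xs)) (\<lambda>ys zs. [(?s a ys)] \<cdot>\<^bsub>?W (degs xs)\<^esub> F ys (a # zs)) xs"
        by (rule unshuffle_sum_cong) (use split xs in auto)
      then show "unshuffle_sum (?W (degs xs)) ?F1 xs \<oplus>\<^bsub>?W (degs xs)\<^esub> unshuffle_sum (?W (degs xs))
          ?F2 xs =
        unshuffle_sum (W (degs (a # xs))) F (a # xs)"
        by (simp add: shift_def add.commute)
    qed
  next
    fix bs p assume bs: "bs \<in> lists (homogs A)" "length bs = n"
    have "(\<lambda>x. unshuffle_sum (W (p + degs bs)) F ((p, x) # bs)) \<in> linear_maps K (A p) (W (p + degs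
        bs))"
      unfolding unshuffle_sum.simps
    proof (intro linear_maps_add linear_maps_unshuffle_sum graded_module[OF W])
      fix ys zs assume "mset ys + mset zs = mset bs"
      from split[OF this bs(1)] bs have s: "ys \<in> lists (homogs A)" "zs \<in> lists (homogs A)"
        "length ys + length zs = n" "degs ys + degs zs = degs bs"
        by auto
      then have n: "length zs \<le> n" "length ys \<le> n" by auto
      show "(\<lambda>x. F ((p, x) # ys) zs) \<in> linear_maps K (A p) (W (p + degs bs))"
        using skew_multilinear_slot[OF l[OF s(2) n(1)], of "[]" ys "p + degs ys" p] s
        by (simp add: shift_def add.assoc)
      have "(\<lambda>x. F ys ((p, x) # zs)) \<in> linear_maps K (A p) (W (p + degs bs))"
        using skew_multilinear_slot[OF r[OF s(1) n(2)], of "[]" zs "p + degs zs" p] s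
        by (simp add: shift_def add.assoc add.commute[of "degs zs" "degs ys"])
      then show "(\<lambda>x. [(?s (p, x) ys)] \<cdot>\<^bsub>W (p + degs bs)\<^esub> F ys ((p, x) # zs)) \<in> linear_maps K (A
          p) (W (p + degs bs))"
        unfolding fst_conv by (rule linear_maps_int_mult[OF graded_module[OF W]])
    qed
    then show "(\<lambda>x. unshuffle_sum (W (degs ((p, x) # bs))) F ((p, x) # bs)) \<in> linear_maps K (A p)
        (W (p + degs bs))"
      by simp
  next
    fix bs x y assume bs: "bs \<in> lists (homogs A)" "Suc (length bs) = n"
      and x: "x \<in> homogs A" and y: "y \<in> homogs A"
    let ?d = "fst x + fst y + degs bs"
    let ?M = "W ?d"
    interpret abelian_group ?M by (rule graded_abelian_group[OF W])
    let ?k = "- neg1 (fst x * fst y)"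
    let ?S = "\<lambda>F. unshuffle_sum ?M F bs"
    have s: "ys \<in> lists (homogs A)" "zs \<in> lists (homogs A)" "length ys + length zs = length bs"
        "degs ys + degs zs = degs bs"  if "mset ys + mset zs = mset bs" for ys zs
      using split[OF that bs(1)] by auto
    have c: "F (x # y # ys) zs \<in> carrier ?M" "F (y # x # ys) zs \<in> carrier ?M"
      "F (x # ys) (y # zs) \<in> carrier ?M" "F (y # ys) (x # zs) \<in> carrier ?M"
      "F ys (x # y # zs) \<in> carrier ?M" "F ys (y # x # zs) \<in> carrier ?M"
      if "mset ys + mset zs = mset bs" for ys zs
      using s[OF that] bs x y by (auto intro!: closed)
    have kk: "?k = neg1 (1 + fst x * fst y)" by (simp add: neg1_def)
    have SB: "unshuffle_sum ?M F (u # v # bs) =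
      (?S (\<lambda>ys zs. F (u # v # ys) zs) \<oplus>\<^bsub>?M\<^esub> ?S (\<lambda>ys zs. [(?s v ys)] \<cdot>\<^bsub>?M\<^esub> F (u # ys) (v # zs)))
          \<oplus>\<^bsub>?M\<^esub>
      (?S (\<lambda>ys zs. [(?s u (v # ys))] \<cdot>\<^bsub>?M\<^esub> F (v # ys) (u # zs)) \<oplus>\<^bsub>?M\<^esub>
       ?S (\<lambda>ys zs. [(?s v ys)] \<cdot>\<^bsub>?M\<^esub> ([(?s u ys)] \<cdot>\<^bsub>?M\<^esub> F ys (u # v # zs))))" for u v
      by simp
    have 1: "?S (\<lambda>ys zs. F (x # y # ys) zs) = [?k] \<cdot>\<^bsub>?M\<^esub> ?S (\<lambda>ys zs. F (y # x # ys) zs)"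
    proof (subst unshuffle_sum_int_mult[symmetric])
      show "?S (\<lambda>ys zs. F (x # y # ys) zs) = ?S (\<lambda>ys zs. [?k] \<cdot>\<^bsub>?M\<^esub> F (y # x # ys) zs)"
      proof (rule unshuffle_sum_cong)
        fix ys zs assume m: "mset ys + mset zs = mset bs"
        have n: "length zs \<le> n" using s(3)[OF m] bs(2) by auto
        have "F ([] @ x # y # ys) zs = [?k] \<cdot>\<^bsub>shift W (degs zs) (?d - degs zs)\<^esub> F ([] @ y # x #
            ys) zs"
          by (rule skew_multilinear_swap[OF l[OF s(2)[OF m] n]]) (use s[OF m] x y bs(2) n in auto)
        then show "F (x # y # ys) zs = [?k] \<cdot>\<^bsub>?M\<^esub> F (y # x # ys) zs"
          by (simp add: shift_def)
      qed
    qed (rule c)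
    have 4: "?S (\<lambda>ys zs. [(?s y ys)] \<cdot>\<^bsub>?M\<^esub> ([(?s x ys)] \<cdot>\<^bsub>?M\<^esub> F ys (x # y # zs))) =
       [?k] \<cdot>\<^bsub>?M\<^esub> ?S (\<lambda>ys zs. [(?s x ys)] \<cdot>\<^bsub>?M\<^esub> ([(?s y ys)] \<cdot>\<^bsub>?M\<^esub> F ys (y # x # zs)))"
    proof (subst unshuffle_sum_int_mult[symmetric])
      show "?S (\<lambda>ys zs. [(?s y ys)] \<cdot>\<^bsub>?M\<^esub> ([(?s x ys)] \<cdot>\<^bsub>?M\<^esub> F ys (x # y # zs))) =
        ?S (\<lambda>ys zs. [?k] \<cdot>\<^bsub>?M\<^esub> ([(?s x ys)] \<cdot>\<^bsub>?M\<^esub> ([(?s y ys)] \<cdot>\<^bsub>?M\<^esub> F ys (y # x # zs))))"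
      proof (rule unshuffle_sum_cong)
        fix ys zs assume m: "mset ys + mset zs = mset bs"
        have n: "length ys \<le> n" using s(3)[OF m] bs(2) by auto
        have "F ys ([] @ x # y # zs) = [?k] \<cdot>\<^bsub>shift W (degs ys) (?d - degs ys)\<^esub> F ys ([] @ y # x #
            zs)"
          by (rule skew_multilinear_swap[OF r[OF s(1)[OF m] n]]) (use s[OF m] x y bs(2) n in auto)
        then have "F ys (x # y # zs) = [?k] \<cdot>\<^bsub>?M\<^esub> F ys (y # x # zs)"
          by (simp add: shift_def)
        then show "[(?s y ys)] \<cdot>\<^bsub>?M\<^esub> ([(?s x ys)] \<cdot>\<^bsub>?M\<^esub> F ys (x # y # zs)) =
           [?k] \<cdot>\<^bsub>?M\<^esub> ([(?s x ys)] \<cdot>\<^bsub>?M\<^esub> ([(?s y ys)] \<cdot>\<^bsub>?M\<^esub> F ys (y # x # zs)))"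
          by (simp add: int_mult_mult c[OF m] mult_ac)
      qed
    qed (intro add.int_pow_closed c)
    have 2: "?S (\<lambda>ys zs. [(?s y ys)] \<cdot>\<^bsub>?M\<^esub> F (x # ys) (y # zs)) =
       [?k] \<cdot>\<^bsub>?M\<^esub> ?S (\<lambda>ys zs. [(?s y (x # ys))] \<cdot>\<^bsub>?M\<^esub> F (x # ys) (y # zs))"
    proof (subst unshuffle_sum_int_mult[symmetric])
      show "?S (\<lambda>ys zs. [(?s y ys)] \<cdot>\<^bsub>?M\<^esub> F (x # ys) (y # zs)) =
        ?S (\<lambda>ys zs. [?k] \<cdot>\<^bsub>?M\<^esub> ([(?s y (x # ys))] \<cdot>\<^bsub>?M\<^esub> F (x # ys) (y # zs)))"
        unfolding kk
        by (rule unshuffle_sum_cong, subst neg1_act_act[OF c(3)], assumption,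
            rule arg_cong[where f="\<lambda>k. [k] \<cdot>\<^bsub>?M\<^esub> _"], rule neg1_cong) (simp add: algebra_simps)
    qed (intro add.int_pow_closed c)
    have 3: "?S (\<lambda>ys zs. [(?s x (y # ys))] \<cdot>\<^bsub>?M\<^esub> F (y # ys) (x # zs)) =
       [?k] \<cdot>\<^bsub>?M\<^esub> ?S (\<lambda>ys zs. [(?s x ys)] \<cdot>\<^bsub>?M\<^esub> F (y # ys) (x # zs))"
    proof (subst unshuffle_sum_int_mult[symmetric])
      show "?S (\<lambda>ys zs. [(?s x (y # ys))] \<cdot>\<^bsub>?M\<^esub> F (y # ys) (x # zs)) =
        ?S (\<lambda>ys zs. [?k] \<cdot>\<^bsub>?M\<^esub> ([(?s x ys)] \<cdot>\<^bsub>?M\<^esub> F (y # ys) (x # zs)))"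
        unfolding kk
        by (rule unshuffle_sum_cong, subst neg1_act_act[OF c(4)], assumption,
            rule arg_cong[where f="\<lambda>k. [k] \<cdot>\<^bsub>?M\<^esub> _"], rule neg1_cong) (simp add: algebra_simps)
    qed (intro add.int_pow_closed c)
    have cl: "?S (\<lambda>ys zs. F (y # x # ys) zs) \<in> carrier ?M"
      "?S (\<lambda>ys zs. [(?s y (x # ys))] \<cdot>\<^bsub>?M\<^esub> F (x # ys) (y # zs)) \<in> carrier ?M"
      "?S (\<lambda>ys zs. [(?s x ys)] \<cdot>\<^bsub>?M\<^esub> F (y # ys) (x # zs)) \<in> carrier ?M"
      "?S (\<lambda>ys zs. [(?s x ys)] \<cdot>\<^bsub>?M\<^esub> ([(?s y ys)] \<cdot>\<^bsub>?M\<^esub> F ys (y # x # zs))) \<in> carrier ?M"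
      by (intro unshuffle_sum_closed add.int_pow_closed c, assumption)+
    have perm: "([k] \<cdot>\<^bsub>?M\<^esub> a \<oplus>\<^bsub>?M\<^esub> [k] \<cdot>\<^bsub>?M\<^esub> b) \<oplus>\<^bsub>?M\<^esub> ([k] \<cdot>\<^bsub>?M\<^esub> c \<oplus>\<^bsub>?M\<^esub> [k] \<cdot>\<^bsub>?M\<^esub> d) =
       [k] \<cdot>\<^bsub>?M\<^esub> ((a \<oplus>\<^bsub>?M\<^esub> c) \<oplus>\<^bsub>?M\<^esub> (b \<oplus>\<^bsub>?M\<^esub> d))"
      if "a \<in> carrier ?M" "b \<in> carrier ?M" "c \<in> carrier ?M" "d \<in> carrier ?M" for a b c d
          and k :: int
      using that by (simp add: int_mult_add a_ac)
    have "unshuffle_sum ?M F (x # y # bs) = [?k] \<cdot>\<^bsub>?M\<^esub> unshuffle_sum ?M F (y # x # bs)"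
      unfolding SB 1 2 3 4 by (rule perm[OF cl])
    then show "unshuffle_sum (W (degs (x # y # bs))) F (x # y # bs) =
      [?k] \<cdot>\<^bsub>?M\<^esub> unshuffle_sum (W (degs (y # x # bs))) F (y # x # bs)"
      by (simp add: ac_simps)
  qed
qed

section \<open>Spaces of intertwiners\<close>

lemma itw_target_eq: "itw_target V n xs m = V (degs xs + m + (n - int (length xs)))"
  by (simp add: itw_target_def shift_def)

lemma itw_dom_iff: "(xs, u) \<in> itw_dom A U \<longleftrightarrow> xs \<in> lists (homogs A) \<and> u \<in> homogs U"
  by (auto simp: itw_dom_def)

text \<open>
  The component that contains a value is given by an equation, so that the lemmas apply however the
  index happens to be written.
\<close>

lemma intertwiner_closed:
  assumes "f \<in> intertwiners K A U V n" "xs \<in> lists (homogs A)" "u \<in> homogs U"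
    "d = degs xs + fst u + n - int (length xs)"
  shows "f (xs, u) \<in> carrier (V d)"
proof -
  have "f \<in> (\<Pi>\<^sub>E (xs, u) \<in> itw_dom A U. carrier (itw_target V n xs (fst u)))"
    using assms(1) by (simp add: intertwiners_def)
  from PiE_mem[OF this, of "(xs, u)"] have "f (xs, u) \<in> carrier (itw_target V n xs (fst u))"
    using assms(2,3) by (simp add: itw_dom_iff)
  moreover have "itw_target V n xs (fst u) = V d"
    unfolding itw_target_eq assms(4) by (simp add: algebra_simps)
  ultimately show ?thesis by simp
qed

lemma intertwiner_skew:
  assumes "f \<in> intertwiners K A U V n" "u \<in> homogs U" "d = n - int k + fst u"
  shows "skew_multilinear K A k (shift V d) (\<lambda>xs. f (xs, u))"
proof -
  have "\<forall>u\<in>homogs U. \<forall>i\<ge>1.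
           skew_multilinear K A (i - 1) (shift V (n - int (i - 1) + fst u)) (\<lambda>xs. f (xs, u))"
    using assms(1) by (simp add: intertwiners_def)
  from this[rule_format, OF assms(2), of "Suc k"] show ?thesis
    by (simp add: assms(3))
qed

lemma intertwiner_linear:
  assumes "f \<in> intertwiners K A U V n" "xs \<in> lists (homogs A)"
    "d = degs xs + m + n - int (length xs)"
  shows "(\<lambda>y. f (xs, (m, y))) \<in> linear_maps K (U m) (V d)"
proof -
  have "\<forall>xs\<in>lists (homogs A). \<forall>m.
           (\<lambda>y. f (xs, (m, y))) \<in> linear_maps K (U m) (itw_target V n xs m)"
    using assms(1) by (simp add: intertwiners_def)
  moreover have "itw_target V n xs m = V d"
    unfolding itw_target_eq assms(3) by (simp add: algebra_simps)
  ultimately show ?thesis using assms(2) by metis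
qed

lemma intertwiner_extensional:
  "f \<in> intertwiners K A U V n \<Longrightarrow> f \<in> extensional (itw_dom A U)"
  by (simp add: intertwiners_def PiE_def)

lemma intertwiner_eqI:
  assumes "f \<in> extensional (itw_dom A U)" "g \<in> extensional (itw_dom A U)"
    and "\<And>xs u. xs \<in> lists (homogs A) \<Longrightarrow> u \<in> homogs U \<Longrightarrow> f (xs, u) = g (xs, u)"
  shows "f = g"
  by (rule extensionalityI[OF assms(1,2)]) (auto simp: itw_dom_def intro: assms(3))

lemma restrict_intertwiner:
  assumes A: "graded_vector_space K A" and U: "graded_vector_space K U"
    and closed: "\<And>xs u. xs \<in> lists (homogs A) \<Longrightarrow> u \<in> homogs U \<Longrightarrow>
      f (xs, u) \<in> carrier (V (degs xs + fst u + n - int (length xs)))"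
    and skew: "\<And>u k. u \<in> homogs U \<Longrightarrow>
      skew_multilinear K A k (shift V (n - int k + fst u)) (\<lambda>xs. f (xs, u))"
    and lin: "\<And>xs m. xs \<in> lists (homogs A) \<Longrightarrow>
      (\<lambda>y. f (xs, (m, y))) \<in> linear_maps K (U m) (V (degs xs + m + n - int (length xs)))"
  shows "restrict f (itw_dom A U) \<in> intertwiners K A U V n"
  unfolding intertwiners_def
proof (intro CollectI conjI ballI allI impI)
  let ?f = "restrict f (itw_dom A U)"
  show "?f \<in> (\<Pi>\<^sub>E (xs, u) \<in> itw_dom A U. carrier (itw_target V n xs (fst u)))"
    using closed by (auto simp: itw_dom_def itw_target_eq algebra_simps)
  show "skew_multilinear K A (i - 1) (shift V (n - int (i - 1) + fst u)) (\<lambda>xs. ?f (xs, u))"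
    if "u \<in> homogs U" for u i
    by (rule skew_multilinear_cong[OF A skew[OF that]]) (simp add: that itw_dom_iff)
  show "(\<lambda>y. ?f (xs, (m, y))) \<in> linear_maps K (U m) (itw_target V n xs m)"
    if "xs \<in> lists (homogs A)" for xs m
    by (rule linear_maps_cong[OF graded_module[OF U], where h = "\<lambda>y. f (xs, (m, y))"])
      (use that lin[OF that, of m] in \<open>auto simp: itw_dom_iff itw_target_eq homogs_iff
          algebra_simps\<close>)
qed

lemma skew_multilinear_zero:
  fixes A :: "('k, 'g) graded"
  assumes W: "graded_vector_space K W"
  shows "skew_multilinear K A n W (\<lambda>xs. \<zero>\<^bsub>W (degs xs)\<^esub>)"
  unfolding skew_multilinear_def
proof (intro conjI ballI impI allI)
  fix as bs :: "'g homogeneous list" and p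
  show "(\<lambda>x. \<zero>\<^bsub>W (degs (as @ (p, x) # bs))\<^esub>) \<in> linear_maps K (A p) (W (degs as + p + degs bs))"
    using linear_maps_zero[OF graded_module[OF W]] by (simp add: add.assoc)
  fix x y :: "'g homogeneous"
  interpret abelian_group "W (degs as + fst x + fst y + degs bs)"
    by (rule graded_abelian_group[OF W])
  show "\<zero>\<^bsub>W (degs (as @ x # y # bs))\<^esub> = [(- neg1 (fst x * fst y))] \<cdot>\<^bsub>W (degs as + fst x + fst y +
      degs bs)\<^esub>
     \<zero>\<^bsub>W (degs (as @ y # x # bs))\<^esub>"
    using int_mult_zero by (simp add: ac_simps)
qed

lemma skew_multilinear_comp:
  assumes h: "skew_multilinear K A n W h"
    and \<phi>: "\<And>d. \<phi> d \<in> linear_maps K (W d) (W' d)"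
    and W: "graded_vector_space K W" and W': "graded_vector_space K W'"
  shows "skew_multilinear K A n W' (\<lambda>xs. \<phi> (degs xs) (h xs))"
  unfolding skew_multilinear_def
proof (intro conjI ballI impI allI)
  fix as bs p
  assume as: "as \<in> lists (homogs A)" "bs \<in> lists (homogs A)" "length as + 1 + length bs = n"
  show "(\<lambda>x. \<phi> (degs (as @ (p, x) # bs)) (h (as @ (p, x) # bs)))
      \<in> linear_maps K (A p) (W' (degs as + p + degs bs))"
    using linear_maps_comp[OF skew_multilinear_slot[OF h as refl] \<phi>]
    by (simp add: add.assoc)
next
  fix as bs x y
  assume as: "as \<in> lists (homogs A)" "bs \<in> lists (homogs A)" "x \<in> homogs A" "y \<in> homogs A"
      "length as + 2 + length bs = n"
  let ?d = "degs as + fst x + fst y + degs bs"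
  have eq: "degs (as @ x # y # bs) = ?d" "degs (as @ y # x # bs) = ?d" by simp_all
  have c: "h (as @ y # x # bs) \<in> carrier (W ?d)"
    using skew_multilinear_closed[OF h, of "as @ y # x # bs", unfolded eq] as by auto
  show "\<phi> (degs (as @ x # y # bs)) (h (as @ x # y # bs)) =
       [(- neg1 (fst x * fst y))] \<cdot>\<^bsub>W' ?d\<^esub> \<phi> (degs (as @ y # x # bs)) (h (as @ y # x # bs))"
    unfolding eq skew_multilinear_swap[OF h as refl]
    by (rule linear_maps_int_mult_commute[OF \<phi> graded_module[OF W] graded_module[OF W'] c])
qed

lemma skew_multilinear_smult:
  assumes h: "skew_multilinear K A n W h" and W: "graded_vector_space K W" and c: "c \<in> carrier K"
  shows "skew_multilinear K A n W (\<lambda>xs. c \<odot>\<^bsub>W (degs xs)\<^esub> h xs)"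
proof (rule skew_multilinear_comp[OF h _ W W])
  fix d
  show "(\<odot>\<^bsub>W d\<^esub>) c \<in> linear_maps K (W d) (W d)"
    by (rule linear_maps_smult[OF graded_module[OF W] _ c, of "\<lambda>x. x"]) (rule linear_mapsI; simp)
qed

lemma itw_space_simps:
  "carrier (itw_space K A U V n) = intertwiners K A U V n"
  "\<zero>\<^bsub>itw_space K A U V n\<^esub> = (\<lambda>(xs, u)\<in>itw_dom A U. \<zero>\<^bsub>itw_target V n xs (fst u)\<^esub>)"
  "f \<oplus>\<^bsub>itw_space K A U V n\<^esub> g =
     (\<lambda>(xs, u)\<in>itw_dom A U. f (xs, u) \<oplus>\<^bsub>itw_target V n xs (fst u)\<^esub> g (xs, u))"
  "c \<odot>\<^bsub>itw_space K A U V n\<^esub> f = (\<lambda>(xs, u)\<in>itw_dom A U. c \<odot>\<^bsub>itw_target V n xs (fst u)\<^esub> f (xs, u))"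
  by (simp_all add: itw_space_def)

lemma itw_space_module:
  fixes A :: "('k, 'g) graded" and U :: "('k, 'u) graded" and V :: "('k, 'v) graded"
  assumes A: "graded_vector_space K A" and U: "graded_vector_space K U"
      and V: "graded_vector_space K V"
  shows "module K (itw_space K A U V n)"
proof -
  let ?H = "itw_space K A U V n"
  let ?T = "\<lambda>xs u. itw_target V n xs (fst u)"
  note mod = graded_module[OF V]
  have T: "module K (itw_target V n xs m)" for xs :: "'g homogeneous list" and m
    by (simp add: itw_target_eq mod)
  have tr: "itw_target V n xs m = V (degs xs + m + n - int (length xs))"
      for xs :: "'g homogeneous list" and m
    by (simp add: itw_target_eq algebra_simps)
  have "cring K" using mod[of 0] by (rule module.axioms)
  interpret K: cring K by fact
  have shift_eq: "W (degs xs + fst u + n - int (length xs)) = shift W (n - int (length xs) + fst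
      u) (degs xs)"
    for W :: "int \<Rightarrow> ('k, 'v) module" and xs :: "'g homogeneous list" and u :: "'u homogeneous"
    by (simp add: shift_def algebra_simps)
  have sk: "skew_multilinear K A k (shift V (n - int k + fst u)) (\<lambda>xs. G xs (shift V (n - int k +
      fst u) (degs xs)))
    \<Longrightarrow> skew_multilinear K A k (shift V (n - int k + fst u)) (\<lambda>xs. G xs (?T xs u))"
    for k and u :: "'u homogeneous" and G
  proof (erule skew_multilinear_cong[OF A])
    fix xs :: "'g homogeneous list" assume k: "length xs = k"
    have "shift V (n - int k + fst u) (degs xs) = ?T xs u"
      unfolding itw_target_eq shift_def k by (simp add: algebra_simps)
    then show "G xs (shift V (n - int k + fst u) (degs xs)) = G xs (?T xs u)" by simp
  qed
  have closed_add: "f \<oplus>\<^bsub>?H\<^esub> g \<in> carrier ?H" if "f \<in> carrier ?H" "g \<in> carrier ?H" for f g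
  proof -
    have f: "f \<in> intertwiners K A U V n" "g \<in> intertwiners K A U V n"
      using that by (simp_all add: itw_space_simps)
    show ?thesis
      unfolding itw_space_simps
    proof (rule restrict_intertwiner[OF A U], unfold prod.case fst_conv)
      fix xs u assume "xs \<in> lists (homogs A)" "u \<in> homogs U"
      then show "f (xs, u) \<oplus>\<^bsub>?T xs u\<^esub> g (xs, u) \<in> carrier (V (degs xs + fst u + n - int (length
          xs)))"
        using f by (auto simp: tr intro!: abelian_groupE(1)[OF graded_abelian_group[OF V]]
            intertwiner_closed)
    next
      fix u k assume u: "u \<in> homogs U"
      show "skew_multilinear K A k (shift V (n - int k + fst u)) (\<lambda>xs. f (xs, u) \<oplus>\<^bsub>?T xs u\<^esub> g (xs,
          u))"
        by (rule sk[of k u "\<lambda>xs M. f (xs, u) \<oplus>\<^bsub>M\<^esub> g (xs, u)"],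
            rule skew_multilinear_add[OF graded_shift[OF V] intertwiner_skew[OF f(1) u refl]
                intertwiner_skew[OF f(2) u refl]])
    next
      fix xs m assume xs: "xs \<in> lists (homogs A)"
      show "(\<lambda>y. f (xs, (m, y)) \<oplus>\<^bsub>itw_target V n xs m\<^esub> g (xs, (m, y))) \<in> linear_maps K (U m) (V
          (degs xs + m + n - int (length xs)))"
        unfolding tr by (rule linear_maps_add[OF mod intertwiner_linear[OF f(1) xs refl]
            intertwiner_linear[OF f(2) xs refl]])
    qed
  qed
  have closed_smult: "c \<odot>\<^bsub>?H\<^esub> f \<in> carrier ?H" if "c \<in> carrier K" "f \<in> carrier ?H" for c f
  proof -
    have f: "f \<in> intertwiners K A U V n" and c: "c \<in> carrier K"
      using that by (simp_all add: itw_space_simps)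
    show ?thesis
      unfolding itw_space_simps
    proof (rule restrict_intertwiner[OF A U], unfold prod.case fst_conv)
      fix xs u assume "xs \<in> lists (homogs A)" "u \<in> homogs U"
      then show "c \<odot>\<^bsub>?T xs u\<^esub> f (xs, u) \<in> carrier (V (degs xs + fst u + n - int (length xs)))"
        using f c by (auto simp: tr intro!: module.smult_closed[OF mod] intertwiner_closed)
    next
      fix u k assume u: "u \<in> homogs U"
      show "skew_multilinear K A k (shift V (n - int k + fst u)) (\<lambda>xs. c \<odot>\<^bsub>?T xs u\<^esub> f (xs, u))"
        by (rule sk[of k u "\<lambda>xs M. c \<odot>\<^bsub>M\<^esub> f (xs, u)"],
            rule skew_multilinear_smult[OF intertwiner_skew[OF f u refl] graded_shift[OF V] c])
    next
      fix xs m assume xs: "xs \<in> lists (homogs A)"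
      show "(\<lambda>y. c \<odot>\<^bsub>itw_target V n xs m\<^esub> f (xs, (m, y))) \<in> linear_maps K (U m) (V (degs xs + m +
          n - int (length xs)))"
        unfolding tr by (rule linear_maps_smult[OF mod intertwiner_linear[OF f xs refl] c])
    qed
  qed
  have closed_zero: "\<zero>\<^bsub>?H\<^esub> \<in> carrier ?H"
    unfolding itw_space_simps
  proof (rule restrict_intertwiner[OF A U], unfold prod.case fst_conv)
    fix xs u assume "xs \<in> lists (homogs A)" "u \<in> homogs U"
    then show "\<zero>\<^bsub>?T xs u\<^esub> \<in> carrier (V (degs xs + fst u + n - int (length xs)))"
      unfolding tr by (intro abelian_groupE(2)[OF graded_abelian_group[OF V]])
  next
    fix u k assume u: "u \<in> homogs U"
    show "skew_multilinear K A k (shift V (n - int k + fst u)) (\<lambda>xs. \<zero>\<^bsub>?T xs u\<^esub>)"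
      by (rule sk[of k u "\<lambda>xs M. \<zero>\<^bsub>M\<^esub>"], rule skew_multilinear_zero[OF graded_shift[OF V]])
  next
    fix xs m assume xs: "xs \<in> lists (homogs A)"
    show "(\<lambda>y. \<zero>\<^bsub>itw_target V n xs m\<^esub>) \<in> linear_maps K (U m) (V (degs xs + m + n - int (length
        xs)))"
      unfolding tr by (rule linear_maps_zero[OF mod])
  qed
  have ext: "f = g" if "f \<in> extensional (itw_dom A U)" "g \<in> extensional (itw_dom A U)"
    "\<And>xs u. (xs, u) \<in> itw_dom A U \<Longrightarrow> f (xs, u) = g (xs, u)" for f g
    using that by (intro intertwiner_eqI) (auto simp: itw_dom_iff)
  have val: "f (xs, u) \<in> carrier (?T xs u)" if "f \<in> carrier ?H" "(xs, u) \<in> itw_dom A U" for f xs u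
    using that by (auto simp: itw_space_simps tr itw_dom_iff intro!: intertwiner_closed)
  have exH: "f \<in> extensional (itw_dom A U)" if "f \<in> carrier ?H" for f
    using that by (auto simp: itw_space_simps intro: intertwiner_extensional)
  note aM = module.axioms(2)[OF T]
  note T_simps = abelian_groupE[OF aM]
  show ?thesis
  proof (rule moduleI[OF \<open>cring K\<close>])
    show "abelian_group ?H"
    proof (rule abelian_groupI)
      fix f g h assume f: "f \<in> carrier ?H" and g: "g \<in> carrier ?H" and h: "h \<in> carrier ?H"
      show "f \<oplus>\<^bsub>?H\<^esub> g \<oplus>\<^bsub>?H\<^esub> h = f \<oplus>\<^bsub>?H\<^esub> (g \<oplus>\<^bsub>?H\<^esub> h)"
        by (rule ext) (auto simp: itw_space_simps(3) intro!: T_simps(3) val f g h)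
      show "f \<oplus>\<^bsub>?H\<^esub> g = g \<oplus>\<^bsub>?H\<^esub> f"
      proof (rule ext)
        fix xs u assume d: "(xs, u) \<in> itw_dom A U"
        from T_simps(4)[OF val[OF f d] val[OF g d]] d
        show "(f \<oplus>\<^bsub>?H\<^esub> g) (xs, u) = (g \<oplus>\<^bsub>?H\<^esub> f) (xs, u)"
          by (simp add: itw_space_simps(3))
      qed (simp_all add: itw_space_simps(3))
      show "\<zero>\<^bsub>?H\<^esub> \<oplus>\<^bsub>?H\<^esub> f = f"
        by (rule ext) (auto simp: itw_space_simps(2,3) exH f intro!: T_simps(5) val f)
      show "\<exists>g\<in>carrier ?H. g \<oplus>\<^bsub>?H\<^esub> f = \<zero>\<^bsub>?H\<^esub>"
      proof (rule bexI)
        (* The negative of f is obtained from scalar multiplication, whose closure is known. *)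
        show "(\<ominus>\<^bsub>K\<^esub> \<one>\<^bsub>K\<^esub>) \<odot>\<^bsub>?H\<^esub> f \<in> carrier ?H" by (rule closed_smult) (simp_all add: f)
        show "(\<ominus>\<^bsub>K\<^esub> \<one>\<^bsub>K\<^esub>) \<odot>\<^bsub>?H\<^esub> f \<oplus>\<^bsub>?H\<^esub> f = \<zero>\<^bsub>?H\<^esub>"
        proof (rule ext)
          fix xs u assume d: "(xs, u) \<in> itw_dom A U"
          interpret M: module K "?T xs u" by (rule T)
          show "((\<ominus>\<^bsub>K\<^esub> \<one>\<^bsub>K\<^esub>) \<odot>\<^bsub>?H\<^esub> f \<oplus>\<^bsub>?H\<^esub> f) (xs, u) = \<zero>\<^bsub>?H\<^esub> (xs, u)"
            using d val[OF f d] by (simp add: itw_space_simps M.smult_l_minus M.l_neg)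
        qed (auto simp: itw_space_simps)
      qed
    qed (use closed_add closed_zero in auto)
  next
    fix c f assume "c \<in> carrier K" "f \<in> carrier ?H"
    then show "c \<odot>\<^bsub>?H\<^esub> f \<in> carrier ?H" by (rule closed_smult)
  next
    fix a b f g assume a: "a \<in> carrier K" and b: "b \<in> carrier K" and f: "f \<in> carrier ?H"
    show "(a \<oplus>\<^bsub>K\<^esub> b) \<odot>\<^bsub>?H\<^esub> f = a \<odot>\<^bsub>?H\<^esub> f \<oplus>\<^bsub>?H\<^esub> b \<odot>\<^bsub>?H\<^esub> f"
      by (rule ext) (auto simp: itw_space_simps(3,4) intro!: module.smult_l_distr[OF T] val a b f)
    show "(a \<otimes>\<^bsub>K\<^esub> b) \<odot>\<^bsub>?H\<^esub> f = a \<odot>\<^bsub>?H\<^esub> (b \<odot>\<^bsub>?H\<^esub> f)"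
      by (rule ext) (auto simp: itw_space_simps(3,4) intro!: module.smult_assoc1[OF T] val a b f)
    fix g assume g: "g \<in> carrier ?H"
    show "a \<odot>\<^bsub>?H\<^esub> (f \<oplus>\<^bsub>?H\<^esub> g) = a \<odot>\<^bsub>?H\<^esub> f \<oplus>\<^bsub>?H\<^esub> a \<odot>\<^bsub>?H\<^esub> g"
      by (rule ext) (auto simp: itw_space_simps(3,4) intro!: module.smult_r_distr[OF T] val a b f g)
  next
    fix f assume f: "f \<in> carrier ?H"
    show "\<one>\<^bsub>K\<^esub> \<odot>\<^bsub>?H\<^esub> f = f"
      by (rule ext) (auto simp: itw_space_simps(3,4) exH f intro!: module.smult_one[OF T] val f)
  qed
qed

lemma itw_target_eqI: "d = degs xs + m + n - int (length xs) \<Longrightarrow> itw_target V n xs m = V d"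
  unfolding itw_target_eq by (rule arg_cong[of _ _ V]) simp

lemma intertwiner_eval_linear:
  assumes A: "graded_vector_space K A" and V: "graded_vector_space K V"
    and "xs \<in> lists (homogs A)" "u \<in> homogs U"
    and d: "d = degs xs + fst u + n - int (length xs)"
  shows "(\<lambda>f. f (xs, u)) \<in> linear_maps K (itw_space K A U V n) (V d)"
  by (rule linear_mapsI)
    (use assms in \<open>auto simp: itw_space_simps itw_dom_iff itw_target_eqI[OF d] intro!:
        intertwiner_closed\<close>)

lemma linear_maps_itw_space:
  assumes V: "graded_vector_space K V"
    and closed: "\<And>x. x \<in> carrier M \<Longrightarrow> \<Phi> x \<in> intertwiners K A U V n"
    and lin: "\<And>xs u. xs \<in> lists (homogs A) \<Longrightarrow> u \<in> homogs U \<Longrightarrow>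
      (\<lambda>x. \<Phi> x (xs, u)) \<in> linear_maps K M (V (degs xs + fst u + n - int (length xs)))"
    and M: "module K M"
  shows "\<Phi> \<in> linear_maps K M (itw_space K A U V n)"
proof (rule linear_mapsI)
  interpret M: module K M by (rule M)
  fix x assume x: "x \<in> carrier M"
  then show "\<Phi> x \<in> carrier (itw_space K A U V n)"
    by (simp add: itw_space_simps closed)
  fix y assume y: "y \<in> carrier M"
  show "\<Phi> (x \<oplus>\<^bsub>M\<^esub> y) = \<Phi> x \<oplus>\<^bsub>itw_space K A U V n\<^esub> \<Phi> y"
    by (rule intertwiner_eqI[OF intertwiner_extensional[OF closed]])
      (simp_all add: x y itw_space_simps itw_dom_iff linear_mapsD(2)[OF lin] itw_target_eqI[OF
          refl])
next
  interpret M: module K M by (rule M)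
  fix c x assume c: "c \<in> carrier K" and x: "x \<in> carrier M"
  show "\<Phi> (c \<odot>\<^bsub>M\<^esub> x) = c \<odot>\<^bsub>itw_space K A U V n\<^esub> \<Phi> x"
    by (rule intertwiner_eqI[OF intertwiner_extensional[OF closed]])
      (simp_all add: x c itw_space_simps itw_dom_iff linear_mapsD(3)[OF lin] itw_target_eqI[OF
          refl])
qed

text \<open>
  Juxtapositions and the action of the brackets are both given by sums over unshuffles, and they are
  intertwiners for this common reason.
\<close>

lemma unshuffle_sum_intertwiner:
  fixes T :: "('k, 'v) module \<Rightarrow> 'u homogeneous \<Rightarrow> 'g homogeneous list \<Rightarrow> 'g homogeneous list \<Rightarrow> 'v"
  assumes A: "graded_vector_space K A" and U: "graded_vector_space K U"
      and V: "graded_vector_space K V"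
    and ext: "h \<in> extensional (itw_dom A U)"
    and val: "\<And>xs u d. xs \<in> lists (homogs A) \<Longrightarrow> u \<in> homogs U \<Longrightarrow>
      d = degs xs + fst u + n - int (length xs) \<Longrightarrow> h (xs, u) = unshuffle_sum (V d) (T (V d) u) xs"
    and lin: "\<And>xs ys zs m d. xs \<in> lists (homogs A) \<Longrightarrow> mset ys + mset zs = mset xs \<Longrightarrow>
      d = degs xs + m + n - int (length xs) \<Longrightarrow>
      (\<lambda>y. T (V d) (m, y) ys zs) \<in> linear_maps K (U m) (V d)"
    and left: "\<And>u k zs s. u \<in> homogs U \<Longrightarrow> zs \<in> lists (homogs A) \<Longrightarrow>
      s = n - int (k + length zs) + fst u + degs zs \<Longrightarrow>
      skew_multilinear K A k (shift V s) (\<lambda>ys. T (shift V s (degs ys)) u ys zs)"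
    and right: "\<And>u k ys s. u \<in> homogs U \<Longrightarrow> ys \<in> lists (homogs A) \<Longrightarrow>
      s = n - int (k + length ys) + fst u + degs ys \<Longrightarrow>
      skew_multilinear K A k (shift V s) (\<lambda>zs. T (shift V s (degs zs)) u ys zs)"
  shows "h \<in> intertwiners K A U V n"
proof -
  have "restrict h (itw_dom A U) \<in> intertwiners K A U V n"
  proof (rule restrict_intertwiner[OF A U])
    fix xs assume xs: "xs \<in> lists (homogs A)"
    show lin': "(\<lambda>y. h (xs, (m, y))) \<in> linear_maps K (U m) (V (degs xs + m + n - int (length
        xs)))" for m
    proof -
      let ?M = "V (degs xs + m + n - int (length xs))"
      have "(\<lambda>y. unshuffle_sum ?M (T ?M (m, y)) xs) \<in> linear_maps K (U m) ?M"
        by (rule linear_maps_unshuffle_sum[OF graded_module[OF V] lin[OF xs _ refl]])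
      then show ?thesis
        by (rule linear_maps_cong[OF graded_module[OF U]]) (simp add: val[OF xs _ refl] homogs_iff)
    qed
    fix u assume "u \<in> homogs U"
    then show "h (xs, u) \<in> carrier (V (degs xs + fst u + n - int (length xs)))"
      using linear_mapsD(1)[OF lin', of "snd u" "fst u"] by (simp add: homogs_iff)
  next
    fix u k assume u: "u \<in> homogs U"
    let ?W = "shift V (n - int k + fst u)"
    let ?F = "\<lambda>ys zs. T (?W (degs ys + degs zs)) u ys zs"
    have eq: "shift (shift V s) t = shift V (s + t)" for s t
      by (simp add: shift_def ac_simps)
    have "skew_multilinear K A k ?W (\<lambda>xs. unshuffle_sum (?W (degs xs)) ?F xs)"
    proof (rule skew_multilinear_unshuffle_sum[OF A graded_shift[OF V]])
      fix zs assume "zs \<in> lists (homogs A)" "length zs \<le> k"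
      then show "skew_multilinear K A (k - length zs) (shift ?W (degs zs)) (\<lambda>ys. ?F ys zs)"
        using left[OF u, of zs _ "k - length zs"] by (simp add: eq) (simp add: shift_def ac_simps)
    next
      fix ys assume "ys \<in> lists (homogs A)" "length ys \<le> k"
      then show "skew_multilinear K A (k - length ys) (shift ?W (degs ys)) (\<lambda>zs. ?F ys zs)"
        using right[OF u, of ys _ "k - length ys"] by (simp add: eq) (simp add: shift_def ac_simps)
    qed
    then show "skew_multilinear K A k ?W (\<lambda>xs. h (xs, u))"
    proof (rule skew_multilinear_cong[OF A])
      fix xs assume xs: "xs \<in> lists (homogs A)" "length xs = k"
      have "h (xs, u) = unshuffle_sum (?W (degs xs)) (T (?W (degs xs)) u) xs"
        unfolding shift_def by (rule val[OF xs(1) u]) (simp add: xs(2))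
      also have "\<dots> = unshuffle_sum (?W (degs xs)) ?F xs"
        by (rule unshuffle_sum_cong) (simp add: splits_degs)
      finally show "unshuffle_sum (?W (degs xs)) ?F xs = h (xs, u)" ..
    qed
  qed
  then show ?thesis
    by (simp add: extensional_restrict[OF ext])
qed

text \<open>
  The companion of the previous lemma for the dependence on an intertwiner: linearity of the
  summands suffices.
\<close>

lemma unshuffle_sum_linear:
  fixes T :: "'x \<Rightarrow> ('k, 'v) module \<Rightarrow> 'u homogeneous \<Rightarrow> 'g homogeneous list \<Rightarrow> 'g homogeneous list \<Rightarrow>
      'v"
  assumes V: "graded_vector_space K V" and M: "module K M"
    and closed: "\<And>x. x \<in> carrier M \<Longrightarrow> \<Phi> x \<in> intertwiners K A U V n"
    and val: "\<And>x xs u d. x \<in> carrier M \<Longrightarrow> xs \<in> lists (homogs A) \<Longrightarrow> u \<in> homogs U \<Longrightarrow>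
      d = degs xs + fst u + n - int (length xs) \<Longrightarrow> \<Phi> x (xs, u) = unshuffle_sum (V d) (T x (V d) u)
          xs"
    and lin: "\<And>xs u ys zs d. xs \<in> lists (homogs A) \<Longrightarrow> u \<in> homogs U \<Longrightarrow> mset ys + mset zs = mset xs \<Longrightarrow>
      d = degs xs + fst u + n - int (length xs) \<Longrightarrow>
      (\<lambda>x. T x (V d) u ys zs) \<in> linear_maps K M (V d)"
  shows "\<Phi> \<in> linear_maps K M (itw_space K A U V n)"
proof (rule linear_maps_itw_space[OF V closed _ M])
  fix xs u assume xs: "xs \<in> lists (homogs A)" and u: "u \<in> homogs U"
  let ?N = "V (degs xs + fst u + n - int (length xs))"
  have "(\<lambda>x. unshuffle_sum ?N (T x ?N u) xs) \<in> linear_maps K M ?N"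
    by (rule linear_maps_unshuffle_sum[OF graded_module[OF V] lin[OF xs u _ refl]])
  then show "(\<lambda>x. \<Phi> x (xs, u)) \<in> linear_maps K M ?N"
    by (rule linear_maps_cong[OF M]) (simp add: val[OF _ xs u refl])
qed

section \<open>Juxtaposition\<close>

text \<open>
  The summand of a juxtaposition, with the two signs of the definition multiplied.  The module \<open>M\<close>
  is the component that contains the value.
\<close>

definition juxt_term ::
    "('k, 'w) module \<Rightarrow> int \<Rightarrow> int \<Rightarrow> ('g, 'v, 'w) itw \<Rightarrow> ('g, 'u, 'v) itw \<Rightarrow> 'u homogeneous \<Rightarrow>
     'g homogeneous list \<Rightarrow> 'g homogeneous list \<Rightarrow> 'w" where
  "juxt_term M p q g f u ys zs =
     [(neg1 ((p - int (length ys)) * int (length zs) + (q - int (length zs)) * degs ys))] \<cdot>\<^bsub>M\<^esub>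
       g (ys, (q - int (length zs) + degs zs + fst u, f (zs, u)))"

text \<open>
  The values of \<open>g\<close> are all that matters here: the lemma is also used for the map associated with an
  intertwiner on \<open>\<gg> \<otimes> U\<close>, before anything is known about it except some of its values.
\<close>

lemma juxt_apply_closed:
  assumes W: "graded_vector_space K W"
    and xs: "xs \<in> lists (homogs A)" and u: "u \<in> homogs U"
    and d: "d = degs xs + fst u + p + q - int (length xs)"
    and closed: "\<And>ys zs. mset ys + mset zs = mset xs \<Longrightarrow>
      g (ys, (q - int (length zs) + degs zs + fst u, f (zs, u))) \<in> carrier (W d)"
  shows "juxt A U W p q g f (xs, u) = unshuffle_sum (W d) (juxt_term (W d) p q g f u) xs"
proof -
  let ?M = "W d"
  let ?n = "length xs"
  interpret abelian_group ?M by (rule graded_abelian_group[OF W])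
  have tr: "itw_target W (p + q) xs (fst u) = ?M"
    by (simp add: itw_target_eq d algebra_simps)
  let ?h = "\<lambda>a ws. [(neg1 ((q - int (?n - a)) * degs (take a ws)))] \<cdot>\<^bsub>?M\<^esub>
      g (take a ws, (q - int (?n - a) + degs (drop a ws) + fst u, f (drop a ws, u)))"
  have "juxt A U W p q g f (xs, u) = (\<Oplus>\<^bsub>?M\<^esub>a\<in>{..?n}. [(neg1 ((p - int a) * int (?n - a)))] \<cdot>\<^bsub>?M\<^esub>
      shuffle_sum ?M a (?n - a) (?h a) xs)"
    using xs u by (simp add: juxt_def itw_dom_iff Let_def tr)
  also have "\<dots> = unshuffle_sum ?M (\<lambda>ys zs. if length ys \<in> {..?n} then
      [(neg1 ((p - int (length ys)) * int (?n - length ys)))] \<cdot>\<^bsub>?M\<^esub> ?h (length ys) (ys @ zs) else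
          \<zero>\<^bsub>?M\<^esub>) xs"
  proof (rule finsum_shuffle_sum)
    show "abelian_group ?M" by (rule abelian_group_axioms)
    fix a zs assume a: "a \<in> {..?n}" and z: "mset zs = mset xs"
    have "length zs = ?n" using z by (rule mset_eq_length)
    then have "int (?n - a) = int (length (drop a zs))" using a by simp
    moreover have "mset (take a zs) + mset (drop a zs) = mset xs"
      unfolding mset_append[symmetric] append_take_drop_id by (rule z)
    ultimately show "?h a zs \<in> carrier ?M"
      using closed[of "take a zs" "drop a zs"] by (simp only: add.int_pow_closed)
  qed simp
  also have "\<dots> = unshuffle_sum ?M (juxt_term ?M p q g f u) xs"
  proof (rule unshuffle_sum_cong)
    fix ys zs assume m: "mset ys + mset zs = mset xs"
    have n: "?n = length ys + length zs" by (rule splits_length[OF m])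
    show "(if length ys \<in> {..?n} then
      [(neg1 ((p - int (length ys)) * int (?n - length ys)))] \<cdot>\<^bsub>?M\<^esub> ?h (length ys) (ys @ zs) else
          \<zero>\<^bsub>?M\<^esub>) =
      juxt_term ?M p q g f u ys zs"
      by (simp add: n juxt_term_def neg1_act_act closed[OF m])
  qed
  finally show ?thesis .
qed

lemma juxt_arg_homog:
  assumes f: "f \<in> intertwiners K A U V q" and "zs \<in> lists (homogs A)" "u \<in> homogs U"
  shows "(q - int (length zs) + degs zs + fst u, f (zs, u)) \<in> homogs V"
  using intertwiner_closed[OF assms refl] by (simp add: homogs_iff algebra_simps)

lemma juxt_value_closed:
  assumes g: "g \<in> intertwiners K A V W p" and f: "f \<in> intertwiners K A U V q"
    and "ys \<in> lists (homogs A)" "zs \<in> lists (homogs A)" "u \<in> homogs U"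
    and "d = degs ys + degs zs + fst u + p + q - int (length ys) - int (length zs)"
  shows "g (ys, (q - int (length zs) + degs zs + fst u, f (zs, u))) \<in> carrier (W d)"
  by (rule intertwiner_closed[OF g _ juxt_arg_homog[OF f]]) (use assms in simp_all)

lemma juxt_apply:
  assumes W: "graded_vector_space K W"
    and g: "g \<in> intertwiners K A V W p" and f: "f \<in> intertwiners K A U V q"
    and xs: "xs \<in> lists (homogs A)" and u: "u \<in> homogs U"
    and d: "d = degs xs + fst u + p + q - int (length xs)"
  shows "juxt A U W p q g f (xs, u) = unshuffle_sum (W d) (juxt_term (W d) p q g f u) xs"
proof (rule juxt_apply_closed[OF W xs u d])
  fix ys zs assume m: "mset ys + mset zs = mset xs"
  show "g (ys, (q - int (length zs) + degs zs + fst u, f (zs, u))) \<in> carrier (W d)"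
    by (rule juxt_value_closed[OF g f _ _ u])
      (use splits_lists[OF m xs] splits_length[OF m] splits_degs[OF m] d in auto)
qed

lemma juxt_extensional: "juxt A U W p q g f \<in> extensional (itw_dom A U)"
  by (simp add: juxt_def)

lemma juxt_intertwiner:
  assumes A: "graded_vector_space K A" and U: "graded_vector_space K U"
    and V: "graded_vector_space K V" and W: "graded_vector_space K W"
    and g: "g \<in> intertwiners K A V W p" and f: "f \<in> intertwiners K A U V q"
  shows "juxt A U W p q g f \<in> intertwiners K A U W (p + q)"
proof (rule unshuffle_sum_intertwiner[OF A U W juxt_extensional])
  fix xs u d assume "xs \<in> lists (homogs A)" "u \<in> homogs U" "d = degs xs + fst u + (p + q) - int
      (length xs)"
  then show "juxt A U W p q g f (xs, u) = unshuffle_sum (W d) (juxt_term (W d) p q g f u) xs"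
    by (intro juxt_apply[OF W g f]) simp_all
next
  fix xs ys zs m d
  assume xs: "xs \<in> lists (homogs A)" and ms: "mset ys + mset zs = mset xs"
    and d: "d = degs xs + m + (p + q) - int (length xs)"
  note s = splits_lists[OF ms xs] splits_length[OF ms] splits_degs[OF ms]
  let ?n = "q - int (length zs) + degs zs + m"
  have 1: "(\<lambda>y. f (zs, (m, y))) \<in> linear_maps K (U m) (V ?n)"
    by (rule intertwiner_linear[OF f]) (use s in auto)
  have 2: "(\<lambda>y. g (ys, (?n, y))) \<in> linear_maps K (V ?n) (W d)"
    by (rule intertwiner_linear[OF g]) (use s d in auto)
  show "(\<lambda>y. juxt_term (W d) p q g f (m, y) ys zs) \<in> linear_maps K (U m) (W d)"
    unfolding juxt_term_def fst_conv
    by (rule linear_maps_int_mult[OF graded_module[OF W] linear_maps_comp[OF 1 2]])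
next
  fix u k zs s
  assume u: "u \<in> homogs U" and zs: "zs \<in> lists (homogs A)"
    and s: "s = p + q - int (k + length zs) + fst u + degs zs"
  have "skew_multilinear K A k (shift W s) (\<lambda>ys. g (ys, (q - int (length zs) + degs zs + fst u, f
      (zs, u))))"
    by (rule intertwiner_skew[OF g juxt_arg_homog[OF f zs u]]) (simp add: s)
  from skew_multilinear_int_mult[OF graded_shift[OF W] this,
      of "\<lambda>n d. neg1 ((p - int n) * int (length zs) + (q - int (length zs)) * d)"]
  show "skew_multilinear K A k (shift W s) (\<lambda>ys. juxt_term (shift W s (degs ys)) p q g f u ys zs)"
    unfolding juxt_term_def .
next
  fix u k ys s
  assume u: "u \<in> homogs U" and ys: "ys \<in> lists (homogs A)"
    and s: "s = p + q - int (k + length ys) + fst u + degs ys"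
  let ?t = "q - int k + fst u"
  have "skew_multilinear K A k (shift W s) (\<lambda>zs. g (ys, (degs zs + ?t, f (zs, u))))"
  proof (rule skew_multilinear_comp[OF intertwiner_skew[OF f u refl] _ graded_shift[OF V]
      graded_shift[OF W]])
    show "(\<lambda>y. g (ys, (d + ?t, y))) \<in> linear_maps K (shift V ?t d) (shift W s d)" for d
      unfolding shift_def by (rule intertwiner_linear[OF g ys]) (simp add: s)
  qed
  from skew_multilinear_int_mult[OF graded_shift[OF W] this,
      of "\<lambda>n d. neg1 ((p - int (length ys)) * int n + (q - int n) * degs ys)"]
  show "skew_multilinear K A k (shift W s) (\<lambda>zs. juxt_term (shift W s (degs zs)) p q g f u ys zs)"
    by (rule skew_multilinear_cong[OF A]) (simp add: juxt_term_def ac_simps)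
qed

lemma juxt_linear_left:
  assumes A: "graded_vector_space K A" and U: "graded_vector_space K U"
    and V: "graded_vector_space K V" and W: "graded_vector_space K W"
    and f: "f \<in> intertwiners K A U V q"
  shows "(\<lambda>g. juxt A U W p q g f) \<in> linear_maps K (itw_space K A V W p) (itw_space K A U W (p + q))"
proof (rule unshuffle_sum_linear[OF W itw_space_module[OF A V W]], unfold itw_space_simps(1))
  fix g assume g: "g \<in> intertwiners K A V W p"
  show "juxt A U W p q g f \<in> intertwiners K A U W (p + q)"
    by (rule juxt_intertwiner[OF A U V W g f])
  fix xs u d assume "xs \<in> lists (homogs A)" "u \<in> homogs U" "d = degs xs + fst u + (p + q) - int
      (length xs)"
  then show "juxt A U W p q g f (xs, u) = unshuffle_sum (W d) (juxt_term (W d) p q g f u) xs"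
    by (intro juxt_apply[OF W g f]) simp_all
next
  fix xs u ys zs d
  assume xs: "xs \<in> lists (homogs A)" and u: "u \<in> homogs U" and ms: "mset ys + mset zs = mset xs"
    and d: "d = degs xs + fst u + (p + q) - int (length xs)"
  note s = splits_lists[OF ms xs] splits_length[OF ms] splits_degs[OF ms]
  show "(\<lambda>g. juxt_term (W d) p q g f u ys zs) \<in> linear_maps K (itw_space K A V W p) (W d)"
    unfolding juxt_term_def
    by (rule linear_maps_int_mult[OF graded_module[OF W]],
        rule intertwiner_eval_linear[OF A W _ juxt_arg_homog[OF f _ u]]) (use s d in auto)
qed

lemma juxt_linear_right:
  assumes A: "graded_vector_space K A" and U: "graded_vector_space K U"
    and V: "graded_vector_space K V" and W: "graded_vector_space K W"
    and g: "g \<in> intertwiners K A V W p"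
  shows "(\<lambda>f. juxt A U W p q g f) \<in> linear_maps K (itw_space K A U V q) (itw_space K A U W (p + q))"
proof (rule unshuffle_sum_linear[OF W itw_space_module[OF A U V]], unfold itw_space_simps(1))
  fix f assume f: "f \<in> intertwiners K A U V q"
  show "juxt A U W p q g f \<in> intertwiners K A U W (p + q)"
    by (rule juxt_intertwiner[OF A U V W g f])
  fix xs u d assume "xs \<in> lists (homogs A)" "u \<in> homogs U" "d = degs xs + fst u + (p + q) - int
      (length xs)"
  then show "juxt A U W p q g f (xs, u) = unshuffle_sum (W d) (juxt_term (W d) p q g f u) xs"
    by (intro juxt_apply[OF W g f]) simp_all
next
  fix xs u ys zs d
  assume xs: "xs \<in> lists (homogs A)" and u: "u \<in> homogs U" and ms: "mset ys + mset zs = mset xs"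
    and d: "d = degs xs + fst u + (p + q) - int (length xs)"
  note s = splits_lists[OF ms xs] splits_length[OF ms] splits_degs[OF ms]
  let ?n = "q - int (length zs) + degs zs + fst u"
  have 1: "(\<lambda>f. f (zs, u)) \<in> linear_maps K (itw_space K A U V q) (V ?n)"
    by (rule intertwiner_eval_linear[OF A V _ u]) (use s in auto)
  have 2: "(\<lambda>y. g (ys, (?n, y))) \<in> linear_maps K (V ?n) (W d)"
    by (rule intertwiner_linear[OF g]) (use s d in auto)
  show "(\<lambda>f. juxt_term (W d) p q g f u ys zs) \<in> linear_maps K (itw_space K A U V q) (W d)"
    unfolding juxt_term_def
    by (rule linear_maps_int_mult[OF graded_module[OF W] linear_maps_comp[OF 1 2]])
qed

text \<open>
  Expanded, both sides are sums over distributions of the entries over three lists, and the exponents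
  of the signs are equal as integers.
\<close>

lemma juxt_assoc:
  assumes A: "graded_vector_space K A" and U: "graded_vector_space K U"
    and V: "graded_vector_space K V" and W: "graded_vector_space K W"
        and T: "graded_vector_space K T"
    and h: "h \<in> intertwiners K A W T r" and g: "g \<in> intertwiners K A V W p"
    and f: "f \<in> intertwiners K A U V q"
  shows "juxt A U T (r + p) q (juxt A V T r p h g) f = juxt A U T r (p + q) h (juxt A U W p q g f)"
proof (rule intertwiner_eqI[OF juxt_extensional juxt_extensional])
  fix xs u assume xs: "xs \<in> lists (homogs A)" and u: "u \<in> homogs U"
  let ?d = "degs xs + fst u + (r + p + q) - int (length xs)"
  let ?M = "T ?d"
  interpret abelian_group ?M by (rule graded_abelian_group[OF T])
  note hg = juxt_intertwiner[OF A V W T h g] and gf = juxt_intertwiner[OF A U V W g f]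
  (* The summand for the distribution of xs over as, bs, cs is, up to sign, the value of h at
     as and ?gv bs cs. *)
  let ?fv = "\<lambda>cs. (q - int (length cs) + degs cs + fst u, f (cs, u))"
  let ?gv = "\<lambda>bs cs. (p - int (length bs) + degs bs + fst (?fv cs), g (bs, ?fv cs))"
  let ?e = "\<lambda>as bs cs. (r - int (length as)) * int (length bs + length cs) +
     (p + q - int (length bs + length cs)) * degs as + (p - int (length bs)) * int (length cs) +
     (q - int (length cs)) * degs bs"
  let ?F = "\<lambda>as bs cs. [(neg1 (?e as bs cs))] \<cdot>\<^bsub>?M\<^esub> h (as, ?gv bs cs)"
  have cl: "h (as, ?gv bs cs) \<in> carrier ?M" if m: "mset as + mset bs + mset cs = mset xs"
      for as bs cs
  proof -
    have 1: "mset as + mset (bs @ cs) = mset xs" and 2: "mset (as @ bs) + mset cs = mset xs"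
      using m by (simp_all add: ac_simps)
    have l: "as \<in> lists (homogs A)" "bs \<in> lists (homogs A)" "cs \<in> lists (homogs A)"
      using splits_lists[OF 1 xs] splits_lists[OF 2 xs] by simp_all
    have "length xs = length as + length bs + length cs" "degs xs = degs as + degs bs + degs cs"
      using splits_length[OF 2] splits_degs[OF 2] by simp_all
    then show ?thesis
      by (intro intertwiner_closed[OF h] l juxt_arg_homog[OF g] juxt_arg_homog[OF f] u) simp
  qed
  have "juxt A U T (r + p) q (juxt A V T r p h g) f (xs, u) =
     unshuffle_sum ?M (juxt_term ?M (r + p) q (juxt A V T r p h g) f u) xs"
    by (rule juxt_apply[OF T hg f xs u]) simp
  also have "\<dots> = unshuffle_sum ?M (\<lambda>ws cs. unshuffle_sum ?M (\<lambda>as bs. ?F as bs cs) ws) xs"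
  proof (rule unshuffle_sum_cong)
    fix ws cs assume m: "mset ws + mset cs = mset xs"
    note s = splits_lists[OF m xs] splits_length[OF m] splits_degs[OF m]
    let ?k = "neg1 ((r + p - int (length ws)) * int (length cs) + (q - int (length cs)) * degs ws)"
    have "juxt A V T r p h g (ws, ?fv cs) = unshuffle_sum ?M (juxt_term ?M r p h g (?fv cs)) ws"
      by (rule juxt_apply[OF T h g _ juxt_arg_homog[OF f _ u]]) (use s in auto)
    then have "juxt_term ?M (r + p) q (juxt A V T r p h g) f u ws cs =
      [?k] \<cdot>\<^bsub>?M\<^esub> unshuffle_sum ?M (juxt_term ?M r p h g (?fv cs)) ws"
      unfolding juxt_term_def[where g = "juxt A V T r p h g"] by simp
    also have "\<dots> = unshuffle_sum ?M (\<lambda>as bs. [?k] \<cdot>\<^bsub>?M\<^esub> juxt_term ?M r p h g (?fv cs) as bs) ws"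
      by (rule unshuffle_sum_int_mult[symmetric])
        (use m in \<open>auto simp: juxt_term_def intro!: add.int_pow_closed cl[simplified]\<close>)
    also have "\<dots> = unshuffle_sum ?M (\<lambda>as bs. ?F as bs cs) ws"
    proof (rule unshuffle_sum_cong)
      fix as bs assume m': "mset as + mset bs = mset ws"
      have "mset as + mset bs + mset cs = mset xs" using m m' by simp
      note c = cl[OF this]
      show "[?k] \<cdot>\<^bsub>?M\<^esub> juxt_term ?M r p h g (?fv cs) as bs = ?F as bs cs"
        unfolding juxt_term_def neg1_act_act[OF c]
        by (rule arg_cong[where f="\<lambda>k. [(neg1 k)] \<cdot>\<^bsub>?M\<^esub> _"])
          (simp add: splits_length[OF m'] splits_degs[OF m'] algebra_simps)
    qed
    finally show "juxt_term ?M (r + p) q (juxt A V T r p h g) f u ws cs = \<dots>" .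
  qed
  also have "\<dots> = unshuffle_sum ?M (\<lambda>as zs. unshuffle_sum ?M (\<lambda>bs cs. ?F as bs cs) zs) xs"
    by (rule unshuffle_sum_coassoc) (intro add.int_pow_closed cl)
  also have "\<dots> = unshuffle_sum ?M (juxt_term ?M r (p + q) h (juxt A U W p q g f) u) xs"
  proof (rule unshuffle_sum_cong)
    fix as zs assume m: "mset as + mset zs = mset xs"
    note s = splits_lists[OF m xs] splits_length[OF m] splits_degs[OF m]
    let ?k = "neg1 ((r - int (length as)) * int (length zs) + (p + q - int (length zs)) * degs as)"
    let ?n = "p + q - int (length zs) + degs zs + fst u"
    have lin: "(\<lambda>y. h (as, (?n, y))) \<in> linear_maps K (W ?n) ?M"
      by (rule intertwiner_linear[OF h]) (use s in auto)
    have cl': "juxt_term (W ?n) p q g f u bs cs \<in> carrier (W ?n)" if "mset bs + mset cs = mset zs"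
        for bs cs
    proof -
      note s' = splits_lists[OF that, of "homogs A"] splits_length[OF that] splits_degs[OF that]
      interpret W: abelian_group "W ?n" by (rule graded_abelian_group[OF W])
      show ?thesis unfolding juxt_term_def
        by (rule W.add.int_pow_closed, rule juxt_value_closed[OF g f _ _ u]) (use s s' in auto)
    qed
    have "juxt A U W p q g f (zs, u) = unshuffle_sum (W ?n) (juxt_term (W ?n) p q g f u) zs"
      by (rule juxt_apply[OF W g f _ u]) (use s in auto)
    moreover have "h (as, (?n, unshuffle_sum (W ?n) (juxt_term (W ?n) p q g f u) zs)) =
        unshuffle_sum ?M (\<lambda>bs cs. h (as, (?n, juxt_term (W ?n) p q g f u bs cs))) zs"
      by (rule unshuffle_sum_hom[where h = "\<lambda>y. h (as, (?n, y))",
            OF graded_abelian_group[OF W] abelian_group_axioms _ linear_mapsD(2)[OF lin] cl'])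
        (auto intro: linear_mapsD(1)[OF lin])
    ultimately have "h (as, (?n, juxt A U W p q g f (zs, u))) =
        unshuffle_sum ?M (\<lambda>bs cs. h (as, (?n, juxt_term (W ?n) p q g f u bs cs))) zs"
      by simp
    then have "juxt_term ?M r (p + q) h (juxt A U W p q g f) u as zs = [?k] \<cdot>\<^bsub>?M\<^esub>
        unshuffle_sum ?M (\<lambda>bs cs. h (as, (?n, juxt_term (W ?n) p q g f u bs cs))) zs"
      unfolding juxt_term_def[where f = "juxt A U W p q g f"] by simp
    also have "\<dots> = unshuffle_sum ?M (\<lambda>bs cs. [?k] \<cdot>\<^bsub>?M\<^esub> h (as, (?n, juxt_term (W ?n) p q g f u bs
        cs))) zs"
      by (rule unshuffle_sum_int_mult[symmetric]) (rule linear_mapsD(1)[OF lin cl'])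
    also have "\<dots> = unshuffle_sum ?M (\<lambda>bs cs. ?F as bs cs) zs"
    proof (rule unshuffle_sum_cong)
      fix bs cs assume m': "mset bs + mset cs = mset zs"
      note s' = splits_lists[OF m', of "homogs A"] splits_length[OF m'] splits_degs[OF m']
      have c: "h (as, ?gv bs cs) \<in> carrier ?M" by (rule cl) (use m m' in \<open>simp add: ac_simps\<close>)
      have n: "p - int (length bs) + degs bs + (q - int (length cs) + degs cs + fst u) = ?n"
        using s' by simp
      have "h (as, (?n, juxt_term (W ?n) p q g f u bs cs)) =
         [(neg1 ((p - int (length bs)) * int (length cs) + (q - int (length cs)) * degs bs))]
             \<cdot>\<^bsub>?M\<^esub> h (as, (?n, g (bs, ?fv cs)))"
        unfolding juxt_term_def
        by (rule linear_maps_int_mult_commute[OF lin graded_module[OF W] graded_module[OF T]],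
            rule juxt_value_closed[OF g f _ _ u]) (use s s' in auto)
      also have "h (as, (?n, g (bs, ?fv cs))) = h (as, ?gv bs cs)"
        by (simp only: n fst_conv)
      finally show "[?k] \<cdot>\<^bsub>?M\<^esub> h (as, (?n, juxt_term (W ?n) p q g f u bs cs)) = ?F as bs cs"
        by (simp only: neg1_act_act[OF c])
          (rule arg_cong[where f="\<lambda>k. [(neg1 k)] \<cdot>\<^bsub>?M\<^esub> _"], simp add: s' algebra_simps)
    qed
    finally show "unshuffle_sum ?M (\<lambda>bs cs. ?F as bs cs) zs = juxt_term ?M r (p + q) h (juxt A U W
        p q g f) u as zs" ..
  qed
  also have "\<dots> = juxt A U T r (p + q) h (juxt A U W p q g f) (xs, u)"
    by (rule juxt_apply[OF T h gf xs u, symmetric]) simp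
  finally show "juxt A U T (r + p) q (juxt A V T r p h g) f (xs, u) =
     juxt A U T r (p + q) h (juxt A U W p q g f) (xs, u)" .
qed

text \<open>
  The counit law of the coalgebra.
\<close>

lemma (in abelian_group) unshuffle_sum_left_Nil:
  assumes "\<And>zs. mset zs = mset xs \<Longrightarrow> F zs \<in> carrier G"
  shows "unshuffle_sum G (\<lambda>ys zs. if ys = [] then F zs else \<zero>) xs = F xs"
  using assms
proof (induction xs arbitrary: F)
  case (Cons x xs)
  have c: "F (x # zs) \<in> carrier G" if "mset zs = mset xs" for zs
    by (rule Cons.prems) (simp add: that)
  have "unshuffle_sum G (\<lambda>ys zs. [(neg1 (int (length ys) + fst x * degs ys))] \<cdot>
      (if ys = [] then F (x # zs) else \<zero>)) xs = unshuffle_sum G (\<lambda>ys zs.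
          if ys = [] then F (x # zs) else \<zero>) xs"
    by (rule unshuffle_sum_cong) (auto simp: c)
  also have "\<dots> = F (x # xs)"
    by (rule Cons.IH) (rule c)
  finally show ?case
    by (simp add: unshuffle_sum_zero c)
qed simp

lemma (in abelian_group) unshuffle_sum_right_Nil:
  assumes "\<And>ys. mset ys = mset xs \<Longrightarrow> F ys \<in> carrier G"
  shows "unshuffle_sum G (\<lambda>ys zs. if zs = [] then F ys else \<zero>) xs = F xs"
proof -
  have "unshuffle_sum G (\<lambda>ys zs. if zs = [] then F ys else \<zero>) xs =
    unshuffle_sum G (\<lambda>ys zs. [(neg1 (int (length ys * length zs) + degs ys * degs zs))] \<cdot>
      (if ys = [] then F zs else \<zero>)) xs"
    by (rule unshuffle_sum_cocomm) (auto intro: assms)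
  also have "\<dots> = unshuffle_sum G (\<lambda>ys zs. if ys = [] then F zs else \<zero>) xs"
    by (rule unshuffle_sum_cong) (auto simp: assms)
  also have "\<dots> = F xs" by (rule unshuffle_sum_left_Nil) (rule assms)
  finally show ?thesis .
qed

lemma itw_id_intertwiner:
  assumes A: "graded_vector_space K A" and U: "graded_vector_space K U"
  shows "itw_id A U \<in> intertwiners K A U U 0"
  unfolding itw_id_def
proof (rule restrict_intertwiner[OF A U], unfold prod.case fst_conv snd_conv)
  fix xs u assume xs: "xs \<in> lists (homogs A)" and u: "u \<in> homogs U"
  let ?d = "degs xs + fst u + 0 - int (length xs)"
  interpret abelian_group "U ?d" by (rule graded_abelian_group[OF U])
  show "(if xs = [] then snd u else \<zero>\<^bsub>itw_target U 0 xs (fst u)\<^esub>) \<in> carrier (U ?d)"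
    using u zero_closed by (cases "xs = []") (simp_all add: homogs_iff itw_target_eqI[OF refl]
        del: zero_closed)
next
  fix u k assume u: "u \<in> homogs U"
  let ?W = "shift U (0 - int k + fst u)"
  show "skew_multilinear K A k ?W (\<lambda>xs. if xs = [] then snd u else \<zero>\<^bsub>itw_target U 0 xs (fst u)\<^esub>)"
  proof (cases "k = 0")
    case True
    then show ?thesis by (simp add: skew_multilinear_def)
  next
    case False
    show ?thesis
      by (rule skew_multilinear_cong[OF A skew_multilinear_zero[OF graded_shift[OF U]]])
        (use False in \<open>auto simp: itw_target_eq shift_def algebra_simps\<close>)
  qed
next
  fix xs m assume xs: "xs \<in> lists (homogs A)"
  show "(\<lambda>y. if xs = [] then y else \<zero>\<^bsub>itw_target U 0 xs m\<^esub>) \<in> linear_maps K (U m) (U (degs xs + m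
      + 0 - int (length xs)))"
  proof (cases "xs = []")
    case True
    then show ?thesis by (auto intro!: linear_mapsI)
  next
    case False
    then show ?thesis
      using linear_maps_zero[OF graded_module[OF U]] by (simp add: itw_target_eqI[OF refl])
  qed
qed

lemma juxt_id_left:
  assumes A: "graded_vector_space K A" and U: "graded_vector_space K U"
      and V: "graded_vector_space K V"
    and f: "f \<in> intertwiners K A U V q"
  shows "juxt A U V 0 q (itw_id A V) f = f"
proof (rule intertwiner_eqI[OF juxt_extensional intertwiner_extensional[OF f]])
  fix xs u assume xs: "xs \<in> lists (homogs A)" and u: "u \<in> homogs U"
  let ?d = "degs xs + fst u + q - int (length xs)"
  let ?M = "V ?d"
  interpret abelian_group ?M by (rule graded_abelian_group[OF V])
  have c: "f (zs, u) \<in> carrier ?M" if "mset zs = mset xs" for zs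
    by (rule intertwiner_closed[OF f _ u])
      (use that splits_lists[of "[]" zs xs, OF _ xs] splits_length[of "[]" zs xs] splits_degs[of
          "[]" zs xs] in auto)
  have "juxt A U V 0 q (itw_id A V) f (xs, u) = unshuffle_sum ?M (juxt_term ?M 0 q (itw_id A V) f
      u) xs"
    by (rule juxt_apply[OF V itw_id_intertwiner[OF A V] f xs u]) simp
  also have "\<dots> = unshuffle_sum ?M (\<lambda>ys zs. if ys = [] then f (zs, u) else \<zero>\<^bsub>?M\<^esub>) xs"
  proof (rule unshuffle_sum_cong)
    fix ys zs assume m: "mset ys + mset zs = mset xs"
    note s = splits_lists[OF m xs] splits_length[OF m] splits_degs[OF m]
    let ?v = "(q - int (length zs) + degs zs + fst u, f (zs, u))"
    have "?v \<in> homogs V" by (rule juxt_arg_homog[OF f _ u]) (use s in simp)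
    then have "itw_id A V (ys, ?v) = (if ys = [] then f (zs, u) else \<zero>\<^bsub>itw_target V 0 ys (fst ?v)\<^esub>)"
      using s by (simp add: itw_id_def itw_dom_iff)
    also have "itw_target V 0 ys (fst ?v) = ?M" by (rule itw_target_eqI) (use s in simp)
    finally show "juxt_term ?M 0 q (itw_id A V) f u ys zs = (if ys = [] then f (zs, u) else \<zero>\<^bsub>?M\<^esub>)"
      using c[of zs] m by (cases "ys = []") (simp_all add: juxt_term_def)
  qed
  also have "\<dots> = f (xs, u)" by (rule unshuffle_sum_left_Nil) (rule c)
  finally show "juxt A U V 0 q (itw_id A V) f (xs, u) = f (xs, u)" .
qed

lemma juxt_id_right:
  assumes A: "graded_vector_space K A" and U: "graded_vector_space K U"
      and V: "graded_vector_space K V"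
    and f: "f \<in> intertwiners K A U V q"
  shows "juxt A U V q 0 f (itw_id A U) = f"
proof (rule intertwiner_eqI[OF juxt_extensional intertwiner_extensional[OF f]])
  fix xs u assume xs: "xs \<in> lists (homogs A)" and u: "u \<in> homogs U"
  let ?d = "degs xs + fst u + q - int (length xs)"
  let ?M = "V ?d"
  interpret abelian_group ?M by (rule graded_abelian_group[OF V])
  have c: "f (zs, u) \<in> carrier ?M" if "mset zs = mset xs" for zs
    by (rule intertwiner_closed[OF f _ u])
      (use that splits_lists[of "[]" zs xs, OF _ xs] splits_length[of "[]" zs xs] splits_degs[of
          "[]" zs xs] in auto)
  have "juxt A U V q 0 f (itw_id A U) (xs, u) = unshuffle_sum ?M (juxt_term ?M q 0 f (itw_id A U)
      u) xs"
    by (rule juxt_apply[OF V f itw_id_intertwiner[OF A U] xs u]) simp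
  also have "\<dots> = unshuffle_sum ?M (\<lambda>ys zs. if zs = [] then f (ys, u) else \<zero>\<^bsub>?M\<^esub>) xs"
  proof (rule unshuffle_sum_cong)
    fix ys zs assume m: "mset ys + mset zs = mset xs"
    note s = splits_lists[OF m xs] splits_length[OF m] splits_degs[OF m]
    show "juxt_term ?M q 0 f (itw_id A U) u ys zs = (if zs = [] then f (ys, u) else \<zero>\<^bsub>?M\<^esub>)"
    proof (cases "zs = []")
      case True
      then show ?thesis
        using c[of ys] m u by (simp add: juxt_term_def itw_id_def itw_dom_iff)
    next
      case False
      let ?n = "0 - int (length zs) + degs zs + fst u"
      have "itw_target U 0 zs (fst u) = U ?n" by (rule itw_target_eqI) simp
      then have "itw_id A U (zs, u) = \<zero>\<^bsub>U ?n\<^esub>"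
        using False s u by (simp add: itw_id_def itw_dom_iff)
      moreover have "(\<lambda>y. f (ys, (?n, y))) \<in> linear_maps K (U ?n) ?M"
        by (rule intertwiner_linear[OF f]) (use s in auto)
      from linear_maps_zero_value[OF this graded_module[OF U] graded_module[OF V]]
      have "f (ys, (?n, \<zero>\<^bsub>U ?n\<^esub>)) = \<zero>\<^bsub>?M\<^esub>" .
      ultimately show ?thesis
        using False by (simp add: juxt_term_def)
    qed
  qed
  also have "\<dots> = f (xs, u)" by (rule unshuffle_sum_right_Nil) (rule c)
  finally show "juxt A U V q 0 f (itw_id A U) (xs, u) = f (xs, u)" .
qed

section \<open>Linear maps on tensor products\<close>

lemma free_module_simps:
  "\<phi> \<in> carrier (free_module K B) \<longleftrightarrow> (\<forall>b. \<phi> b \<in> carrier K) \<and> finite {b. \<phi> b \<noteq> \<zero>\<^bsub>K\<^esub>} \<and> {b. \<phi> b \<noteq>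
      \<zero>\<^bsub>K\<^esub>} \<subseteq> B"
  "\<zero>\<^bsub>free_module K B\<^esub> = (\<lambda>_. \<zero>\<^bsub>K\<^esub>)"
  "\<phi> \<oplus>\<^bsub>free_module K B\<^esub> \<psi> = (\<lambda>b. \<phi> b \<oplus>\<^bsub>K\<^esub> \<psi> b)"
  "c \<odot>\<^bsub>free_module K B\<^esub> \<phi> = (\<lambda>b. c \<otimes>\<^bsub>K\<^esub> \<phi> b)"
  by (auto simp: free_module_def)

lemma free_module_module:
  assumes "field K"
  shows "module K (free_module K B)"
proof -
  interpret K: field K by fact
  have add: "(\<lambda>b. \<phi> b \<oplus>\<^bsub>K\<^esub> \<psi> b) \<in> carrier (free_module K B)"
    if "\<phi> \<in> carrier (free_module K B)" "\<psi> \<in> carrier (free_module K B)" for \<phi> \<psi>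
  proof -
    have "{b. \<phi> b \<oplus>\<^bsub>K\<^esub> \<psi> b \<noteq> \<zero>\<^bsub>K\<^esub>} \<subseteq> {b. \<phi> b \<noteq> \<zero>\<^bsub>K\<^esub>} \<union> {b. \<psi> b \<noteq> \<zero>\<^bsub>K\<^esub>}" by auto
    then show ?thesis using that unfolding free_module_simps by (auto intro: finite_subset)
  qed
  have smult: "(\<lambda>b. c \<otimes>\<^bsub>K\<^esub> \<phi> b) \<in> carrier (free_module K B)"
    if "c \<in> carrier K" "\<phi> \<in> carrier (free_module K B)" for c \<phi>
  proof -
    have "{b. c \<otimes>\<^bsub>K\<^esub> \<phi> b \<noteq> \<zero>\<^bsub>K\<^esub>} \<subseteq> {b. \<phi> b \<noteq> \<zero>\<^bsub>K\<^esub>}" using that by auto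
    then show ?thesis using that unfolding free_module_simps by (auto intro: finite_subset)
  qed
  have val: "\<phi> b \<in> carrier K" if "\<phi> \<in> carrier (free_module K B)" for \<phi> b
    using that by (simp add: free_module_simps(1))
  show ?thesis
  proof (rule moduleI)
    show "cring K" by (rule K.is_cring)
    show "abelian_group (free_module K B)"
    proof (rule abelian_groupI)
      fix \<phi> assume \<phi>: "\<phi> \<in> carrier (free_module K B)"
      show "\<exists>\<psi>\<in>carrier (free_module K B). \<psi> \<oplus>\<^bsub>free_module K B\<^esub> \<phi> = \<zero>\<^bsub>free_module K B\<^esub>"
        by (rule bexI[OF _ smult[OF _ \<phi>, of "\<ominus>\<^bsub>K\<^esub> \<one>\<^bsub>K\<^esub>"]])
          (simp_all add: free_module_simps(2,3) val[OF \<phi>] K.l_minus K.l_neg)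
    qed (auto simp: free_module_simps(2,3) val K.a_ac intro: add, simp add: free_module_simps(1))
  qed (auto simp: free_module_simps(3,4) val K.l_distr K.r_distr K.m_assoc intro: smult)
qed

lemma free_gen_carrier:
  assumes "field K" "b \<in> B"
  shows "free_gen K b \<in> carrier (free_module K B)"
proof -
  interpret K: field K by fact
  have "{b'. free_gen K b b' \<noteq> \<zero>\<^bsub>K\<^esub>} = {b}" by (auto simp: free_gen_def)
  then show ?thesis using assms(2) unfolding free_module_simps(1) by (simp add: free_gen_def)
qed

text \<open>
  The linear map on the free module that extends \<open>h\<close>, written as in \<open>tensor_lift\<close>.
\<close>

definition free_extension :: "('k, 'm) ring_scheme \<Rightarrow> ('k, 'w) module \<Rightarrow> ('b \<Rightarrow> 'w) \<Rightarrow> ('b \<Rightarrow> 'k) \<Rightarrow> 'w"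
    where
  "free_extension K M h \<phi> = (\<Oplus>\<^bsub>M\<^esub>b\<in>{b. \<phi> b \<noteq> \<zero>\<^bsub>K\<^esub>}. \<phi> b \<odot>\<^bsub>M\<^esub> h b)"

lemma free_extension_linear:
  assumes K: "field K" and M: "module K M" and h: "\<And>b. b \<in> B \<Longrightarrow> h b \<in> carrier M"
  shows "free_extension K M h \<in> linear_maps K (free_module K B) M"
    and "b \<in> B \<Longrightarrow> free_extension K M h (free_gen K b) = h b"
proof -
  interpret K: field K by fact
  interpret M: module K M by fact
  let ?F = "free_module K B"
  have ext: "free_extension K M h \<phi> = (\<Oplus>\<^bsub>M\<^esub>b\<in>S. \<phi> b \<odot>\<^bsub>M\<^esub> h b)"
    if "\<phi> \<in> carrier ?F" "finite S" "{b. \<phi> b \<noteq> \<zero>\<^bsub>K\<^esub>} \<subseteq> S" "S \<subseteq> B" for \<phi> S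
    unfolding free_extension_def
    by (rule M.add.finprod_mono_neutral_cong_left) (use that h in \<open>auto simp: free_module_simps(1)\<close>)
  have supp: "finite {b. \<phi> b \<noteq> \<zero>\<^bsub>K\<^esub>}" "{b. \<phi> b \<noteq> \<zero>\<^bsub>K\<^esub>} \<subseteq> B" "\<phi> b \<in> carrier K" if "\<phi> \<in> carrier ?F"
      for \<phi> b
    using that by (auto simp: free_module_simps(1))
  interpret F: module K ?F by (rule free_module_module[OF K])
  show "free_extension K M h \<in> linear_maps K ?F M"
  proof (rule linear_mapsI)
    fix \<phi> assume \<phi>: "\<phi> \<in> carrier ?F"
    show "free_extension K M h \<phi> \<in> carrier M"
      unfolding free_extension_def using supp[OF \<phi>] h by (auto intro!: M.finsum_closed)
    show "free_extension K M h (c \<odot>\<^bsub>?F\<^esub> \<phi>) = c \<odot>\<^bsub>M\<^esub> free_extension K M h \<phi>" if c: "c \<in> carrier K"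
        for c
    proof -
      let ?S = "{b. \<phi> b \<noteq> \<zero>\<^bsub>K\<^esub>}"
      have "free_extension K M h (c \<odot>\<^bsub>?F\<^esub> \<phi>) = (\<Oplus>\<^bsub>M\<^esub>b\<in>?S. (c \<odot>\<^bsub>?F\<^esub> \<phi>) b \<odot>\<^bsub>M\<^esub> h b)"
        by (rule ext[OF F.smult_closed[OF c \<phi>]]) (use supp[OF \<phi>] c in \<open>auto simp:
            free_module_simps(4)\<close>)
      also have "\<dots> = (\<Oplus>\<^bsub>M\<^esub>b\<in>?S. c \<odot>\<^bsub>M\<^esub> (\<phi> b \<odot>\<^bsub>M\<^esub> h b))"
        by (rule M.finsum_cong') (use supp[OF \<phi>] c h in \<open>auto simp: free_module_simps(4)
            M.smult_assoc1\<close>)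
      also have "\<dots> = c \<odot>\<^bsub>M\<^esub> free_extension K M h \<phi>"
        unfolding free_extension_def
        by (rule M.finsum_smult_ldistr[symmetric]) (use supp[OF \<phi>] c h in auto)
      finally show ?thesis .
    qed
    fix \<psi> assume \<psi>: "\<psi> \<in> carrier ?F"
    let ?S = "{b. \<phi> b \<noteq> \<zero>\<^bsub>K\<^esub>} \<union> {b. \<psi> b \<noteq> \<zero>\<^bsub>K\<^esub>}"
    have "free_extension K M h (\<phi> \<oplus>\<^bsub>?F\<^esub> \<psi>) = (\<Oplus>\<^bsub>M\<^esub>b\<in>?S. (\<phi> \<oplus>\<^bsub>?F\<^esub> \<psi>) b \<odot>\<^bsub>M\<^esub> h b)"
      by (rule ext[OF F.a_closed[OF \<phi> \<psi>]]) (use supp[OF \<phi>] supp[OF \<psi>] in \<open>auto simp: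
          free_module_simps(3)\<close>)
    also have "\<dots> = (\<Oplus>\<^bsub>M\<^esub>b\<in>?S. \<phi> b \<odot>\<^bsub>M\<^esub> h b \<oplus>\<^bsub>M\<^esub> \<psi> b \<odot>\<^bsub>M\<^esub> h b)"
      by (rule M.finsum_cong') (use supp[OF \<phi>] supp[OF \<psi>] h in \<open>auto simp: free_module_simps(3)
          M.smult_l_distr\<close>)
    also have "\<dots> = (\<Oplus>\<^bsub>M\<^esub>b\<in>?S. \<phi> b \<odot>\<^bsub>M\<^esub> h b) \<oplus>\<^bsub>M\<^esub> (\<Oplus>\<^bsub>M\<^esub>b\<in>?S. \<psi> b \<odot>\<^bsub>M\<^esub> h b)"
      by (rule M.finsum_addf) (use supp[OF \<phi>] supp[OF \<psi>] h in auto)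
    also have "\<dots> = free_extension K M h \<phi> \<oplus>\<^bsub>M\<^esub> free_extension K M h \<psi>"
      by (subst (1 2) ext[of _ ?S]) (use supp[OF \<phi>] supp[OF \<psi>] \<phi> \<psi> in auto)
    finally show "free_extension K M h (\<phi> \<oplus>\<^bsub>?F\<^esub> \<psi>) = free_extension K M h \<phi> \<oplus>\<^bsub>M\<^esub>
        free_extension K M h \<psi>" .
  qed
  show "free_extension K M h (free_gen K b) = h b" if "b \<in> B"
  proof -
    have "free_extension K M h (free_gen K b) = (\<Oplus>\<^bsub>M\<^esub>b'\<in>{b}. free_gen K b b' \<odot>\<^bsub>M\<^esub> h b')"
      by (rule ext[OF free_gen_carrier[OF K that]]) (use that in \<open>auto simp: free_gen_def\<close>)
    then show ?thesis using h[OF that] by (simp add: free_gen_def)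
  qed
qed

definition bilinear_map ::
    "('k, 'm) ring_scheme \<Rightarrow> ('k, 'u) graded \<Rightarrow> ('k, 'v) graded \<Rightarrow> int \<Rightarrow> ('k, 'w) module \<Rightarrow>
     ('u homogeneous \<Rightarrow> 'v homogeneous \<Rightarrow> 'w) \<Rightarrow> bool" where
  "bilinear_map K U V n M h \<longleftrightarrow>
     (\<forall>p q. p + q = n \<longrightarrow>
        (\<forall>y\<in>carrier (V q). (\<lambda>x. h (p, x) (q, y)) \<in> linear_maps K (U p) M) \<and>
        (\<forall>x\<in>carrier (U p). (\<lambda>y. h (p, x) (q, y)) \<in> linear_maps K (V q) M))"

text \<open>
  The kernel of the linear extension of a bilinear map is a submodule that contains all relators,
  hence it contains the submodule that they generate.
\<close>

lemma tensor_null_kernel: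
  assumes U: "graded_vector_space K U" and V: "graded_vector_space K V"
    and M: "module K M" and h: "bilinear_map K U V n M h" and \<nu>: "\<nu> \<in> tensor_null K U V n"
  shows "\<nu> \<in> carrier (tensor_free K U V n)"
    and "free_extension K M (\<lambda>b. h (fst b) (snd b)) \<nu> = \<zero>\<^bsub>M\<^esub>"
proof -
  have K: "field K" using U by (simp add: graded_vector_space_def)
  let ?B = "tensor_basis U V n"
  let ?F = "free_module K ?B"
  let ?\<Phi> = "free_extension K M (\<lambda>b. h (fst b) (snd b))"
  let ?N = "{\<phi> \<in> carrier ?F. ?\<Phi> \<phi> = \<zero>\<^bsub>M\<^esub>}"
  interpret F: module K ?F by (rule free_module_module[OF K])
  interpret M: module K M by (rule M)
  note hl = h[unfolded bilinear_map_def, rule_format, THEN conjunct1, rule_format]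
  note hr = h[unfolded bilinear_map_def, rule_format, THEN conjunct2, rule_format]
  have hc: "h (fst b) (snd b) \<in> carrier M" if "b \<in> ?B" for b
    using that linear_mapsD(1)[OF hl] by (cases b) (auto simp: tensor_basis_def homogs_def)
  have \<Phi>: "?\<Phi> \<in> linear_maps K ?F M"
    by (rule free_extension_linear(1)[OF K M]) (rule hc)
  have \<Phi>_gen: "?\<Phi> (free_gen K b) = h (fst b) (snd b)" if "b \<in> ?B" for b
    by (rule free_extension_linear(2)[OF K M _ that]) (rule hc)
  have \<Phi>_inv: "?\<Phi> (\<ominus>\<^bsub>?F\<^esub> \<phi>) = \<ominus>\<^bsub>M\<^esub> ?\<Phi> \<phi>" if "\<phi> \<in> carrier ?F" for \<phi>
  proof (rule M.minus_equality[symmetric])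
    show "?\<Phi> (\<ominus>\<^bsub>?F\<^esub> \<phi>) \<oplus>\<^bsub>M\<^esub> ?\<Phi> \<phi> = \<zero>\<^bsub>M\<^esub>"
      using that linear_maps_zero_value[OF \<Phi> F.module_axioms M]
      by (simp add: linear_mapsD(2)[OF \<Phi>, symmetric] F.l_neg)
  qed (simp_all add: that linear_mapsD(1)[OF \<Phi>])
  have diff: "a \<ominus>\<^bsub>?F\<^esub> b \<in> ?N" if "a \<in> carrier ?F" "b \<in> carrier ?F" "?\<Phi> a = ?\<Phi> b" for a b
    using that by (simp add: a_minus_def linear_mapsD[OF \<Phi>] \<Phi>_inv M.r_neg)
  have gen: "free_gen K ((p, x), (q, y)) \<in> carrier ?F" "?\<Phi> (free_gen K ((p, x), (q, y))) =
      h (p, x) (q, y)"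
    if "p + q = n" "x \<in> carrier (U p)" "y \<in> carrier (V q)" for p q x y
  proof -
    have "((p, x), (q, y)) \<in> ?B" using that by (simp add: tensor_basis_def homogs_def)
    then show "free_gen K ((p, x), (q, y)) \<in> carrier ?F" "?\<Phi> (free_gen K ((p, x), (q, y))) =
        h (p, x) (q, y)"
      using free_gen_carrier[OF K] \<Phi>_gen by auto
  qed
  have Um: "x \<oplus>\<^bsub>U p\<^esub> x' \<in> carrier (U p)" "c \<in> carrier K \<Longrightarrow> c \<odot>\<^bsub>U p\<^esub> x \<in> carrier (U p)"
    if "x \<in> carrier (U p)" "x' \<in> carrier (U p)" for p x x' c
    using that graded_module[OF U, of p] by (auto intro: module.smult_closed abelian_groupE(1)
        module.axioms)
  have Vm: "x \<oplus>\<^bsub>V p\<^esub> x' \<in> carrier (V p)" "c \<in> carrier K \<Longrightarrow> c \<odot>\<^bsub>V p\<^esub> x \<in> carrier (V p)"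
    if "x \<in> carrier (V p)" "x' \<in> carrier (V p)" for p x x' c
    using that graded_module[OF V, of p] by (auto intro: module.smult_closed abelian_groupE(1)
        module.axioms)
  have "tensor_relators K U V n \<subseteq> ?N"
    unfolding tensor_relators_def Let_def
    apply (intro Un_least subsetI)
    subgoal by (elim CollectE exE conjE, simp only:, rule diff)
      (simp_all add: gen Um linear_mapsD[OF \<Phi>] linear_mapsD[OF hl])
    subgoal by (elim CollectE exE conjE, simp only:, rule diff)
      (simp_all add: gen Vm linear_mapsD[OF \<Phi>] linear_mapsD[OF hr])
    subgoal by (elim CollectE exE conjE, simp only:, rule diff)
      (simp_all add: gen Um linear_mapsD[OF \<Phi>] linear_mapsD[OF hl])
    subgoal by (elim CollectE exE conjE, simp only:, rule diff)
      (simp_all add: gen Vm linear_mapsD[OF \<Phi>] linear_mapsD[OF hr])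
    done
  moreover have "submodule ?N K ?F"
    by (rule F.submoduleI)
      (auto simp: linear_mapsD[OF \<Phi>] \<Phi>_inv linear_maps_zero_value[OF \<Phi> F.module_axioms M])
  ultimately have "tensor_null K U V n \<subseteq> ?N"
    unfolding tensor_null_def by auto
  with \<nu> show "\<nu> \<in> carrier ?F" "?\<Phi> \<nu> = \<zero>\<^bsub>M\<^esub>" by auto
qed

lemma zero_in_tensor_null: "\<zero>\<^bsub>tensor_free K U V n\<^esub> \<in> tensor_null K U V n"
  unfolding tensor_null_def by (auto dest!: submodule.axioms(1) subgroup.one_closed)

lemma tensor_lift_pure_tensor:
  assumes U: "graded_vector_space K U" and V: "graded_vector_space K V"
    and M: "module K M" and h: "bilinear_map K U V n M h"
    and x: "x \<in> homogs U" and y: "y \<in> homogs V" and n: "fst x + fst y = n"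
  shows "tensor_lift K M h (pure_tensor K U V x y) = h x y"
proof -
  have K: "field K" using U by (simp add: graded_vector_space_def)
  let ?B = "tensor_basis U V n"
  let ?F = "free_module K ?B"
  let ?\<Phi> = "free_extension K M (\<lambda>b. h (fst b) (snd b))"
  interpret F: module K ?F by (rule free_module_module[OF K])
  interpret M: module K M by (rule M)
  note hl = h[unfolded bilinear_map_def, rule_format, THEN conjunct1, rule_format]
  have hc: "h (fst b) (snd b) \<in> carrier M" if "b \<in> ?B" for b
    using that linear_mapsD(1)[OF hl] by (cases b) (auto simp: tensor_basis_def homogs_def)
  have \<Phi>: "?\<Phi> \<in> linear_maps K ?F M"
    by (rule free_extension_linear(1)[OF K M]) (rule hc)
  have \<Phi>_gen: "?\<Phi> (free_gen K b) = h (fst b) (snd b)" if "b \<in> ?B" for b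
    by (rule free_extension_linear(2)[OF K M _ that]) (rule hc)
  have b: "(x, y) \<in> ?B" using x y n by (simp add: tensor_basis_def)
  note g = free_gen_carrier[OF K b]
  have "?\<Phi> \<phi> = h x y" if "\<phi> \<in> pure_tensor K U V x y" for \<phi>
  proof -
    from that obtain \<nu> where \<nu>: "\<nu> \<in> tensor_null K U V n" "\<phi> = \<nu> \<oplus>\<^bsub>?F\<^esub> free_gen K (x, y)"
      by (auto simp: pure_tensor_def n Let_def a_r_coset_def r_coset_def)
    note k = tensor_null_kernel[OF U V M h \<nu>(1)]
    show ?thesis
      using \<Phi>_gen[OF b] hc[OF b] by (simp add: \<nu>(2) linear_mapsD(2)[OF \<Phi> k(1) g] k(2))
  qed
  moreover have "\<zero>\<^bsub>?F\<^esub> \<oplus>\<^bsub>?F\<^esub> free_gen K (x, y) \<in> pure_tensor K U V x y"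
    by (auto simp: pure_tensor_def n Let_def a_r_coset_def r_coset_def intro: zero_in_tensor_null)
  ultimately have "?\<Phi> ` pure_tensor K U V x y = {h x y}" by auto
  then show ?thesis
    by (simp add: tensor_lift_def free_extension_def)
qed

lemma tensor_lift_zero:
  assumes U: "graded_vector_space K U" and V: "graded_vector_space K V"
    and M: "module K M" and h: "bilinear_map K U V n M h"
  shows "tensor_lift K M h \<zero>\<^bsub>tensor K U V n\<^esub> = \<zero>\<^bsub>M\<^esub>"
proof -
  let ?\<Phi> = "free_extension K M (\<lambda>b. h (fst b) (snd b))"
  have ker: "?\<Phi> ` tensor_null K U V n \<subseteq> {\<zero>\<^bsub>M\<^esub>}"
    using tensor_null_kernel(2)[OF U V M h] by auto
  have mem: "?\<Phi> \<zero>\<^bsub>tensor_free K U V n\<^esub> \<in> ?\<Phi> ` tensor_null K U V n"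
    by (rule imageI[OF zero_in_tensor_null])
  have "\<And>A z a. A \<subseteq> {z} \<Longrightarrow> a \<in> A \<Longrightarrow> A = {z}"
    by blast
  from this[OF ker mem] have "?\<Phi> ` tensor_null K U V n = {\<zero>\<^bsub>M\<^esub>}" .
  then have "tensor_lift K M h (tensor_null K U V n) = \<zero>\<^bsub>M\<^esub>"
    unfolding tensor_lift_def free_extension_def by (simp only: the_elem_eq)
  then show ?thesis
    by (simp add: tensor_def Let_def)
qed

lemma pure_tensor_carrier:
  assumes "field K" "x \<in> homogs U" "y \<in> homogs V" "fst x + fst y = n"
  shows "pure_tensor K U V x y \<in> carrier (tensor K U V n)"
proof -
  have "free_gen K (x, y) \<in> carrier (tensor_free K U V n)"
    by (rule free_gen_carrier) (use assms in \<open>auto simp: tensor_basis_def\<close>)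
  then show ?thesis
    by (auto simp: pure_tensor_def assms(4) tensor_def Let_def A_RCOSETS_def RCOSETS_def
        a_r_coset_def)
qed

lemma tensor_zero_carrier:
  assumes U: "graded_vector_space K U" and V: "graded_vector_space K V"
  shows "\<zero>\<^bsub>tensor K U V n\<^esub> \<in> carrier (tensor K U V n)"
proof -
  let ?F = "tensor_free K U V n" and ?N = "tensor_null K U V n"
  have K: "field K" using U by (simp add: graded_vector_space_def)
  interpret F: module K ?F by (rule free_module_module[OF K])
  have "bilinear_map K U V n ?F (\<lambda>_ _. \<zero>\<^bsub>?F\<^esub>)"
    unfolding bilinear_map_def by (intro allI impI conjI ballI linear_maps_zero[OF F.module_axioms])
  from tensor_null_kernel(1)[OF U V F.module_axioms this]
  have "?N +>\<^bsub>?F\<^esub> \<zero>\<^bsub>?F\<^esub> = ?N"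
    by (force simp: a_r_coset_def r_coset_def)
  then have "?N \<in> a_rcosets\<^bsub>?F\<^esub> ?N"
    using F.M.zero_closed by (force simp: A_RCOSETS_def RCOSETS_def a_r_coset_def)
  then show ?thesis by (simp add: tensor_def Let_def)
qed

section \<open>The action of the brackets on intertwiners\<close>

lemma skew_multilinear_move_front:
  assumes W: "graded_vector_space K W" and h: "skew_multilinear K A n W h"
    and ys: "ys \<in> lists (homogs A)" and x: "x \<in> homogs A" and n: "n = Suc (length ys)"
    and d: "d = degs ys + fst x"
  shows "h (ys @ [x]) = [(neg1 (int (length ys) + fst x * degs ys))] \<cdot>\<^bsub>W d\<^esub> h (x # ys)"
  using W h ys n d
proof (induction ys arbitrary: n W h d)
  case Nil
  interpret abelian_group "W d" by (rule graded_abelian_group[OF Nil(1)])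
  have "h [x] \<in> carrier (W d)"
    using skew_multilinear_closed[OF Nil(2), of "[x]"] Nil x by simp
  then show ?case by simp
next
  case (Cons a ys)
  interpret abelian_group "W d" by (rule graded_abelian_group[OF Cons.prems(1)])
  have a: "a \<in> homogs A" and ys: "ys \<in> lists (homogs A)" using Cons.prems(3) by auto
  have n: "n = Suc (Suc (length ys))" using Cons.prems(4) by simp
  have c: "h (x # a # ys) \<in> carrier (W d)"
    using skew_multilinear_closed[OF Cons.prems(2), of "x # a # ys"] Cons.prems a x ys
    by (simp add: ac_simps)
  have "skew_multilinear K A (Suc (length ys)) (shift W (fst a)) (\<lambda>xs. h (a # xs))"
    using Cons.prems(2) a unfolding n by (subst (asm) skew_multilinear_Suc) blast
  from Cons.IH[OF graded_shift[OF Cons.prems(1)] this ys refl, of "degs ys + fst x"]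
  have "h (a # ys @ [x]) = [(neg1 (int (length ys) + fst x * degs ys))] \<cdot>\<^bsub>W d\<^esub> h (a # x # ys)"
    by (simp add: shift_def Cons.prems(5) ac_simps)
  also have "h ([] @ a # x # ys) = [(- neg1 (fst a * fst x))] \<cdot>\<^bsub>W d\<^esub> h ([] @ x # a # ys)"
    by (rule skew_multilinear_swap[OF Cons.prems(2) _ ys a x]) (simp_all add: n Cons.prems(5))
  then have "h (a # x # ys) = [(- neg1 (fst a * fst x))] \<cdot>\<^bsub>W d\<^esub> h (x # a # ys)" by simp
  finally show ?case
    by (simp add: int_mult_mult c minus_neg1 neg1_mult algebra_simps)
qed

definition bracket :: "('g homogeneous list \<Rightarrow> 'g) \<Rightarrow> 'g homogeneous list \<Rightarrow> 'g homogeneous" where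
  "bracket l zs = (2 - int (length zs) + degs zs, l zs)"

lemma fst_bracket [simp]: "fst (bracket l zs) = 2 - int (length zs) + degs zs"
  by (simp add: bracket_def)

text \<open>
  The last term of the hom differential, up to signs the composite of \<open>f\<close> with the coderivation that
  the brackets define.
\<close>

definition ell_action ::
    "('k, 'm) ring_scheme \<Rightarrow> ('k, 'g) graded \<Rightarrow> ('g homogeneous list \<Rightarrow> 'g) \<Rightarrow>
     ('k, 'u) graded \<Rightarrow> ('k, 'v) graded \<Rightarrow> int \<Rightarrow> ('g, 'u, 'v) itw \<Rightarrow> ('g, 'u, 'v) itw" where
  "ell_action K A l U V n f = juxt A U V (n - 1) 2 (itw_varrho K A U V n f) (itw_ell K A l U)"

text \<open>
  The summand of \<open>ell_action\<close>, with the bracket of \<open>zs\<close> as first argument of \<open>f\<close>.  The definition by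
  juxtaposition places the bracket behind the other entries instead; moving it to the front and
  exchanging the two lists removes all dependence of the sign on the degrees of the entries.
\<close>

definition bracket_term ::
    "('k, 'v) module \<Rightarrow> ('g homogeneous list \<Rightarrow> 'g) \<Rightarrow> int \<Rightarrow> ('g, 'u, 'v) itw \<Rightarrow> 'u homogeneous \<Rightarrow>
     'g homogeneous list \<Rightarrow> 'g homogeneous list \<Rightarrow> 'v" where
  "bracket_term M l n f u zs ys = (if zs = [] then \<zero>\<^bsub>M\<^esub>
     else [(neg1 ((n - 1) * int (length zs) + 1))] \<cdot>\<^bsub>M\<^esub> f (bracket l zs # ys, u))"

locale homotopy_lie =
  fixes K :: "('k, 'm) ring_scheme" and A :: "('k, 'g) graded" and l :: "'g homogeneous list \<Rightarrow> 'g"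
  assumes hla: "homotopy_lie_algebra K A l"
begin

lemma graded_lie: "graded_vector_space K A"
  using hla by (simp add: homotopy_lie_algebra_def)

lemma l_skew: "i \<ge> 1 \<Longrightarrow> skew_multilinear K A i (shift A (2 - int i)) l"
  using hla by (simp add: homotopy_lie_algebra_def)

lemma bracket_homog: "zs \<in> lists (homogs A) \<Longrightarrow> zs \<noteq> [] \<Longrightarrow> bracket l zs \<in> homogs A"
  using skew_multilinear_closed[OF l_skew, of "length zs" zs]
  by (simp add: homogs_iff bracket_def shift_def Suc_le_eq add.commute)

text \<open>
  The defining relation of a homotopy Lie algebra in terms of unshuffles.  The empty list, for which
  there is no bracket, contributes nothing.
\<close>

lemma homotopy_jacobi:
  assumes ws: "ws \<in> lists (homogs A)" and m: "m = degs ws + 3 - int (length ws)"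
  shows "unshuffle_sum (A m) (\<lambda>zs ys. if zs = [] then \<zero>\<^bsub>A m\<^esub>
      else [(neg1 (int (length ys)))] \<cdot>\<^bsub>A m\<^esub> l (bracket l zs # ys)) ws = \<zero>\<^bsub>A m\<^esub>"
proof (cases "ws = []")
  case True
  then show ?thesis by simp
next
  case False
  let ?n = "length ws"
  let ?M = "A m"
  interpret abelian_group ?M by (rule graded_abelian_group[OF graded_lie])
  have M: "shift A (3 - int ?n) (degs ws) = ?M" by (simp add: shift_def m algebra_simps)
  let ?h = "\<lambda>k ys. l ((2 - int k + degs (take k ys), l (take k ys)) # drop k ys)"
  have n: "?n \<ge> 1" using False by (simp add: Suc_le_eq)
  have closed: "l (bracket l zs # ys) \<in> carrier ?M" if "mset zs + mset ys = mset ws" "zs \<noteq> []"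
      for zs ys
  proof -
    note s = splits_lists[OF that(1) ws] splits_length[OF that(1)] splits_degs[OF that(1)]
    have "l (bracket l zs # ys) \<in> carrier (shift A (2 - int (Suc (length ys))) (degs (bracket l zs
        # ys)))"
      by (rule skew_multilinear_closed[OF l_skew]) (use s bracket_homog that(2) in auto)
    then show ?thesis using s by (simp add: shift_def m algebra_simps)
  qed
  have "\<zero>\<^bsub>?M\<^esub> = (\<Oplus>\<^bsub>?M\<^esub>k\<in>{1..?n}. [(neg1 (int (?n - k)))] \<cdot>\<^bsub>?M\<^esub> shuffle_sum ?M k (?n - k) (?h k) ws)"
    using hla[unfolded homotopy_lie_algebra_def Let_def, THEN conjunct2, THEN conjunct2,
        rule_format, OF n ws refl]
    by (simp only: M)
  also have "\<dots> = unshuffle_sum ?M (\<lambda>zs ys. if length zs \<in> {1..?n} then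
      [(neg1 (int (?n - length zs)))] \<cdot>\<^bsub>?M\<^esub> ?h (length zs) (zs @ ys) else \<zero>\<^bsub>?M\<^esub>) ws"
  proof (rule finsum_shuffle_sum)
    show "abelian_group ?M" by (rule abelian_group_axioms)
    fix k zs assume k: "k \<in> {1..?n}" and z: "mset zs = mset ws"
    have "length zs = ?n" using z by (rule mset_eq_length)
    then have "length (take k zs) = k" "take k zs \<noteq> []" using k by auto
    moreover have "mset (take k zs) + mset (drop k zs) = mset ws"
      unfolding mset_append[symmetric] append_take_drop_id by (rule z)
    ultimately show "?h k zs \<in> carrier ?M"
      using closed[of "take k zs" "drop k zs"] by (simp add: bracket_def)
  qed auto
  also have "\<dots> = unshuffle_sum ?M (\<lambda>zs ys. if zs = [] then \<zero>\<^bsub>?M\<^esub>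
      else [(neg1 (int (length ys)))] \<cdot>\<^bsub>?M\<^esub> l (bracket l zs # ys)) ws"
  proof (rule unshuffle_sum_cong)
    fix zs ys assume "mset zs + mset ys = mset ws"
    from splits_length[OF this]
    show "(if length zs \<in> {1..?n} then
      [(neg1 (int (?n - length zs)))] \<cdot>\<^bsub>?M\<^esub> ?h (length zs) (zs @ ys) else \<zero>\<^bsub>?M\<^esub>) =
      (if zs = [] then \<zero>\<^bsub>?M\<^esub> else [(neg1 (int (length ys)))] \<cdot>\<^bsub>?M\<^esub> l (bracket l zs # ys))"
      by (simp add: bracket_def Suc_le_eq)
  qed
  finally show ?thesis ..
qed

text \<open>
  On a pure tensor, the lift of a bilinear map is given by the map itself; this removes the tensor
  product from the differential.
\<close>

lemma varrho_ell_value: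
  assumes U: "graded_vector_space K U" and V: "graded_vector_space K V"
    and f: "f \<in> intertwiners K A U V n"
    and ys: "ys \<in> lists (homogs A)" and zs: "zs \<in> lists (homogs A)" and u: "u \<in> homogs U"
    and d: "d = degs ys + degs zs + fst u + n + 1 - int (length ys) - int (length zs)"
  shows "itw_varrho K A U V n f (ys, (2 - int (length zs) + degs zs + fst u, itw_ell K A l U (zs,
      u))) =
    (if zs = [] then \<zero>\<^bsub>V d\<^esub> else [(neg1 (int (length ys) + 1))] \<cdot>\<^bsub>V d\<^esub> f (ys @ [bracket l zs], u))"
proof -
  let ?m = "2 - int (length zs) + degs zs + fst u"
  let ?t = "itw_ell K A l U (zs, u)"
  let ?M = "V d"
  interpret abelian_group ?M by (rule graded_abelian_group[OF V])
  have K: "field K" using U by (simp add: graded_vector_space_def)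
  have t: "?t = (if zs = [] then \<zero>\<^bsub>tensor K A U ?m\<^esub> else pure_tensor K A U (bracket l zs) u)"
    using zs u itw_target_eqI[of ?m zs "fst u" 2 "tensor K A U"]
    by (cases "zs = []") (simp_all add: itw_ell_def itw_dom_iff bracket_def)
  have "?t \<in> carrier (tensor K A U ?m)"
    unfolding t using tensor_zero_carrier[OF graded_lie U] pure_tensor_carrier[OF K
        bracket_homog[OF zs] u] by auto
  then have dom: "(ys, (?m, ?t)) \<in> itw_dom A (tensor K A U)"
    using ys by (simp add: itw_dom_iff homogs_iff)
  have M: "itw_target V (n - 1) ys ?m = ?M"
    by (rule itw_target_eqI) (simp add: d)
  have bil: "bilinear_map K A U ?m ?M (\<lambda>x u. f (ys @ [x], u))"
    unfolding bilinear_map_def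
  proof (intro allI impI conjI ballI)
    fix p q y assume pq: "p + q = ?m" and y: "y \<in> carrier (U q)"
    then have "(q, y) \<in> homogs U" by (simp add: homogs_iff)
    from intertwiner_skew[OF f this refl]
    have "(\<lambda>x. f (ys @ [(p, x)], (q, y))) \<in>
        linear_maps K (A p) (shift V (n - int (Suc (length ys)) + fst (q, y)) (degs ys + p))"
      by (rule skew_multilinear_slot) (use ys in auto)
    moreover have "shift V (n - int (Suc (length ys)) + fst (q, y)) (degs ys + p) = ?M"
      unfolding shift_def by (rule arg_cong[of _ _ V]) (use pq d in simp)
    ultimately show "(\<lambda>x. f (ys @ [(p, x)], (q, y))) \<in> linear_maps K (A p) ?M"
      by simp
  next
    fix p q x assume pq: "p + q = ?m" and x: "x \<in> carrier (A p)"
    show "(\<lambda>y. f (ys @ [(p, x)], (q, y))) \<in> linear_maps K (U q) ?M"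
      by (rule intertwiner_linear[OF f]) (use ys x pq d in \<open>auto simp: homogs_iff\<close>)
  qed
  have "itw_varrho K A U V n f (ys, (?m, ?t)) =
    [(neg1 (int (length ys + 1)))] \<cdot>\<^bsub>?M\<^esub> tensor_lift K ?M (\<lambda>x u. f (ys @ [x], u)) ?t"
    using dom by (simp add: itw_varrho_def Let_def M)
  also have "tensor_lift K ?M (\<lambda>x u. f (ys @ [x], u)) ?t =
    (if zs = [] then \<zero>\<^bsub>V d\<^esub> else f (ys @ [bracket l zs], u))"
    unfolding t
    using tensor_lift_zero[OF graded_lie U graded_module[OF V] bil]
      tensor_lift_pure_tensor[OF graded_lie U graded_module[OF V] bil bracket_homog[OF zs] u]
    by (cases "zs = []") simp_all
  finally show ?thesis by (simp add: add.commute)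
qed

lemma bracket_value_closed:
  assumes f: "f \<in> intertwiners K A U V n"
    and "ys \<in> lists (homogs A)" "zs \<in> lists (homogs A)" "zs \<noteq> []" "u \<in> homogs U"
    and "d = degs ys + degs zs + fst u + n + 1 - int (length ys) - int (length zs)"
  shows "f (bracket l zs # ys, u) \<in> carrier (V d)"
  by (rule intertwiner_closed[OF f]) (use assms bracket_homog in auto)

lemma bracket_term_closed:
  assumes V: "graded_vector_space K V" and f: "f \<in> intertwiners K A U V n"
    and xs: "xs \<in> lists (homogs A)" "u \<in> homogs U" "mset zs + mset ys = mset xs"
    and d: "d = degs xs + fst u + n + 1 - int (length xs)"
  shows "bracket_term (V d) l n f u zs ys \<in> carrier (V d)"
proof -
  interpret abelian_group "V d" by (rule graded_abelian_group[OF V])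
  note s = splits_lists[OF xs(3,1)] splits_length[OF xs(3)] splits_degs[OF xs(3)]
  have dd: "d = degs ys + degs zs + fst u + n + 1 - int (length ys) - int (length zs)"
    using s d by simp
  show ?thesis
    unfolding bracket_term_def
    using bracket_value_closed[OF f _ _ _ xs(2) dd] s by (cases "zs = []") simp_all
qed

lemma ell_action_apply:
  assumes U: "graded_vector_space K U" and V: "graded_vector_space K V"
    and f: "f \<in> intertwiners K A U V n"
    and xs: "xs \<in> lists (homogs A)" and u: "u \<in> homogs U"
    and d: "d = degs xs + fst u + n + 1 - int (length xs)"
  shows "ell_action K A l U V n f (xs, u) = unshuffle_sum (V d) (bracket_term (V d) l n f u) xs"
proof -
  let ?M = "V d"
  interpret abelian_group ?M by (rule graded_abelian_group[OF V])
  let ?g = "itw_varrho K A U V n f" and ?e = "itw_ell K A l U"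
  have val: "?g (ys, (2 - int (length zs) + degs zs + fst u, ?e (zs, u))) =
    (if zs = [] then \<zero>\<^bsub>?M\<^esub> else [(neg1 (int (length ys) + 1))] \<cdot>\<^bsub>?M\<^esub> f (ys @ [bracket l zs], u))"
    and cl: "zs \<noteq> [] \<Longrightarrow> f (ys @ [bracket l zs], u) \<in> carrier ?M" "zs \<noteq> [] \<Longrightarrow>
        f (bracket l zs # ys, u) \<in> carrier ?M"
    and move: "zs \<noteq> [] \<Longrightarrow> f (ys @ [bracket l zs], u) =
       [(neg1 (int (length ys) + fst (bracket l zs) * degs ys))] \<cdot>\<^bsub>?M\<^esub> f (bracket l zs # ys, u)"
    if m: "mset ys + mset zs = mset xs" for ys zs
  proof -
    note s = splits_lists[OF m xs] splits_length[OF m] splits_degs[OF m]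
    show "?g (ys, (2 - int (length zs) + degs zs + fst u, ?e (zs, u))) =
      (if zs = [] then \<zero>\<^bsub>?M\<^esub> else [(neg1 (int (length ys) + 1))] \<cdot>\<^bsub>?M\<^esub> f (ys @ [bracket l zs], u))"
      by (rule varrho_ell_value[OF U V f]) (use s u d in auto)
    assume z: "zs \<noteq> []"
    show "f (ys @ [bracket l zs], u) \<in> carrier ?M"
      by (rule intertwiner_closed[OF f]) (use s u d bracket_homog z in auto)
    show "f (bracket l zs # ys, u) \<in> carrier ?M"
      by (rule intertwiner_closed[OF f]) (use s u d bracket_homog z in auto)
    have "f (ys @ [bracket l zs], u) = [(neg1 (int (length ys) + fst (bracket l zs) * degs ys))]
        \<cdot>\<^bsub>shift V (n - int (Suc (length ys)) + fst u) (degs ys + fst (bracket l zs))\<^esub> f (bracket l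
            zs # ys, u)"
      by (rule skew_multilinear_move_front[OF graded_shift[OF V] intertwiner_skew[OF f u refl]])
        (use s bracket_homog z in auto)
    moreover have "shift V (n - int (Suc (length ys)) + fst u) (degs ys + fst (bracket l zs)) = ?M"
      unfolding shift_def by (rule arg_cong[of _ _ V]) (use s d in simp)
    ultimately show "f (ys @ [bracket l zs], u) =
       [(neg1 (int (length ys) + fst (bracket l zs) * degs ys))] \<cdot>\<^bsub>?M\<^esub> f (bracket l zs # ys, u)"
           by simp
  qed
  have "ell_action K A l U V n f (xs, u) = unshuffle_sum ?M (juxt_term ?M (n - 1) 2 ?g ?e u) xs"
    unfolding ell_action_def
  proof (rule juxt_apply_closed[OF V xs u])
    show "d = degs xs + fst u + (n - 1) + 2 - int (length xs)" by (simp add: d)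
    fix ys zs assume "mset ys + mset zs = mset xs"
    then show "?g (ys, (2 - int (length zs) + degs zs + fst u, ?e (zs, u))) \<in> carrier ?M"
      by (simp add: val cl)
  qed
  also have "\<dots> = unshuffle_sum ?M (\<lambda>zs ys. [(neg1 (int (length zs * length ys) + degs zs * degs
      ys))] \<cdot>\<^bsub>?M\<^esub>
      juxt_term ?M (n - 1) 2 ?g ?e u ys zs) xs"
    by (rule unshuffle_sum_cocomm) (auto simp: juxt_term_def val intro: cl)
  also have "\<dots> = unshuffle_sum ?M (bracket_term ?M l n f u) xs"
  proof (rule unshuffle_sum_cong)
    fix zs ys assume m': "mset zs + mset ys = mset xs"
    then have m: "mset ys + mset zs = mset xs" by (simp add: add.commute)
    show "[(neg1 (int (length zs * length ys) + degs zs * degs ys))] \<cdot>\<^bsub>?M\<^esub>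
      juxt_term ?M (n - 1) 2 ?g ?e u ys zs = bracket_term ?M l n f u zs ys"
    proof (cases "zs = []")
      case True
      then show ?thesis unfolding juxt_term_def val[OF m] bracket_term_def by simp
    next
      case False
      then show ?thesis
        unfolding juxt_term_def val[OF m] bracket_term_def
        by (simp add: move[OF m] neg1_act_act cl[OF m])
          (rule arg_cong[where f = "\<lambda>k. [k] \<cdot>\<^bsub>?M\<^esub> _"], rule neg1_cong, simp add: algebra_simps)
    qed
  qed
  finally show ?thesis .
qed

lemma ell_action_extensional: "ell_action K A l U V n f \<in> extensional (itw_dom A U)"
  by (simp add: ell_action_def juxt_extensional)

lemma ell_action_intertwiner:
  assumes U: "graded_vector_space K U" and V: "graded_vector_space K V"
    and f: "f \<in> intertwiners K A U V n"
  shows "ell_action K A l U V n f \<in> intertwiners K A U V (n + 1)"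
proof (rule unshuffle_sum_intertwiner[OF graded_lie U V ell_action_extensional])
  fix xs u d assume "xs \<in> lists (homogs A)" "u \<in> homogs U" "d = degs xs + fst u + (n + 1) - int
      (length xs)"
  then show "ell_action K A l U V n f (xs, u) = unshuffle_sum (V d) (bracket_term (V d) l n f u) xs"
    by (intro ell_action_apply[OF U V f]) simp_all
next
  fix xs zs ys m d
  assume xs: "xs \<in> lists (homogs A)" and ms: "mset zs + mset ys = mset xs"
    and d: "d = degs xs + m + (n + 1) - int (length xs)"
  note s = splits_lists[OF ms xs] splits_length[OF ms] splits_degs[OF ms]
  show "(\<lambda>y. bracket_term (V d) l n f (m, y) zs ys) \<in> linear_maps K (U m) (V d)"
  proof (cases "zs = []")
    case True
    then show ?thesis by (simp add: bracket_term_def linear_maps_zero[OF graded_module[OF V]])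
  next
    case False
    have "(\<lambda>y. f (bracket l zs # ys, (m, y))) \<in> linear_maps K (U m) (V d)"
      by (rule intertwiner_linear[OF f]) (use s d bracket_homog False in auto)
    from linear_maps_int_mult[OF graded_module[OF V] this] show ?thesis
      using False by (simp add: bracket_term_def)
  qed
next
  fix u k ys s
  assume u: "u \<in> homogs U" and ys: "ys \<in> lists (homogs A)"
    and s: "s = n + 1 - int (k + length ys) + fst u + degs ys"
  show "skew_multilinear K A k (shift V s) (\<lambda>zs. bracket_term (shift V s (degs zs)) l n f u zs ys)"
  proof (cases "k = 0")
    case True
    then show ?thesis by (simp add: skew_multilinear_def)
  next
    case False
    let ?t = "2 - int k"
    have "skew_multilinear K A k (shift V s) (\<lambda>zs. f ((degs zs + ?t, l zs) # ys, u))"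
    proof (rule skew_multilinear_comp[OF l_skew _ graded_shift[OF graded_lie] graded_shift[OF V]])
      show "1 \<le> k" using False by simp
      fix d
      have "(\<lambda>y. f ([] @ (d + ?t, y) # ys, u)) \<in> linear_maps K (A (d + ?t))
          (shift V (n - int (Suc (length ys)) + fst u) (d + ?t + degs ys))"
        by (rule skew_multilinear_slot[OF intertwiner_skew[OF f u refl]]) (use ys in auto)
      moreover have "shift V (n - int (Suc (length ys)) + fst u) (d + ?t + degs ys) = shift V s d"
        unfolding shift_def by (rule arg_cong[of _ _ V]) (simp add: s)
      ultimately show "(\<lambda>y. f ((d + ?t, y) # ys, u)) \<in> linear_maps K (shift A ?t d) (shift V s d)"
        by (simp add: shift_def)
    qed
    from skew_multilinear_int_mult[OF graded_shift[OF V] this, of "\<lambda>k d. neg1 ((n - 1) * int k +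
        1)"]
    show ?thesis
    proof (rule skew_multilinear_cong[OF graded_lie])
      fix zs :: "'g homogeneous list" assume "length zs = k"
      moreover from this False have "zs \<noteq> []" by auto
      ultimately show "[(neg1 ((n - 1) * int (length zs) + 1))] \<cdot>\<^bsub>shift V s (degs zs)\<^esub>
          f ((degs zs + ?t, l zs) # ys, u) = bracket_term (shift V s (degs zs)) l n f u zs ys"
        by (simp add: bracket_term_def bracket_def add.commute)
    qed
  qed
next
  fix u k zs s
  assume u: "u \<in> homogs U" and zs: "zs \<in> lists (homogs A)"
    and s: "s = n + 1 - int (k + length zs) + fst u + degs zs"
  show "skew_multilinear K A k (shift V s) (\<lambda>ys. bracket_term (shift V s (degs ys)) l n f u zs ys)"
  proof (cases "zs = []")
    case True
    then show ?thesis
      using skew_multilinear_zero[OF graded_shift[OF V]] by (simp add: bracket_term_def)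
  next
    case False
    have "skew_multilinear K A (Suc k) (shift V (n - int (Suc k) + fst u)) (\<lambda>xs. f (xs, u))"
      by (rule intertwiner_skew[OF f u refl])
    from this[unfolded skew_multilinear_Suc] bracket_homog[OF zs False]
    have "skew_multilinear K A k (shift (shift V (n - int (Suc k) + fst u)) (fst (bracket l zs)))
        (\<lambda>xs. f (bracket l zs # xs, u))" by blast
    moreover have "shift (shift V (n - int (Suc k) + fst u)) (fst (bracket l zs)) = shift V s"
      unfolding shift_def by (rule ext, rule arg_cong[of _ _ V]) (simp add: s)
    ultimately have "skew_multilinear K A k (shift V s) (\<lambda>xs. f (bracket l zs # xs, u))" by simp
    from skew_multilinear_int_mult[OF graded_shift[OF V] this, of "\<lambda>_ _. neg1 ((n - 1) * int
        (length zs) + 1)"]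
    show ?thesis using False by (simp add: bracket_term_def)
  qed
qed

lemma ell_action_linear:
  assumes U: "graded_vector_space K U" and V: "graded_vector_space K V"
  shows "ell_action K A l U V n \<in> linear_maps K (itw_space K A U V n) (itw_space K A U V (n + 1))"
proof (rule unshuffle_sum_linear[OF V itw_space_module[OF graded_lie U V]], unfold
    itw_space_simps(1))
  fix f assume f: "f \<in> intertwiners K A U V n"
  show "ell_action K A l U V n f \<in> intertwiners K A U V (n + 1)"
    by (rule ell_action_intertwiner[OF U V f])
  fix xs u d assume "xs \<in> lists (homogs A)" "u \<in> homogs U" "d = degs xs + fst u + (n + 1) - int
      (length xs)"
  then show "ell_action K A l U V n f (xs, u) = unshuffle_sum (V d) (bracket_term (V d) l n f u) xs"
    by (intro ell_action_apply[OF U V f]) simp_all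
next
  fix xs u zs ys d
  assume xs: "xs \<in> lists (homogs A)" and u: "u \<in> homogs U" and ms: "mset zs + mset ys = mset xs"
    and d: "d = degs xs + fst u + (n + 1) - int (length xs)"
  note s = splits_lists[OF ms xs] splits_length[OF ms] splits_degs[OF ms]
  show "(\<lambda>f. bracket_term (V d) l n f u zs ys) \<in> linear_maps K (itw_space K A U V n) (V d)"
  proof (cases "zs = []")
    case True
    then show ?thesis by (simp add: bracket_term_def linear_maps_zero[OF graded_module[OF V]])
  next
    case False
    have "(\<lambda>f. f (bracket l zs # ys, u)) \<in> linear_maps K (itw_space K A U V n) (V d)"
      by (rule intertwiner_eval_linear[OF graded_lie V _ u]) (use s d bracket_homog False in auto)
    from linear_maps_int_mult[OF graded_module[OF V] this] show ?thesis
      using False by (simp add: bracket_term_def)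
  qed
qed

lemma ell_action_id:
  assumes U: "graded_vector_space K U"
  shows "ell_action K A l U U 0 (itw_id A U) = \<zero>\<^bsub>itw_space K A U U 1\<^esub>"
proof (rule intertwiner_eqI[OF ell_action_extensional])
  show "\<zero>\<^bsub>itw_space K A U U 1\<^esub> \<in> extensional (itw_dom A U)" by (simp add: itw_space_simps)
  fix xs u assume xs: "xs \<in> lists (homogs A)" and u: "u \<in> homogs U"
  let ?d = "degs xs + fst u + 1 - int (length xs)"
  let ?M = "U ?d"
  interpret abelian_group ?M by (rule graded_abelian_group[OF U])
  have "ell_action K A l U U 0 (itw_id A U) (xs, u) = unshuffle_sum ?M (bracket_term ?M l 0
      (itw_id A U) u) xs"
    by (rule ell_action_apply[OF U U itw_id_intertwiner[OF graded_lie U] xs u]) simp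
  also have "\<dots> = unshuffle_sum ?M (\<lambda>zs ys. \<zero>\<^bsub>?M\<^esub>) xs"
  proof (rule unshuffle_sum_cong)
    fix zs ys assume ms: "mset zs + mset ys = mset xs"
    note s = splits_lists[OF ms xs] splits_length[OF ms] splits_degs[OF ms]
    have "itw_id A U (bracket l zs # ys, u) = \<zero>\<^bsub>?M\<^esub>" if "zs \<noteq> []"
    proof -
      have "itw_target U 0 (bracket l zs # ys) (fst u) = ?M"
        by (rule itw_target_eqI) (use s in simp)
      then show ?thesis using s u bracket_homog that by (simp add: itw_id_def itw_dom_iff)
    qed
    then show "bracket_term ?M l 0 (itw_id A U) u zs ys = \<zero>\<^bsub>?M\<^esub>"
      by (simp add: bracket_term_def)
  qed
  also have "\<dots> = \<zero>\<^bsub>?M\<^esub>" by (rule unshuffle_sum_zero)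
  also have "?M = itw_target U 1 xs (fst u)" by (rule itw_target_eqI[symmetric]) simp
  finally show "ell_action K A l U U 0 (itw_id A U) (xs, u) = \<zero>\<^bsub>itw_space K A U U 1\<^esub> (xs, u)"
    using xs u by (simp add: itw_space_simps itw_dom_iff)
qed

text \<open>
  The coderivation property.  After a bracket has been formed, the bracketed entry goes to one of the
  two factors of the coproduct.  By coassociativity, the terms where it is an argument of \<open>g\<close> form
  \<open>(\<delta>g)f\<close>; those where it is an argument of \<open>f\<close> form \<open>g(\<delta>f)\<close>, once cocommutativity has moved the
  bracketed sublist past the arguments of \<open>g\<close>.
\<close>

lemma ell_action_juxt:
  assumes U: "graded_vector_space K U" and V: "graded_vector_space K V"
      and W: "graded_vector_space K W"
    and g: "g \<in> intertwiners K A V W p" and f: "f \<in> intertwiners K A U V q"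
  shows "ell_action K A l U W (p + q) (juxt A U W p q g f) =
    juxt A U W (p + 1) q (ell_action K A l V W p g) f \<oplus>\<^bsub>itw_space K A U W (p + q + 1)\<^esub>
    ([(neg1 p)] \<cdot>\<^bsub>itw_space K A U W (p + q + 1)\<^esub> juxt A U W p (q + 1) g (ell_action K A l U V q f))"
    (is "?L = ?B \<oplus>\<^bsub>?H\<^esub> ([(neg1 p)] \<cdot>\<^bsub>?H\<^esub> ?C)")
proof (rule intertwiner_eqI[OF ell_action_extensional])
  show "?B \<oplus>\<^bsub>?H\<^esub> ([(neg1 p)] \<cdot>\<^bsub>?H\<^esub> ?C) \<in> extensional (itw_dom A U)" by (simp add: itw_space_simps)
  note gf = juxt_intertwiner[OF graded_lie U V W g f]
  note Dg = ell_action_intertwiner[OF V W g] and Df = ell_action_intertwiner[OF U V f]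
  fix xs u assume xs: "xs \<in> lists (homogs A)" and u: "u \<in> homogs U"
  let ?d = "degs xs + fst u + (p + q + 1) - int (length xs)"
  let ?M = "W ?d"
  interpret abelian_group ?M by (rule graded_abelian_group[OF W])
  (* In ?G1 the bracket is the first argument of g, in ?G2 the first argument of f.
     The exponent ?k comes from bracket_term, ?e1 and ?e2 from the juxtaposition;
     ?e2 includes the sign of moving the bracket past as. *)
  let ?v = "\<lambda>bs. (q - int (length bs) + degs bs + fst u, f (bs, u))"
  let ?w = "\<lambda>zs bs. (q - int (Suc (length bs)) + (fst (bracket l zs) + degs bs) + fst u, f
      (bracket l zs # bs, u))"
  let ?k = "\<lambda>zs. (p + q - 1) * int (length zs) + 1"
  let ?e1 = "\<lambda>zs as bs. (p - int (Suc (length as))) * int (length bs) + (q - int (length bs)) *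
      (fst (bracket l zs) + degs as)"
  let ?e2 = "\<lambda>zs as bs. int (length as) + fst (bracket l zs) * degs as +
     ((p - int (length as)) * int (Suc (length bs)) + (q - int (Suc (length bs))) * degs as)"
  let ?G1 = "\<lambda>zs as bs. if zs = [] then \<zero>\<^bsub>?M\<^esub> else
     [(neg1 (?k zs + ?e1 zs as bs))] \<cdot>\<^bsub>?M\<^esub> g (bracket l zs # as, ?v bs)"
  let ?G2 = "\<lambda>zs as bs. if zs = [] then \<zero>\<^bsub>?M\<^esub> else
     [(neg1 (?k zs + ?e2 zs as bs))] \<cdot>\<^bsub>?M\<^esub> g (as, ?w zs bs)"
  have dist: "zs \<in> lists (homogs A) \<and> as \<in> lists (homogs A) \<and> bs \<in> lists (homogs A) \<and>
      length xs = length zs + length as + length bs \<and> degs xs = degs zs + degs as + degs bs"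
    if m: "mset zs + mset as + mset bs = mset xs" for zs as bs
  proof -
    have 1: "mset (zs @ as) + mset bs = mset xs" using m by simp
    show ?thesis
      using splits_lists[OF 1 xs] splits_length[OF 1] splits_degs[OF 1] by simp
  qed
  have cl1: "g (bracket l zs # as, ?v bs) \<in> carrier ?M" and cl2: "g (as, ?w zs bs) \<in> carrier ?M"
    if m: "mset zs + mset as + mset bs = mset xs" and z: "zs \<noteq> []" for zs as bs
  proof -
    note s = dist[OF m] bracket_homog[OF _ z]
    show "g (bracket l zs # as, ?v bs) \<in> carrier ?M"
      by (rule intertwiner_closed[OF g _ juxt_arg_homog[OF f _ u]]) (use s in auto)
    have "?w zs bs \<in> homogs V"
      using juxt_arg_homog[OF f _ u, of "bracket l zs # bs"] s by simp
    then show "g (as, ?w zs bs) \<in> carrier ?M"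
      by (rule intertwiner_closed[OF g, rotated]) (use s in auto)
  qed
  have G1: "?G1 zs as bs \<in> carrier ?M" and G2: "?G2 zs as bs \<in> carrier ?M"
    if m: "mset zs + mset as + mset bs = mset xs" for zs as bs
    using cl1[OF m] cl2[OF m] by auto
  have "?L (xs, u) = unshuffle_sum ?M (bracket_term ?M l (p + q) (juxt A U W p q g f) u) xs"
    by (rule ell_action_apply[OF U W gf xs u]) simp
  also have "\<dots> = unshuffle_sum ?M (\<lambda>zs ys. unshuffle_sum ?M (\<lambda>as bs. ?G1 zs as bs) ys \<oplus>\<^bsub>?M\<^esub>
      unshuffle_sum ?M (\<lambda>as bs. ?G2 zs as bs) ys) xs"
  proof (rule unshuffle_sum_cong)
    fix zs ys assume m: "mset zs + mset ys = mset xs"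
    note s = splits_lists[OF m xs] splits_length[OF m] splits_degs[OF m]
    show "bracket_term ?M l (p + q) (juxt A U W p q g f) u zs ys =
       unshuffle_sum ?M (\<lambda>as bs. ?G1 zs as bs) ys \<oplus>\<^bsub>?M\<^esub> unshuffle_sum ?M (\<lambda>as bs. ?G2 zs as bs) ys"
    proof (cases "zs = []")
      case True
      then show ?thesis by (simp add: bracket_term_def unshuffle_sum_zero)
    next
      case False
      let ?x = "bracket l zs"
      let ?S = "\<lambda>F. unshuffle_sum ?M F ys"
      let ?J = "juxt_term ?M p q g f u"
      have m3: "mset zs + mset as + mset bs = mset xs" if "mset as + mset bs = mset ys" for as bs
        using that m by (simp add: add.assoc)
      note c1 = cl1[OF m3 False] and c2 = cl2[OF m3 False]
      have J: "?J (?x # as) bs = [(neg1 (?e1 zs as bs))] \<cdot>\<^bsub>?M\<^esub> g (?x # as, ?v bs)"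
        "?J as (?x # bs) = [(neg1 ((p - int (length as)) * int (Suc (length bs)) + (q - int (Suc
            (length bs))) * degs as))] \<cdot>\<^bsub>?M\<^esub> g (as, ?w zs bs)"
        for as bs unfolding juxt_term_def by simp_all
      have "juxt A U W p q g f (?x # ys, u) = unshuffle_sum ?M ?J (?x # ys)"
        by (rule juxt_apply[OF W g f _ u]) (use s bracket_homog False in auto)
      also have "\<dots> = ?S (\<lambda>as bs. [(neg1 (?e1 zs as bs))] \<cdot>\<^bsub>?M\<^esub> g (?x # as, ?v bs)) \<oplus>\<^bsub>?M\<^esub>
         ?S (\<lambda>as bs. [(neg1 (?e2 zs as bs))] \<cdot>\<^bsub>?M\<^esub> g (as, ?w zs bs))"
        unfolding unshuffle_sum.simps
      proof (rule arg_cong2[where f = "add ?M"])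
        show "?S (\<lambda>as bs. ?J (?x # as) bs) = ?S (\<lambda>as bs. [(neg1 (?e1 zs as bs))] \<cdot>\<^bsub>?M\<^esub>
            g (?x # as, ?v bs))"
          unfolding J ..
        show "?S (\<lambda>as bs. [(neg1 (int (length as) + fst ?x * degs as))] \<cdot>\<^bsub>?M\<^esub> ?J as (?x # bs)) =
          ?S (\<lambda>as bs. [(neg1 (?e2 zs as bs))] \<cdot>\<^bsub>?M\<^esub> g (as, ?w zs bs))"
          unfolding J by (rule unshuffle_sum_cong) (simp only: neg1_act_act[OF c2])
      qed
      finally have "bracket_term ?M l (p + q) (juxt A U W p q g f) u zs ys =
         [(neg1 (?k zs))] \<cdot>\<^bsub>?M\<^esub> (?S (\<lambda>as bs. [(neg1 (?e1 zs as bs))] \<cdot>\<^bsub>?M\<^esub> g (?x # as, ?v bs)) \<oplus>\<^bsub>?M\<^esub>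
         ?S (\<lambda>as bs. [(neg1 (?e2 zs as bs))] \<cdot>\<^bsub>?M\<^esub> g (as, ?w zs bs)))"
        using False by (simp only: bracket_term_def if_False)
      also have "\<dots> = [(neg1 (?k zs))] \<cdot>\<^bsub>?M\<^esub> ?S (\<lambda>as bs. [(neg1 (?e1 zs as bs))] \<cdot>\<^bsub>?M\<^esub>
          g (?x # as, ?v bs)) \<oplus>\<^bsub>?M\<^esub>
         [(neg1 (?k zs))] \<cdot>\<^bsub>?M\<^esub> ?S (\<lambda>as bs. [(neg1 (?e2 zs as bs))] \<cdot>\<^bsub>?M\<^esub> g (as, ?w zs bs))"
        by (intro int_mult_add unshuffle_sum_closed add.int_pow_closed c1 c2)
      also have "[(neg1 (?k zs))] \<cdot>\<^bsub>?M\<^esub> ?S (\<lambda>as bs. [(neg1 (?e1 zs as bs))] \<cdot>\<^bsub>?M\<^esub>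
          g (?x # as, ?v bs)) =
          ?S (\<lambda>as bs. [(neg1 (?k zs))] \<cdot>\<^bsub>?M\<^esub> ([(neg1 (?e1 zs as bs))] \<cdot>\<^bsub>?M\<^esub> g (?x # as, ?v bs)))"
        by (rule unshuffle_sum_int_mult[symmetric]) (intro add.int_pow_closed c1)
      also have "\<dots> = ?S (\<lambda>as bs. ?G1 zs as bs)"
        by (rule unshuffle_sum_cong) (simp only: neg1_act_act[OF c1] False if_False)
      also have "[(neg1 (?k zs))] \<cdot>\<^bsub>?M\<^esub> ?S (\<lambda>as bs. [(neg1 (?e2 zs as bs))] \<cdot>\<^bsub>?M\<^esub>
          g (as, ?w zs bs)) =
          ?S (\<lambda>as bs. [(neg1 (?k zs))] \<cdot>\<^bsub>?M\<^esub> ([(neg1 (?e2 zs as bs))] \<cdot>\<^bsub>?M\<^esub> g (as, ?w zs bs)))"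
        by (rule unshuffle_sum_int_mult[symmetric]) (intro add.int_pow_closed c2)
      also have "\<dots> = ?S (\<lambda>as bs. ?G2 zs as bs)"
        by (rule unshuffle_sum_cong) (simp only: neg1_act_act[OF c2] False if_False)
      finally show ?thesis .
    qed
  qed
  also have "\<dots> = unshuffle_sum ?M (\<lambda>zs ys. unshuffle_sum ?M (\<lambda>as bs. ?G1 zs as bs) ys) xs \<oplus>\<^bsub>?M\<^esub>
     unshuffle_sum ?M (\<lambda>zs ys. unshuffle_sum ?M (\<lambda>as bs. ?G2 zs as bs) ys) xs"
  proof (rule unshuffle_sum_add)
    fix zs ys assume m: "mset zs + mset ys = mset xs"
    have m3: "mset zs + mset as + mset bs = mset xs" if "mset as + mset bs = mset ys" for as bs
      using that m by (simp add: add.assoc)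
    show "unshuffle_sum ?M (\<lambda>as bs. ?G1 zs as bs) ys \<in> carrier ?M"
      by (rule unshuffle_sum_closed) (rule G1[OF m3])
    show "unshuffle_sum ?M (\<lambda>as bs. ?G2 zs as bs) ys \<in> carrier ?M"
      by (rule unshuffle_sum_closed) (rule G2[OF m3])
  qed
  also have "unshuffle_sum ?M (\<lambda>zs ys. unshuffle_sum ?M (\<lambda>as bs. ?G1 zs as bs) ys) xs =
      unshuffle_sum ?M (\<lambda>ws bs. unshuffle_sum ?M (\<lambda>zs as. ?G1 zs as bs) ws) xs"
    by (rule unshuffle_sum_coassoc[symmetric]) (rule G1)
  also have "\<dots> = unshuffle_sum ?M (juxt_term ?M (p + 1) q (ell_action K A l V W p g) f u) xs"
  proof (rule unshuffle_sum_cong)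
    fix ws bs assume m: "mset ws + mset bs = mset xs"
    note s = splits_lists[OF m xs] splits_length[OF m] splits_degs[OF m]
    let ?c = "(p + 1 - int (length ws)) * int (length bs) + (q - int (length bs)) * degs ws"
    have m3: "mset zs + mset as + mset bs = mset xs" if "mset zs + mset as = mset ws" for zs as
      using that m by simp
    have v: "?v bs \<in> homogs V" by (rule juxt_arg_homog[OF f _ u]) (use s in auto)
    have "ell_action K A l V W p g (ws, ?v bs) = unshuffle_sum ?M (bracket_term ?M l p g (?v bs))
        ws"
      by (rule ell_action_apply[OF V W g _ v]) (use s in auto)
    then have "juxt_term ?M (p + 1) q (ell_action K A l V W p g) f u ws bs =
      [(neg1 ?c)] \<cdot>\<^bsub>?M\<^esub> unshuffle_sum ?M (bracket_term ?M l p g (?v bs)) ws"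
      unfolding juxt_term_def by simp
    also have "\<dots> = unshuffle_sum ?M (\<lambda>zs as. [(neg1 ?c)] \<cdot>\<^bsub>?M\<^esub> bracket_term ?M l p g (?v bs) zs
        as) ws"
      by (rule unshuffle_sum_int_mult[symmetric], rule bracket_term_closed[OF W g _ v]) (use s in
          auto)
    also have "\<dots> = unshuffle_sum ?M (\<lambda>zs as. ?G1 zs as bs) ws"
    proof (rule unshuffle_sum_cong)
      fix zs as assume m': "mset zs + mset as = mset ws"
      note s' = splits_length[OF m'] splits_degs[OF m']
      show "[(neg1 ?c)] \<cdot>\<^bsub>?M\<^esub> bracket_term ?M l p g (?v bs) zs as = ?G1 zs as bs"
      proof (cases "zs = []")
        case True
        then show ?thesis by (simp add: bracket_term_def)
      next
        case False
        have "neg1 (?c + ((p - 1) * int (length zs) + 1)) = neg1 (?k zs + ?e1 zs as bs)"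
          by (rule neg1_cong) (simp add: s' algebra_simps)
        then show ?thesis
          using False by (simp only: bracket_term_def if_False neg1_act_act[OF cl1[OF m3[OF m']
              False]])
      qed
    qed
    finally show "unshuffle_sum ?M (\<lambda>zs as. ?G1 zs as bs) ws =
      juxt_term ?M (p + 1) q (ell_action K A l V W p g) f u ws bs" ..
  qed
  also have "\<dots> = ?B (xs, u)"
    by (rule juxt_apply[OF W Dg f xs u, symmetric]) simp
  also have "unshuffle_sum ?M (\<lambda>zs ys. unshuffle_sum ?M (\<lambda>as bs. ?G2 zs as bs) ys) xs =
      unshuffle_sum ?M (\<lambda>ws bs. unshuffle_sum ?M (\<lambda>zs as. ?G2 zs as bs) ws) xs"
    by (rule unshuffle_sum_coassoc[symmetric]) (rule G2)
  also have "\<dots> = unshuffle_sum ?M (\<lambda>ws bs. unshuffle_sum ?M (\<lambda>as zs.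
      [(neg1 (int (length as * length zs) + degs as * degs zs))] \<cdot>\<^bsub>?M\<^esub> ?G2 zs as bs) ws) xs"
  proof (rule unshuffle_sum_cong)
    fix ws bs assume m: "mset ws + mset bs = mset xs"
    show "unshuffle_sum ?M (\<lambda>zs as. ?G2 zs as bs) ws = unshuffle_sum ?M (\<lambda>as zs.
      [(neg1 (int (length as * length zs) + degs as * degs zs))] \<cdot>\<^bsub>?M\<^esub> ?G2 zs as bs) ws"
      by (rule unshuffle_sum_cocomm, rule G2) (use m in simp)
  qed
  also have "\<dots> = unshuffle_sum ?M (\<lambda>as ys. unshuffle_sum ?M (\<lambda>zs bs.
      [(neg1 (int (length as * length zs) + degs as * degs zs))] \<cdot>\<^bsub>?M\<^esub> ?G2 zs as bs) ys) xs"
    by (rule unshuffle_sum_coassoc, rule add.int_pow_closed, rule G2) (simp add: ac_simps)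
  also have "\<dots> = unshuffle_sum ?M (\<lambda>as ys. [(neg1 p)] \<cdot>\<^bsub>?M\<^esub> juxt_term ?M p (q + 1) g (ell_action K
      A l U V q f) u as ys) xs"
  proof (rule unshuffle_sum_cong)
    fix as ys assume m: "mset as + mset ys = mset xs"
    note s = splits_lists[OF m xs] splits_length[OF m] splits_degs[OF m]
    let ?c = "(p - int (length as)) * int (length ys) + (q + 1 - int (length ys)) * degs as"
    let ?n = "q + 1 - int (length ys) + degs ys + fst u"
    have m3: "mset zs + mset as + mset bs = mset xs" if "mset zs + mset bs = mset ys" for zs bs
      using m that[symmetric] by (simp add: ac_simps)
    have lin: "(\<lambda>y. g (as, (?n, y))) \<in> linear_maps K (V ?n) ?M"
      by (rule intertwiner_linear[OF g]) (use s in auto)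
    have bc: "bracket_term (V ?n) l q f u zs bs \<in> carrier (V ?n)" if "mset zs + mset bs = mset ys"
        for zs bs
      by (rule bracket_term_closed[OF V f _ u that]) (use s in auto)
    have "ell_action K A l U V q f (ys, u) = unshuffle_sum (V ?n) (bracket_term (V ?n) l q f u) ys"
      by (rule ell_action_apply[OF U V f _ u]) (use s in auto)
    moreover have "g (as, (?n, unshuffle_sum (V ?n) (bracket_term (V ?n) l q f u) ys)) =
        unshuffle_sum ?M (\<lambda>zs bs. g (as, (?n, bracket_term (V ?n) l q f u zs bs))) ys"
      by (rule unshuffle_sum_hom[where h = "\<lambda>y. g (as, (?n, y))",
            OF graded_abelian_group[OF V] abelian_group_axioms _ linear_mapsD(2)[OF lin] bc])
        (auto intro: linear_mapsD(1)[OF lin])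
    ultimately have "[(neg1 p)] \<cdot>\<^bsub>?M\<^esub> juxt_term ?M p (q + 1) g (ell_action K A l U V q f) u as ys =
       [(neg1 p)] \<cdot>\<^bsub>?M\<^esub> ([(neg1 ?c)] \<cdot>\<^bsub>?M\<^esub> unshuffle_sum ?M (\<lambda>zs bs. g (as, (?n, bracket_term (V
           ?n) l q f u zs bs))) ys)"
      unfolding juxt_term_def by simp
    also have "\<dots> = [(neg1 (p + ?c))] \<cdot>\<^bsub>?M\<^esub> unshuffle_sum ?M (\<lambda>zs bs. g (as, (?n, bracket_term (V
        ?n) l q f u zs bs))) ys"
      by (rule neg1_act_act, rule unshuffle_sum_closed, rule linear_mapsD(1)[OF lin bc])
    also have "\<dots> = unshuffle_sum ?M (\<lambda>zs bs. [(neg1 (p + ?c))] \<cdot>\<^bsub>?M\<^esub> g (as, (?n, bracket_term (V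
        ?n) l q f u zs bs))) ys"
      by (rule unshuffle_sum_int_mult[symmetric], rule linear_mapsD(1)[OF lin bc])
    also have "\<dots> = unshuffle_sum ?M (\<lambda>zs bs.
      [(neg1 (int (length as * length zs) + degs as * degs zs))] \<cdot>\<^bsub>?M\<^esub> ?G2 zs as bs) ys"
    proof (rule unshuffle_sum_cong)
      fix zs bs assume m': "mset zs + mset bs = mset ys"
      note s' = splits_lists[OF m', of "homogs A"] splits_length[OF m'] splits_degs[OF m']
      show "[(neg1 (p + ?c))] \<cdot>\<^bsub>?M\<^esub> g (as, (?n, bracket_term (V ?n) l q f u zs bs)) =
        [(neg1 (int (length as * length zs) + degs as * degs zs))] \<cdot>\<^bsub>?M\<^esub> ?G2 zs as bs"
      proof (cases "zs = []")
        case True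
        then show ?thesis
          using linear_maps_zero_value[OF lin graded_module[OF V] graded_module[OF W]]
          by (simp add: bracket_term_def)
      next
        case False
        have n: "q - int (Suc (length bs)) + (fst (bracket l zs) + degs bs) + fst u = ?n"
          using s' by simp
        note c2 = cl2[OF m3[OF m'] False, unfolded n]
        have "g (as, (?n, bracket_term (V ?n) l q f u zs bs)) =
          [(neg1 ((q - 1) * int (length zs) + 1))] \<cdot>\<^bsub>?M\<^esub> g (as, (?n, f (bracket l zs # bs, u)))"
          unfolding bracket_term_def using False
          by (simp only: if_False)
            (rule linear_maps_int_mult_commute[OF lin graded_module[OF V] graded_module[OF W]],
              rule bracket_value_closed[OF f _ _ False u], use s s' in auto)
        moreover have "neg1 (p + ?c + ((q - 1) * int (length zs) + 1)) =
           neg1 (int (length as * length zs) + degs as * degs zs + (?k zs + ?e2 zs as bs))"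
          by (rule neg1_cong) (simp add: s' algebra_simps)
        ultimately show ?thesis
          using False by (simp only: n if_False neg1_act_act[OF c2])
      qed
    qed
    finally show "unshuffle_sum ?M (\<lambda>zs bs.
      [(neg1 (int (length as * length zs) + degs as * degs zs))] \<cdot>\<^bsub>?M\<^esub> ?G2 zs as bs) ys =
      [(neg1 p)] \<cdot>\<^bsub>?M\<^esub> juxt_term ?M p (q + 1) g (ell_action K A l U V q f) u as ys" ..
  qed
  also have "\<dots> = [(neg1 p)] \<cdot>\<^bsub>?M\<^esub> unshuffle_sum ?M (juxt_term ?M p (q + 1) g (ell_action K A l U V
      q f) u) xs"
  proof (rule unshuffle_sum_int_mult)
    fix as ys assume m: "mset as + mset ys = mset xs"
    note s = splits_lists[OF m xs] splits_length[OF m] splits_degs[OF m]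
    show "juxt_term ?M p (q + 1) g (ell_action K A l U V q f) u as ys \<in> carrier ?M"
      unfolding juxt_term_def
      by (rule add.int_pow_closed, rule juxt_value_closed[OF g Df _ _ u]) (use s in auto)
  qed
  also have "unshuffle_sum ?M (juxt_term ?M p (q + 1) g (ell_action K A l U V q f) u) xs =
      ?C (xs, u)"
    by (rule juxt_apply[OF W g Df xs u, symmetric]) simp
  also have "[(neg1 p)] \<cdot>\<^bsub>?M\<^esub> ?C (xs, u) = ([(neg1 p)] \<cdot>\<^bsub>?H\<^esub> ?C) (xs, u)"
    by (rule linear_maps_int_mult_commute[symmetric, OF intertwiner_eval_linear[OF graded_lie W xs
        u refl]
          itw_space_module[OF graded_lie U W] graded_module[OF W]])
      (use juxt_intertwiner[OF graded_lie U V W g Df] in \<open>simp add: itw_space_simps add.assoc\<close>)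
  also have "?B (xs, u) \<oplus>\<^bsub>?M\<^esub> ([(neg1 p)] \<cdot>\<^bsub>?H\<^esub> ?C) (xs, u) = (?B \<oplus>\<^bsub>?H\<^esub> ([(neg1 p)] \<cdot>\<^bsub>?H\<^esub>
      ?C)) (xs, u)"
    using xs u by (simp add: itw_space_simps itw_dom_iff itw_target_eqI[OF refl])
  finally show "?L (xs, u) = (?B \<oplus>\<^bsub>?H\<^esub> ([(neg1 p)] \<cdot>\<^bsub>?H\<^esub> ?C)) (xs, u)" .
qed

end

text \<open>
  The characteristic enters here: in the cancellation of disjoint brackets, a sum is only seen to be
  its own negative.
\<close>

lemma eq_minus_self_imp_zero:
  assumes "field K" and two: "\<one>\<^bsub>K\<^esub> \<oplus>\<^bsub>K\<^esub> \<one>\<^bsub>K\<^esub> \<noteq> \<zero>\<^bsub>K\<^esub>"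
    and M: "module K M" and x: "x \<in> carrier M" and eq: "x = \<ominus>\<^bsub>M\<^esub> x"
  shows "x = \<zero>\<^bsub>M\<^esub>"
proof -
  interpret K: field K by fact
  interpret M: module K M by fact
  let ?two = "\<one>\<^bsub>K\<^esub> \<oplus>\<^bsub>K\<^esub> \<one>\<^bsub>K\<^esub>"
  have two: "?two \<in> Units K"
    using two by (simp add: K.field_Units)
  have "?two \<odot>\<^bsub>M\<^esub> x = x \<oplus>\<^bsub>M\<^esub> x"
    using x by (simp add: M.smult_l_distr)
  also have "\<dots> = x \<oplus>\<^bsub>M\<^esub> (\<ominus>\<^bsub>M\<^esub> x)"
    using eq by simp
  also have "\<dots> = \<zero>\<^bsub>M\<^esub>"
    using x by (rule M.M.r_neg)
  finally have "?two \<odot>\<^bsub>M\<^esub> x = \<zero>\<^bsub>M\<^esub>" .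
  then have "inv\<^bsub>K\<^esub> ?two \<odot>\<^bsub>M\<^esub> (?two \<odot>\<^bsub>M\<^esub> x) = \<zero>\<^bsub>M\<^esub>"
    using two by simp
  then show ?thesis
    using two x by (simp add: M.smult_assoc1[symmetric])
qed

context homotopy_lie
begin

text \<open>
  The second bracket either contains the first one, and the sum of these terms vanishes by the
  homotopy Jacobi identity, or it is disjoint from it.  In the second case exchanging the two
  bracketed sublists reverses the sign of a term, so that the sum is its own negative.
\<close>

lemma ell_action_square:
  assumes two: "\<one>\<^bsub>K\<^esub> \<oplus>\<^bsub>K\<^esub> \<one>\<^bsub>K\<^esub> \<noteq> \<zero>\<^bsub>K\<^esub>"
    and U: "graded_vector_space K U" and V: "graded_vector_space K V"
    and f: "f \<in> intertwiners K A U V n"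
  shows "ell_action K A l U V (n + 1) (ell_action K A l U V n f) = \<zero>\<^bsub>itw_space K A U V (n + 1 + 1)\<^esub>"
proof (rule intertwiner_eqI[OF ell_action_extensional])
  show "\<zero>\<^bsub>itw_space K A U V (n + 1 + 1)\<^esub> \<in> extensional (itw_dom A U)" by (simp add: itw_space_simps)
  note Df = ell_action_intertwiner[OF U V f]
  have K: "field K" using U by (simp add: graded_vector_space_def)
  fix xs u assume xs: "xs \<in> lists (homogs A)" and u: "u \<in> homogs U"
  let ?d = "degs xs + fst u + n + 2 - int (length xs)"
  let ?M = "V ?d"
  interpret abelian_group ?M by (rule graded_abelian_group[OF V])
  let ?L = "bracket l"
  (* Nested brackets make up ?H1, disjoint ones ?H2.  The first bracket formed is that of zs,
     and ?e2 includes the sign of moving it past zs'. *)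
  let ?k = "\<lambda>zs. n * int (length zs) + 1"
  let ?e1 = "\<lambda>zs'. (n - 1) * int (Suc (length zs')) + 1"
  let ?e2 = "\<lambda>zs zs'. int (length zs') + fst (?L zs) * degs zs' + ((n - 1) * int (length zs') + 1)"
  let ?H1 = "\<lambda>zs zs' ys. if zs = [] then \<zero>\<^bsub>?M\<^esub> else
     [(neg1 (?k zs + ?e1 zs'))] \<cdot>\<^bsub>?M\<^esub> f (?L (?L zs # zs') # ys, u)"
  let ?H2 = "\<lambda>zs zs' ys. if zs = [] \<or> zs' = [] then \<zero>\<^bsub>?M\<^esub> else
     [(neg1 (?k zs + ?e2 zs zs'))] \<cdot>\<^bsub>?M\<^esub> f (?L zs' # ?L zs # ys, u)"
  have dist: "zs \<in> lists (homogs A) \<and> zs' \<in> lists (homogs A) \<and> ys \<in> lists (homogs A) \<and>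
      length xs = length zs + length zs' + length ys \<and> degs xs = degs zs + degs zs' + degs ys"
    if m: "mset zs + mset zs' + mset ys = mset xs" for zs zs' ys
  proof -
    have 1: "mset (zs @ zs') + mset ys = mset xs" using m by simp
    show ?thesis
      using splits_lists[OF 1 xs] splits_length[OF 1] splits_degs[OF 1] by simp
  qed
  have cl1: "f (?L (?L zs # zs') # ys, u) \<in> carrier ?M"
    if m: "mset zs + mset zs' + mset ys = mset xs" and z: "zs \<noteq> []" for zs zs' ys
    by (rule intertwiner_closed[OF f _ u]) (use dist[OF m] bracket_homog[OF _ z] bracket_homog[of
        "?L zs # zs'"] in auto)
  have cl2: "f (?L zs' # ?L zs # ys, u) \<in> carrier ?M"
    if m: "mset zs + mset zs' + mset ys = mset xs" and z: "zs \<noteq> []" "zs' \<noteq> []" for zs zs' ys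
    by (rule intertwiner_closed[OF f _ u]) (use dist[OF m] bracket_homog z in auto)
  have H1: "?H1 zs zs' ys \<in> carrier ?M" and H2: "?H2 zs zs' ys \<in> carrier ?M"
    if m: "mset zs + mset zs' + mset ys = mset xs" for zs zs' ys
    using cl1[OF m] cl2[OF m] by auto
  have "ell_action K A l U V (n + 1) (ell_action K A l U V n f) (xs, u) =
      unshuffle_sum ?M (bracket_term ?M l (n + 1) (ell_action K A l U V n f) u) xs"
    by (rule ell_action_apply[OF U V Df xs u]) simp
  also have "\<dots> = unshuffle_sum ?M (\<lambda>zs ws. unshuffle_sum ?M (\<lambda>zs' ys. ?H1 zs zs' ys) ws \<oplus>\<^bsub>?M\<^esub>
      unshuffle_sum ?M (\<lambda>zs' ys. ?H2 zs zs' ys) ws) xs"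
  proof (rule unshuffle_sum_cong)
    fix zs ws assume m: "mset zs + mset ws = mset xs"
    note s = splits_lists[OF m xs] splits_length[OF m] splits_degs[OF m]
    show "bracket_term ?M l (n + 1) (ell_action K A l U V n f) u zs ws =
       unshuffle_sum ?M (\<lambda>zs' ys. ?H1 zs zs' ys) ws \<oplus>\<^bsub>?M\<^esub> unshuffle_sum ?M (\<lambda>zs' ys. ?H2 zs zs'
           ys) ws"
    proof (cases "zs = []")
      case True
      then show ?thesis by (simp add: bracket_term_def unshuffle_sum_zero)
    next
      case False
      let ?S = "\<lambda>F. unshuffle_sum ?M F ws"
      let ?J = "bracket_term ?M l n f u"
      let ?J1 = "\<lambda>zs' ys. [(neg1 (?e1 zs'))] \<cdot>\<^bsub>?M\<^esub> f (?L (?L zs # zs') # ys, u)"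
      let ?J2 = "\<lambda>zs' ys. if zs' = [] then \<zero>\<^bsub>?M\<^esub> else [(neg1 (?e2 zs zs'))] \<cdot>\<^bsub>?M\<^esub>
          f (?L zs' # ?L zs # ys, u)"
      have m3: "mset zs + mset zs' + mset ys = mset xs" if "mset zs' + mset ys = mset ws" for zs' ys
        using that m by (simp add: add.assoc)
      note c1 = cl1[OF m3 False] and c2 = cl2[OF m3 False]
      have cJ2: "?J2 zs' ys \<in> carrier ?M" if "mset zs' + mset ys = mset ws" for zs' ys
        using c2[OF that] by simp
      have "ell_action K A l U V n f (?L zs # ws, u) = unshuffle_sum ?M ?J (?L zs # ws)"
        by (rule ell_action_apply[OF U V f _ u]) (use s bracket_homog False in auto)
      also have "\<dots> = ?S ?J1 \<oplus>\<^bsub>?M\<^esub> ?S ?J2"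
        unfolding unshuffle_sum.simps
      proof (rule arg_cong2[where f = "add ?M"])
        show "?S (\<lambda>zs' ys. ?J (?L zs # zs') ys) = ?S ?J1"
          unfolding bracket_term_def by simp
        show "?S (\<lambda>zs' ys. [(neg1 (int (length zs') + fst (?L zs) * degs zs'))] \<cdot>\<^bsub>?M\<^esub>
            ?J zs' (?L zs # ys)) = ?S ?J2"
        proof (rule unshuffle_sum_cong)
          fix zs' ys assume m': "mset zs' + mset ys = mset ws"
          show "[(neg1 (int (length zs') + fst (?L zs) * degs zs'))] \<cdot>\<^bsub>?M\<^esub> ?J zs' (?L zs # ys) =
              ?J2 zs' ys"
          proof (cases "zs' = []")
            case True
            then show ?thesis by (simp add: bracket_term_def)
          next
            case False
            then show ?thesis by (simp only: bracket_term_def if_False neg1_act_act[OF c2[OF m'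
                False]])
          qed
        qed
      qed
      finally have "bracket_term ?M l (n + 1) (ell_action K A l U V n f) u zs ws =
         [(neg1 (?k zs))] \<cdot>\<^bsub>?M\<^esub> (?S ?J1 \<oplus>\<^bsub>?M\<^esub> ?S ?J2)"
        using False by (simp add: bracket_term_def)
      also have "\<dots> = [(neg1 (?k zs))] \<cdot>\<^bsub>?M\<^esub> ?S ?J1 \<oplus>\<^bsub>?M\<^esub> [(neg1 (?k zs))] \<cdot>\<^bsub>?M\<^esub> ?S ?J2"
        by (intro int_mult_add unshuffle_sum_closed add.int_pow_closed c1 cJ2)
      also have "[(neg1 (?k zs))] \<cdot>\<^bsub>?M\<^esub> ?S ?J1 = ?S (\<lambda>zs' ys. [(neg1 (?k zs))] \<cdot>\<^bsub>?M\<^esub> ?J1 zs' ys)"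
        by (rule unshuffle_sum_int_mult[symmetric]) (intro add.int_pow_closed c1)
      also have "\<dots> = ?S (\<lambda>zs' ys. ?H1 zs zs' ys)"
        by (rule unshuffle_sum_cong) (simp only: neg1_act_act[OF c1] False if_False)
      also have "[(neg1 (?k zs))] \<cdot>\<^bsub>?M\<^esub> ?S ?J2 = ?S (\<lambda>zs' ys. [(neg1 (?k zs))] \<cdot>\<^bsub>?M\<^esub> ?J2 zs' ys)"
        by (rule unshuffle_sum_int_mult[symmetric]) (rule cJ2)
      also have "\<dots> = ?S (\<lambda>zs' ys. ?H2 zs zs' ys)"
      proof (rule unshuffle_sum_cong)
        fix zs' ys assume m': "mset zs' + mset ys = mset ws"
        show "[(neg1 (?k zs))] \<cdot>\<^bsub>?M\<^esub> ?J2 zs' ys = ?H2 zs zs' ys"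
        proof (cases "zs' = []")
          case True
          then show ?thesis by simp
        next
          case z: False
          then show ?thesis using False by (simp only: neg1_act_act[OF c2[OF m' z]] if_False
              simp_thms)
        qed
      qed
      finally show ?thesis .
    qed
  qed
  also have "\<dots> = unshuffle_sum ?M (\<lambda>zs ws. unshuffle_sum ?M (\<lambda>zs' ys. ?H1 zs zs' ys) ws) xs \<oplus>\<^bsub>?M\<^esub>
     unshuffle_sum ?M (\<lambda>zs ws. unshuffle_sum ?M (\<lambda>zs' ys. ?H2 zs zs' ys) ws) xs"
  proof (rule unshuffle_sum_add)
    fix zs ws assume m: "mset zs + mset ws = mset xs"
    have m3: "mset zs + mset zs' + mset ys = mset xs" if "mset zs' + mset ys = mset ws" for zs' ys
      using that m by (simp add: add.assoc)
    show "unshuffle_sum ?M (\<lambda>zs' ys. ?H1 zs zs' ys) ws \<in> carrier ?M"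
      by (rule unshuffle_sum_closed) (rule H1[OF m3])
    show "unshuffle_sum ?M (\<lambda>zs' ys. ?H2 zs zs' ys) ws \<in> carrier ?M"
      by (rule unshuffle_sum_closed) (rule H2[OF m3])
  qed
  also have "unshuffle_sum ?M (\<lambda>zs ws. unshuffle_sum ?M (\<lambda>zs' ys. ?H1 zs zs' ys) ws) xs =
      unshuffle_sum ?M (\<lambda>ws ys. unshuffle_sum ?M (\<lambda>zs zs'. ?H1 zs zs' ys) ws) xs"
    by (rule unshuffle_sum_coassoc[symmetric]) (rule H1)
  also have "\<dots> = unshuffle_sum ?M (\<lambda>ws ys. \<zero>\<^bsub>?M\<^esub>) xs"
  proof (rule unshuffle_sum_cong)
    fix ws ys assume m: "mset ws + mset ys = mset xs"
    note s = splits_lists[OF m xs] splits_length[OF m] splits_degs[OF m]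
    let ?m = "degs ws + 3 - int (length ws)"
    let ?N = "A ?m"
    let ?\<phi> = "\<lambda>y. f ((?m, y) # ys, u)"
    let ?c = "n * int (length ws) + n + 1"
    let ?R = "\<lambda>zs zs'. if zs = [] then \<zero>\<^bsub>?N\<^esub> else [(neg1 (int (length zs')))] \<cdot>\<^bsub>?N\<^esub> l (?L zs # zs')"
    interpret N: abelian_group ?N by (rule graded_abelian_group[OF graded_lie])
    have m3: "mset zs + mset zs' + mset ys = mset xs" if "mset zs + mset zs' = mset ws" for zs zs'
      using that m by simp
    have "(\<lambda>y. f ([] @ (?m, y) # ys, u)) \<in> linear_maps K ?N (shift V (n - int (Suc (length ys)) +
        fst u) (?m + degs ys))"
      by (rule skew_multilinear_slot[OF intertwiner_skew[OF f u refl]]) (use s in auto)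
    moreover have "shift V (n - int (Suc (length ys)) + fst u) (?m + degs ys) = ?M"
      unfolding shift_def by (rule arg_cong[of _ _ V]) (use s in simp)
    ultimately have \<phi>: "?\<phi> \<in> linear_maps K ?N ?M" by simp
    have lc: "l (?L zs # zs') \<in> carrier ?N" if "mset zs + mset zs' = mset ws" "zs \<noteq> []" for zs zs'
    proof -
      note s' = splits_lists[OF that(1)] splits_length[OF that(1)] splits_degs[OF that(1)]
      have "?L (?L zs # zs') \<in> homogs A"
        by (rule bracket_homog) (use s s' bracket_homog that(2) in auto)
      then have "l (?L zs # zs') \<in> carrier (A (fst (?L (?L zs # zs'))))"
        by (simp only: homogs_iff bracket_def snd_conv fst_conv)
      moreover have "fst (?L (?L zs # zs')) = ?m" using s' by simp
      ultimately show ?thesis by metis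
    qed
    have R: "?R zs zs' \<in> carrier ?N" if "mset zs + mset zs' = mset ws" for zs zs'
      using lc[OF that] by simp
    have "unshuffle_sum ?M (\<lambda>zs zs'. ?H1 zs zs' ys) ws = unshuffle_sum ?M (\<lambda>zs zs'. [(neg1 ?c)]
        \<cdot>\<^bsub>?M\<^esub> ?\<phi> (?R zs zs')) ws"
    proof (rule unshuffle_sum_cong)
      fix zs zs' assume m': "mset zs + mset zs' = mset ws"
      note s' = splits_length[OF m'] splits_degs[OF m']
      show "?H1 zs zs' ys = [(neg1 ?c)] \<cdot>\<^bsub>?M\<^esub> ?\<phi> (?R zs zs')"
      proof (cases "zs = []")
        case True
        then show ?thesis
          using linear_maps_zero_value[OF \<phi> graded_module[OF graded_lie] graded_module[OF V]]
              by simp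
      next
        case False
        have L: "?L (?L zs # zs') = (?m, l (?L zs # zs'))"
          using s' by (simp add: bracket_def)
        have "?\<phi> (?R zs zs') = [(neg1 (int (length zs')))] \<cdot>\<^bsub>?M\<^esub> ?\<phi> (l (?L zs # zs'))"
          using False linear_maps_int_mult_commute[OF \<phi> graded_module[OF graded_lie]
              graded_module[OF V] lc[OF m' False]]
          by simp
        moreover have "neg1 (?c + int (length zs')) = neg1 (?k zs + ?e1 zs')"
          by (rule neg1_cong) (simp add: s' algebra_simps)
        ultimately show ?thesis
          using False by (simp only: L if_False neg1_act_act[OF cl1[OF m3[OF m'] False, unfolded
              L]])
      qed
    qed
    also have "\<dots> = [(neg1 ?c)] \<cdot>\<^bsub>?M\<^esub> unshuffle_sum ?M (\<lambda>zs zs'. ?\<phi> (?R zs zs')) ws"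
      by (rule unshuffle_sum_int_mult) (rule linear_mapsD(1)[OF \<phi> R])
    also have "unshuffle_sum ?M (\<lambda>zs zs'. ?\<phi> (?R zs zs')) ws = ?\<phi> (unshuffle_sum ?N ?R ws)"
      by (rule unshuffle_sum_hom[where h = ?\<phi>, symmetric,
            OF graded_abelian_group[OF graded_lie] abelian_group_axioms _ linear_mapsD(2)[OF \<phi>] R])
        (auto intro: linear_mapsD(1)[OF \<phi>])
    also have "unshuffle_sum ?N ?R ws = \<zero>\<^bsub>?N\<^esub>"
      by (rule homotopy_jacobi) (use s in auto)
    also have "?\<phi> \<zero>\<^bsub>?N\<^esub> = \<zero>\<^bsub>?M\<^esub>"
      by (rule linear_maps_zero_value[OF \<phi> graded_module[OF graded_lie] graded_module[OF V]])
    finally show "unshuffle_sum ?M (\<lambda>zs zs'. ?H1 zs zs' ys) ws = \<zero>\<^bsub>?M\<^esub>"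
      by simp
  qed
  also have "\<dots> = \<zero>\<^bsub>?M\<^esub>" by (rule unshuffle_sum_zero)
  also have "unshuffle_sum ?M (\<lambda>zs ws. unshuffle_sum ?M (\<lambda>zs' ys. ?H2 zs zs' ys) ws) xs =
      unshuffle_sum ?M (\<lambda>ws ys. unshuffle_sum ?M (\<lambda>zs zs'. ?H2 zs zs' ys) ws) xs"
    by (rule unshuffle_sum_coassoc[symmetric]) (rule H2)
  also have "\<dots> = unshuffle_sum ?M (\<lambda>ws ys. \<zero>\<^bsub>?M\<^esub>) xs"
  proof (rule unshuffle_sum_cong)
    fix ws ys assume m: "mset ws + mset ys = mset xs"
    let ?Y = "unshuffle_sum ?M (\<lambda>zs zs'. ?H2 zs zs' ys) ws"
    have m3: "mset zs + mset zs' + mset ys = mset xs" if "mset zs + mset zs' = mset ws" for zs zs'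
      using that m by simp
    have m3': "mset zs' + mset zs + mset ys = mset xs" if "mset zs + mset zs' = mset ws" for zs zs'
      using m that[symmetric] by (simp add: ac_simps)
    note h2 = H2[OF m3] and h2' = H2[OF m3']
    have Y: "?Y \<in> carrier ?M" by (rule unshuffle_sum_closed) (rule h2)
    have "?Y = unshuffle_sum ?M (\<lambda>zs zs'. [(neg1 (int (length zs * length zs') + degs zs * degs
        zs'))] \<cdot>\<^bsub>?M\<^esub> ?H2 zs' zs ys) ws"
      by (rule unshuffle_sum_cocomm) (rule h2)
    also have "\<dots> = unshuffle_sum ?M (\<lambda>zs zs'. [(neg1 1)] \<cdot>\<^bsub>?M\<^esub> ?H2 zs zs' ys) ws"
    proof (rule unshuffle_sum_cong)
      fix zs zs' assume m': "mset zs + mset zs' = mset ws"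
      show "[(neg1 (int (length zs * length zs') + degs zs * degs zs'))] \<cdot>\<^bsub>?M\<^esub> ?H2 zs' zs ys =
          [(neg1 1)] \<cdot>\<^bsub>?M\<^esub> ?H2 zs zs' ys"
      proof (cases "zs = [] \<or> zs' = []")
        case True
        then have "?H2 zs' zs ys = \<zero>\<^bsub>?M\<^esub>" "?H2 zs zs' ys = \<zero>\<^bsub>?M\<^esub>" by auto
        then show ?thesis by (simp only: int_mult_zero)
      next
        case False
        then have z: "zs \<noteq> []" "zs' \<noteq> []" by auto
        note s = dist[OF m3[OF m']]
        have "f ([] @ ?L zs # ?L zs' # ys, u) = [(- neg1 (fst (?L zs) * fst (?L zs')))] \<cdot>\<^bsub>shift V
            (n - int (Suc (Suc (length ys))) + fst u)
            (fst (?L zs) + fst (?L zs') + degs ys)\<^esub> f ([] @ ?L zs' # ?L zs # ys, u)"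
          by (rule skew_multilinear_swap[OF intertwiner_skew[OF f u refl]]) (use s bracket_homog z
              in auto)
        moreover have "shift V (n - int (Suc (Suc (length ys))) + fst u) (fst (?L zs) + fst (?L
            zs') + degs ys) = ?M"
          unfolding shift_def by (rule arg_cong[of _ _ V]) (use s in simp)
        ultimately have sw: "f (?L zs # ?L zs' # ys, u) = [(neg1 (fst (?L zs) * fst (?L zs') +
            1))] \<cdot>\<^bsub>?M\<^esub> f (?L zs' # ?L zs # ys, u)"
          by (simp add: minus_neg1)
        note c = cl2[OF m3[OF m'] z]
        have "neg1 (int (length zs * length zs') + degs zs * degs zs' + (?k zs' + ?e2 zs' zs +
            (fst (?L zs) * fst (?L zs') + 1))) =
          neg1 (1 + (?k zs + ?e2 zs zs'))"
          by (rule neg1_cong) (simp add: algebra_simps)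
        then show ?thesis
          using z by (simp only: sw neg1_act_act[OF c] if_False simp_thms)
      qed
    qed
    also have "\<dots> = [(neg1 1)] \<cdot>\<^bsub>?M\<^esub> ?Y" by (rule unshuffle_sum_int_mult) (rule h2)
    also have "\<dots> = \<ominus>\<^bsub>?M\<^esub> ?Y" using Y by (rule neg1_act_odd) simp
    finally have "?Y = \<ominus>\<^bsub>?M\<^esub> ?Y" .
    then show "?Y = \<zero>\<^bsub>?M\<^esub>"
      by (rule eq_minus_self_imp_zero[OF K two graded_module[OF V] Y])
  qed
  also have "\<dots> = \<zero>\<^bsub>?M\<^esub>" by (rule unshuffle_sum_zero)
  also have "\<zero>\<^bsub>?M\<^esub> \<oplus>\<^bsub>?M\<^esub> \<zero>\<^bsub>?M\<^esub> = \<zero>\<^bsub>?M\<^esub>" by simp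
  also have "?M = itw_target V (n + 1 + 1) xs (fst u)" by (rule itw_target_eqI[symmetric]) simp
  finally show "ell_action K A l U V (n + 1) (ell_action K A l U V n f) (xs, u) =
      \<zero>\<^bsub>itw_space K A U V (n + 1 + 1)\<^esub> (xs, u)"
    using xs u by (simp add: itw_space_simps itw_dom_iff)
qed

end

section \<open>The differential\<close>

context abelian_group
begin

text \<open>
  These rewrite every expression in sums and differences to a single difference of sums; equations
  between such differences then follow by \<open>minus_eq_minusI\<close> and commutativity.
\<close>

lemma minus_add_minus:
  assumes "a \<in> carrier G" "b \<in> carrier G" "c \<in> carrier G"
  shows "a \<ominus> b \<ominus> c = a \<ominus> (b \<oplus> c)" and "a \<ominus> (b \<ominus> c) = a \<oplus> c \<ominus> b"
    and "a \<oplus> (b \<ominus> c) = a \<oplus> b \<ominus> c" and "a \<ominus> b \<oplus> c = a \<oplus> c \<ominus> b"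
    and "\<ominus> (a \<ominus> b) = b \<ominus> a" and "a \<oplus> \<ominus> b = a \<ominus> b" and "a \<ominus> \<ominus> b = a \<oplus> b" and "a \<ominus> \<zero> = a"
  using assms by (simp_all add: a_minus_def minus_add a_ac)

lemma minus_eq_minusI:
  assumes "a \<oplus> d = c \<oplus> b" "a \<in> carrier G" "b \<in> carrier G" "c \<in> carrier G" "d \<in> carrier G"
  shows "a \<ominus> b = c \<ominus> d"
proof -
  have cancel: "(x \<ominus> y) \<oplus> (y \<oplus> z) = x \<oplus> z"
    if "x \<in> carrier G" "y \<in> carrier G" "z \<in> carrier G" for x y z
    using that by (simp add: a_minus_def a_assoc r_neg1)
  have "(a \<ominus> b) \<oplus> (b \<oplus> d) = (c \<ominus> d) \<oplus> (d \<oplus> b)"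
    using assms by (simp add: cancel)
  then have "(a \<ominus> b) \<oplus> (b \<oplus> d) = (c \<ominus> d) \<oplus> (b \<oplus> d)"
    using assms(2-) by (simp add: a_comm[of d b])
  then show ?thesis
    using assms(2-) by (simp add: add.right_cancel)
qed

lemma minus_eq_zeroI: "a = b \<Longrightarrow> b \<in> carrier G \<Longrightarrow> a \<ominus> b = \<zero>"
  by (simp add: a_minus_def r_neg)

lemma int_mult_minus:
  "x \<in> carrier G \<Longrightarrow> y \<in> carrier G \<Longrightarrow> [(k::int)] \<cdot> (x \<ominus> y) = [k] \<cdot> x \<ominus> [k] \<cdot> y"
  by (simp add: a_minus_def int_mult_add add.int_pow_inv)

lemma neg1_act_Suc: "x \<in> carrier G \<Longrightarrow> [(neg1 (n + 1))] \<cdot> x = \<ominus> ([(neg1 n)] \<cdot> x)"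
  by (simp add: neg1_def add.int_pow_neg)

text \<open>
  The square of the differential at \<open>f\<close>.  Here \<open>P\<close>, \<open>Q\<close>, \<open>R\<close>, \<open>S\<close>, \<open>T\<close> stand for \<open>\<rho>(\<rho>f)\<close>, \<open>\<rho>(f\<rho>)\<close>,
  \<open>\<rho>(\<delta>f)\<close>, \<open>(\<delta>f)\<rho>\<close>, \<open>(f\<rho>)\<rho>\<close>; the last group of terms is \<open>\<delta>\<close> of the differential, where \<open>P\<close> and
  \<open>T\<close> occur as \<open>(\<delta>\<rho>)f\<close> and \<open>f(\<delta>\<rho>)\<close> because \<open>\<rho>\<rho> = \<delta>\<rho>\<close>.
\<close>

lemma differential_square_identity:
  assumes "P \<in> carrier G" "Q \<in> carrier G" "R \<in> carrier G" "S \<in> carrier G" "T \<in> carrier G"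
  shows "(P \<ominus> [(neg1 n)] \<cdot> Q \<ominus> R) \<ominus> [(neg1 (n + 1))] \<cdot> (Q \<ominus> [(neg1 n)] \<cdot> T \<ominus> S) \<ominus>
    ((P \<oplus> [(neg1 1)] \<cdot> R) \<ominus> [(neg1 n)] \<cdot> (S \<oplus> [(neg1 n)] \<cdot> T) \<ominus> \<zero>) = \<zero>"
proof -
  let ?Q = "[(neg1 n)] \<cdot> Q" and ?S = "[(neg1 n)] \<cdot> S"
  have 1: "[(neg1 (n + 1))] \<cdot> (Q \<ominus> [(neg1 n)] \<cdot> T \<ominus> S) = \<ominus> (?Q \<ominus> T \<ominus> ?S)"
  proof -
    have "[(neg1 (n + 1))] \<cdot> (Q \<ominus> [(neg1 n)] \<cdot> T \<ominus> S) = \<ominus> ([(neg1 n)] \<cdot> (Q \<ominus> [(neg1 n)] \<cdot> T \<ominus> S))"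
      using assms by (intro neg1_act_Suc) simp
    also have "[(neg1 n)] \<cdot> (Q \<ominus> [(neg1 n)] \<cdot> T \<ominus> S) = ?Q \<ominus> T \<ominus> ?S"
      using assms by (simp add: int_mult_minus neg1_act_act neg1_act_even)
    finally show ?thesis .
  qed
  have 2: "[(neg1 n)] \<cdot> (S \<oplus> [(neg1 n)] \<cdot> T) = ?S \<oplus> T"
    using assms by (simp add: int_mult_add neg1_act_act neg1_act_even)
  have 3: "[(neg1 1)] \<cdot> R = \<ominus> R" using assms by (simp add: neg1_act_odd)
  have c: "?Q \<in> carrier G" "?S \<in> carrier G" using assms by simp_all
  have "(P \<ominus> ?Q \<ominus> R) \<ominus> \<ominus> (?Q \<ominus> T \<ominus> ?S) = P \<oplus> \<ominus> R \<ominus> (?S \<oplus> T) \<ominus> \<zero>"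
    using assms c by (simp add: minus_add_minus) (rule minus_eq_minusI, simp_all add: a_ac)
  then show ?thesis
    unfolding 1 2 3 by (rule minus_eq_zeroI) (use assms c in simp)
qed

text \<open>
  The Leibniz rule for \<open>gf\<close>.  Here \<open>a\<close>, \<open>b\<close>, \<open>m\<close>, \<open>B\<close>, \<open>C\<close> stand for \<open>\<rho>(gf)\<close>, \<open>(gf)\<rho>\<close>, \<open>g\<rho>f\<close>, \<open>(\<delta>g)f\<close>,
  \<open>g(\<delta>f)\<close>; the two occurrences of \<open>m\<close> cancel.
\<close>

lemma leibniz_identity:
  assumes "a \<in> carrier G" "b \<in> carrier G" "m \<in> carrier G" "B \<in> carrier G" "C \<in> carrier G"
  shows "a \<ominus> [(neg1 (p + q))] \<cdot> b \<ominus> (B \<oplus> [(neg1 p)] \<cdot> C) =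
    (a \<ominus> [(neg1 p)] \<cdot> m \<ominus> B) \<oplus> [(neg1 p)] \<cdot> (m \<ominus> [(neg1 q)] \<cdot> b \<ominus> C)"
proof -
  let ?b = "[(neg1 (p + q))] \<cdot> b" and ?m = "[(neg1 p)] \<cdot> m" and ?C = "[(neg1 p)] \<cdot> C"
  have 1: "[(neg1 p)] \<cdot> (m \<ominus> [(neg1 q)] \<cdot> b \<ominus> C) = ?m \<ominus> ?b \<ominus> ?C"
    using assms by (simp add: int_mult_minus neg1_act_act)
  have c: "?b \<in> carrier G" "?m \<in> carrier G" "?C \<in> carrier G" using assms by simp_all
  show ?thesis
    unfolding 1 using assms c by (simp add: minus_add_minus) (rule minus_eq_minusI, simp_all add:
        a_ac)
qed

end

lemma linear_maps_minus_commute: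
  assumes h: "h \<in> linear_maps K M N" and M: "module K M" and N: "module K N"
    and x: "x \<in> carrier M" "y \<in> carrier M"
  shows "h (x \<ominus>\<^bsub>M\<^esub> y) = h x \<ominus>\<^bsub>N\<^esub> h y"
proof -
  interpret M: module K M by fact
  interpret N: module K N by fact
  have "h (\<ominus>\<^bsub>M\<^esub> y) = \<ominus>\<^bsub>N\<^esub> h y"
    using linear_maps_int_mult_commute[OF h M N x(2), of "- 1"] x linear_mapsD(1)[OF h x(2)]
    by (simp add: M.M.add.int_pow_neg N.M.add.int_pow_neg)
  then show ?thesis
    using x by (simp add: a_minus_def linear_mapsD(2)[OF h])
qed

lemma linear_maps_minus:
  assumes N: "module K N" and h: "h \<in> linear_maps K M N" and h': "h' \<in> linear_maps K M N"
  shows "(\<lambda>x. h x \<ominus>\<^bsub>N\<^esub> h' x) \<in> linear_maps K M N"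
proof -
  interpret N: module K N by fact
  show ?thesis
  proof (rule linear_mapsI)
    fix x y assume x: "x \<in> carrier M" and y: "y \<in> carrier M"
    note c = linear_mapsD(1)[OF h x] linear_mapsD(1)[OF h y] linear_mapsD(1)[OF h' x]
        linear_mapsD(1)[OF h' y]
    show "h x \<ominus>\<^bsub>N\<^esub> h' x \<in> carrier N" using c by simp
    show "h (x \<oplus>\<^bsub>M\<^esub> y) \<ominus>\<^bsub>N\<^esub> h' (x \<oplus>\<^bsub>M\<^esub> y) = h x \<ominus>\<^bsub>N\<^esub> h' x \<oplus>\<^bsub>N\<^esub> (h y \<ominus>\<^bsub>N\<^esub> h' y)"
      using c by (simp add: linear_mapsD(2)[OF h x y] linear_mapsD(2)[OF h' x y] a_minus_def
          N.M.minus_add N.M.a_ac)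
  next
    fix c x assume c: "c \<in> carrier K" and x: "x \<in> carrier M"
    note cl = linear_mapsD(1)[OF h x] linear_mapsD(1)[OF h' x]
    show "h (c \<odot>\<^bsub>M\<^esub> x) \<ominus>\<^bsub>N\<^esub> h' (c \<odot>\<^bsub>M\<^esub> x) = c \<odot>\<^bsub>N\<^esub> (h x \<ominus>\<^bsub>N\<^esub> h' x)"
      using cl c by (simp add: linear_mapsD(3)[OF h c x] linear_mapsD(3)[OF h' c x] a_minus_def
          N.smult_r_distr N.smult_r_minus)
  qed
qed

context homotopy_lie
begin

lemma representationD:
  assumes "representation K A l (V, \<rho>)"
  shows "graded_vector_space K V" "\<rho> \<in> intertwiners K A V V 1" "juxt A V V 1 1 \<rho> \<rho> =
      ell_action K A l V V 1 \<rho>"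
  using assms by (simp_all add: representation_def ell_action_def)

lemma itw_diff_eq:
  "itw_diff K A l (U, \<rho>\<^sub>U) (V, \<rho>\<^sub>V) n f =
     juxt A U V 1 n \<rho>\<^sub>V f \<ominus>\<^bsub>itw_space K A U V (n + 1)\<^esub>
     ([(neg1 n)] \<cdot>\<^bsub>itw_space K A U V (n + 1)\<^esub> juxt A U V n 1 f \<rho>\<^sub>U) \<ominus>\<^bsub>itw_space K A U V (n + 1)\<^esub>
         ell_action K A l U V n f"
  by (simp add: itw_diff_def ell_action_def Let_def)

lemma itw_diff_linear:
  assumes X: "representation K A l (U, \<rho>\<^sub>U)" and Y: "representation K A l (V, \<rho>\<^sub>V)"
  shows "itw_diff K A l (U, \<rho>\<^sub>U) (V, \<rho>\<^sub>V) n \<in> linear_maps K (itw_space K A U V n) (itw_space K A U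
      V (n + 1))"
proof -
  note X = representationD[OF X] and Y = representationD[OF Y]
  note H = itw_space_module[OF graded_lie X(1) Y(1)]
  have 1: "(\<lambda>f. juxt A U V 1 n \<rho>\<^sub>V f) \<in> linear_maps K (itw_space K A U V n) (itw_space K A U V (n
      + 1))"
    using juxt_linear_right[OF graded_lie X(1) Y(1) Y(1) Y(2), of n] by (simp add: add.commute)
  note 2 = juxt_linear_left[OF graded_lie X(1) X(1) Y(1) X(2), of n]
  show ?thesis
    unfolding itw_diff_eq
    by (intro linear_maps_minus linear_maps_int_mult H 1 2 ell_action_linear X Y)
qed

lemma itw_diff_square:
  assumes two: "\<one>\<^bsub>K\<^esub> \<oplus>\<^bsub>K\<^esub> \<one>\<^bsub>K\<^esub> \<noteq> \<zero>\<^bsub>K\<^esub>"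
    and X: "representation K A l (U, \<rho>\<^sub>U)" and Y: "representation K A l (V, \<rho>\<^sub>V)"
    and f: "f \<in> intertwiners K A U V n"
  shows "itw_diff K A l (U, \<rho>\<^sub>U) (V, \<rho>\<^sub>V) (n + 1) (itw_diff K A l (U, \<rho>\<^sub>U) (V, \<rho>\<^sub>V) n f) =
    \<zero>\<^bsub>itw_space K A U V (n + 1 + 1)\<^esub>"
proof -
  note X = representationD[OF X] and Y = representationD[OF Y]
  let ?H1 = "itw_space K A U V (n + 1)" and ?H2 = "itw_space K A U V (n + 1 + 1)"
  note m1 = itw_space_module[OF graded_lie X(1) Y(1), of "n + 1"]
      and m2 = itw_space_module[OF graded_lie X(1) Y(1), of "n + 1 + 1"]
  interpret H1: module K ?H1 by (rule m1)
  interpret H2: module K ?H2 by (rule m2)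
  let ?D = "ell_action K A l U V"
  let ?a = "juxt A U V 1 n \<rho>\<^sub>V f" and ?b = "juxt A U V n 1 f \<rho>\<^sub>U" and ?c = "?D n f"
  have c1: "?a \<in> carrier ?H1" "?b \<in> carrier ?H1" "?c \<in> carrier ?H1"
    using juxt_intertwiner[OF graded_lie X(1) Y(1) Y(1) Y(2) f] juxt_intertwiner[OF graded_lie
        X(1) X(1) Y(1) f X(2)]
      ell_action_intertwiner[OF X(1) Y(1) f]
    by (simp_all add: itw_space_simps add.commute)
  let ?F = "?a \<ominus>\<^bsub>?H1\<^esub> [(neg1 n)] \<cdot>\<^bsub>?H1\<^esub> ?b \<ominus>\<^bsub>?H1\<^esub> ?c"
  let ?\<rho>l = "juxt A U V 1 (n + 1) \<rho>\<^sub>V" and ?\<rho>r = "\<lambda>g. juxt A U V (n + 1) 1 g \<rho>\<^sub>U"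
  have l: "?\<rho>l \<in> linear_maps K ?H1 ?H2"
    using juxt_linear_right[OF graded_lie X(1) Y(1) Y(1) Y(2), of "n + 1"]
        by (simp add: add.commute)
  have r: "?\<rho>r \<in> linear_maps K ?H1 ?H2"
    using juxt_linear_left[OF graded_lie X(1) X(1) Y(1) X(2), of "n + 1"] by simp
  note D = ell_action_linear[OF X(1) Y(1), of "n + 1"]
  have expand: "h ?F = h ?a \<ominus>\<^bsub>?H2\<^esub> [(neg1 n)] \<cdot>\<^bsub>?H2\<^esub> h ?b \<ominus>\<^bsub>?H2\<^esub> h ?c"
      if "h \<in> linear_maps K ?H1 ?H2" for h
    using c1 by (simp add: linear_maps_minus_commute[OF that m1 m2]
        linear_maps_int_mult_commute[OF that m1 m2])
  let ?P = "?\<rho>l ?a" and ?Q = "?\<rho>l ?b" and ?R = "?\<rho>l ?c" and ?S = "?\<rho>r ?c" and ?T = "?\<rho>r ?b"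
  have cl: "?P \<in> carrier ?H2" "?Q \<in> carrier ?H2" "?R \<in> carrier ?H2" "?S \<in> carrier ?H2" "?T
      \<in> carrier ?H2"
    by (intro linear_mapsD(1)[OF l] linear_mapsD(1)[OF r] c1)+
  have Q: "?\<rho>r ?a = ?Q"
    using juxt_assoc[OF graded_lie X(1) X(1) Y(1) Y(1) Y(2) f X(2)] by (simp add: add.commute)
  have P: "?P = juxt A U V (1 + 1) n (ell_action K A l V V 1 \<rho>\<^sub>V) f"
    using juxt_assoc[OF graded_lie X(1) Y(1) Y(1) Y(1) Y(2) Y(2) f] Y(3) by (simp add: add.commute)
  have T: "?T = juxt A U V n (1 + 1) f (ell_action K A l U U 1 \<rho>\<^sub>U)"
    using juxt_assoc[OF graded_lie X(1) X(1) X(1) Y(1) f X(2) X(2)] X(3) by simp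
  have Da: "?D (n + 1) ?a = ?P \<oplus>\<^bsub>?H2\<^esub> [(neg1 1)] \<cdot>\<^bsub>?H2\<^esub> ?R"
    using ell_action_juxt[OF X(1) Y(1) Y(1) Y(2) f] by (simp only: P add.commute[of 1 n])
  have Db: "?D (n + 1) ?b = ?S \<oplus>\<^bsub>?H2\<^esub> [(neg1 n)] \<cdot>\<^bsub>?H2\<^esub> ?T"
    using ell_action_juxt[OF X(1) X(1) Y(1) f X(2)] by (simp add: T)
  have Dc: "?D (n + 1) ?c = \<zero>\<^bsub>?H2\<^esub>"
    by (rule ell_action_square[OF two X(1) Y(1) f])
  show ?thesis
    unfolding itw_diff_eq expand[OF l] expand[OF r] expand[OF D] Q Da Db Dc
    by (rule H2.M.differential_square_identity[OF cl])
qed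

lemma itw_diff_juxt:
  assumes X: "representation K A l (U, \<rho>\<^sub>U)" and Y: "representation K A l (V, \<rho>\<^sub>V)"
    and Z: "representation K A l (W, \<rho>\<^sub>W)"
    and g: "g \<in> intertwiners K A V W p" and f: "f \<in> intertwiners K A U V q"
  shows "itw_diff K A l (U, \<rho>\<^sub>U) (W, \<rho>\<^sub>W) (p + q) (juxt A U W p q g f) =
    juxt A U W (p + 1) q (itw_diff K A l (V, \<rho>\<^sub>V) (W, \<rho>\<^sub>W) p g) f \<oplus>\<^bsub>itw_space K A U W (p + q + 1)\<^esub>
    ([(neg1 p)] \<cdot>\<^bsub>itw_space K A U W (p + q + 1)\<^esub> juxt A U W p (q + 1) g (itw_diff K A l (U, \<rho>\<^sub>U)
        (V, \<rho>\<^sub>V) q f))"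
proof -
  note X = representationD[OF X] and Y = representationD[OF Y] and Z = representationD[OF Z]
  let ?H = "itw_space K A U W (p + q + 1)"
  let ?Hg = "itw_space K A V W (p + 1)" and ?Hf = "itw_space K A U V (q + 1)"
  note mH = itw_space_module[OF graded_lie X(1) Z(1), of "p + q + 1"]
    and mg = itw_space_module[OF graded_lie Y(1) Z(1), of "p + 1"]
    and mf = itw_space_module[OF graded_lie X(1) Y(1), of "q + 1"]
  interpret H: module K ?H by (rule mH)
  interpret Hg: module K ?Hg by (rule mg)
  interpret Hf: module K ?Hf by (rule mf)
  have cg: "juxt A V W 1 p \<rho>\<^sub>W g \<in> carrier ?Hg" "juxt A V W p 1 g \<rho>\<^sub>V \<in> carrier ?Hg" "ell_action K
      A l V W p g \<in> carrier ?Hg"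
    using juxt_intertwiner[OF graded_lie Y(1) Z(1) Z(1) Z(2) g] juxt_intertwiner[OF graded_lie
        Y(1) Y(1) Z(1) g Y(2)]
      ell_action_intertwiner[OF Y(1) Z(1) g]
    by (simp_all add: itw_space_simps add.commute)
  have cf: "juxt A U V 1 q \<rho>\<^sub>V f \<in> carrier ?Hf" "juxt A U V q 1 f \<rho>\<^sub>U \<in> carrier ?Hf" "ell_action K
      A l U V q f \<in> carrier ?Hf"
    using juxt_intertwiner[OF graded_lie X(1) Y(1) Y(1) Y(2) f] juxt_intertwiner[OF graded_lie
        X(1) X(1) Y(1) f X(2)]
      ell_action_intertwiner[OF X(1) Y(1) f]
    by (simp_all add: itw_space_simps add.commute)
  let ?l = "\<lambda>g. juxt A U W (p + 1) q g f" and ?r = "juxt A U W p (q + 1) g"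
  have l: "?l \<in> linear_maps K ?Hg ?H"
    using juxt_linear_left[OF graded_lie X(1) Y(1) Z(1) f, of "p + 1"] by (simp add: ac_simps)
  have r: "?r \<in> linear_maps K ?Hf ?H"
    using juxt_linear_right[OF graded_lie X(1) Y(1) Z(1) g, of "q + 1"] by (simp add: ac_simps)
  let ?a = "?l (juxt A V W 1 p \<rho>\<^sub>W g)" and ?b = "?r (juxt A U V q 1 f \<rho>\<^sub>U)"
      and ?m = "?r (juxt A U V 1 q \<rho>\<^sub>V f)"
  let ?B = "?l (ell_action K A l V W p g)" and ?C = "?r (ell_action K A l U V q f)"
  have cl: "?a \<in> carrier ?H" "?b \<in> carrier ?H" "?m \<in> carrier ?H" "?B \<in> carrier ?H" "?C \<in> carrier ?H"
    by (intro linear_mapsD(1)[OF l] linear_mapsD(1)[OF r] cg cf)+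
  have a: "juxt A U W 1 (p + q) \<rho>\<^sub>W (juxt A U W p q g f) = ?a"
    using juxt_assoc[OF graded_lie X(1) Y(1) Z(1) Z(1) Z(2) g f] by (simp add: add.commute)
  have b: "juxt A U W (p + q) 1 (juxt A U W p q g f) \<rho>\<^sub>U = ?b"
    using juxt_assoc[OF graded_lie X(1) X(1) Y(1) Z(1) g f X(2)] by simp
  have m: "?l (juxt A V W p 1 g \<rho>\<^sub>V) = ?m"
    using juxt_assoc[OF graded_lie X(1) Y(1) Y(1) Z(1) g Y(2) f] by (simp add: add.commute)
  have D: "ell_action K A l U W (p + q) (juxt A U W p q g f) = ?B \<oplus>\<^bsub>?H\<^esub> [(neg1 p)] \<cdot>\<^bsub>?H\<^esub> ?C"
    by (rule ell_action_juxt[OF X(1) Y(1) Z(1) g f])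
  have lg: "?l (itw_diff K A l (V, \<rho>\<^sub>V) (W, \<rho>\<^sub>W) p g) = ?a \<ominus>\<^bsub>?H\<^esub> [(neg1 p)] \<cdot>\<^bsub>?H\<^esub> ?m \<ominus>\<^bsub>?H\<^esub> ?B"
    unfolding itw_diff_eq using cg
    by (simp add: linear_maps_minus_commute[OF l mg mH] linear_maps_int_mult_commute[OF l mg mH] m)
  have rf: "?r (itw_diff K A l (U, \<rho>\<^sub>U) (V, \<rho>\<^sub>V) q f) = ?m \<ominus>\<^bsub>?H\<^esub> [(neg1 q)] \<cdot>\<^bsub>?H\<^esub> ?b \<ominus>\<^bsub>?H\<^esub> ?C"
    unfolding itw_diff_eq using cf
    by (simp add: linear_maps_minus_commute[OF r mf mH] linear_maps_int_mult_commute[OF r mf mH])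
  show ?thesis
    unfolding lg rf unfolding itw_diff_eq a b D
    by (rule H.M.leibniz_identity[OF cl])
qed

lemma itw_diff_id:
  assumes X: "representation K A l (U, \<rho>)"
  shows "itw_diff K A l (U, \<rho>) (U, \<rho>) 0 (itw_id A U) = \<zero>\<^bsub>itw_space K A U U 1\<^esub>"
proof -
  note X = representationD[OF X]
  interpret H: module K "itw_space K A U U 1" by (rule itw_space_module[OF graded_lie X(1) X(1)])
  have "\<rho> \<in> carrier (itw_space K A U U 1)" using X(2) by (simp add: itw_space_simps)
  then show ?thesis
    by (simp add: itw_diff_eq juxt_id_left[OF graded_lie X(1) X(1) X(2)] juxt_id_right[OF
        graded_lie X(1) X(1) X(2)]
      ell_action_id[OF X(1)] H.M.minus_add_minus H.M.minus_eq_zeroI)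
qed

end

theorem proposition3p11:
  fixes K :: "('k, 'm) ring_scheme"
    and \<gg> :: "('k, 'g) graded"
    and l :: "'g homogeneous list \<Rightarrow> 'g"
  assumes "field K"
    and "\<And>n::nat. n > 0 \<Longrightarrow> [n] \<cdot>\<^bsub>K\<^esub> \<one>\<^bsub>K\<^esub> \<noteq> \<zero>\<^bsub>K\<^esub>"
    and "homotopy_lie_algebra K \<gg> l"
  shows "dg_category K (Rep K \<gg> l :: ('k, ('k, 'g, 'v) rep, ('g, 'v, 'v) itw) dg_cat)"
proof -
  interpret homotopy_lie K \<gg> l by unfold_locales fact
  interpret K: field K by fact
  have "[(2::nat)] \<cdot>\<^bsub>K\<^esub> \<one>\<^bsub>K\<^esub> = \<one>\<^bsub>K\<^esub> \<oplus>\<^bsub>K\<^esub> \<one>\<^bsub>K\<^esub>"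
    by (simp add: numeral_2_eq_2)
  then have two: "\<one>\<^bsub>K\<^esub> \<oplus>\<^bsub>K\<^esub> \<one>\<^bsub>K\<^esub> \<noteq> \<zero>\<^bsub>K\<^esub>"
    using assms(2)[of 2] by simp
  let ?C = "Rep K \<gg> l :: ('k, ('k, 'g, 'v) rep, ('g, 'v, 'v) itw) dg_cat"
  have C: "X \<in> dg_obj ?C \<longleftrightarrow> representation K \<gg> l X" "dg_hom ?C X Y = itw_space K \<gg> (fst X) (fst Y)"
    "dg_diff ?C = itw_diff K \<gg> l" "dg_comp ?C X Y Z p q g f = juxt \<gg> (fst X) (fst Z) p q g f"
    "dg_unit ?C X = itw_id \<gg> (fst X)" for X Y Z p q g f
    by (simp_all add: Rep_def)
  have gr: "graded_vector_space K (fst X)" if "representation K \<gg> l X" for X :: "('k, 'g, 'v) rep"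
    using representationD(1)[of "fst X" "snd X"] that by simp
  show ?thesis
  proof (unfold_locales, unfold C)
    fix X Y Z T :: "('k, 'g, 'v) rep" and p q r :: int and f g h
    assume X: "representation K \<gg> l X"
    show "itw_id \<gg> (fst X) \<in> carrier (itw_space K \<gg> (fst X) (fst X) 0)"
      using itw_id_intertwiner[OF graded_lie gr[OF X]] by (simp add: itw_space_simps)
    show "itw_diff K \<gg> l X X 0 (itw_id \<gg> (fst X)) = \<zero>\<^bsub>itw_space K \<gg> (fst X) (fst X) 1\<^esub>"
      using itw_diff_id[of "fst X" "snd X"] X by simp
    assume Y: "representation K \<gg> l Y"
    show "cochain_complex K (itw_space K \<gg> (fst X) (fst Y)) (itw_diff K \<gg> l X Y)"
      unfolding cochain_complex_def graded_vector_space_def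
      using \<open>field K\<close> itw_space_module[OF graded_lie gr[OF X] gr[OF Y]]
        itw_diff_linear[of "fst X" "snd X" "fst Y" "snd Y"] itw_diff_square[OF two, of "fst X"
            "snd X" "fst Y" "snd Y"] X Y
      by (simp add: itw_space_simps(1))
    assume Z: "representation K \<gg> l Z"
    show "(\<lambda>g. juxt \<gg> (fst X) (fst Z) p q g f) \<in>
      linear_maps K (itw_space K \<gg> (fst Y) (fst Z) p) (itw_space K \<gg> (fst X) (fst Z) (p + q))"
      if "f \<in> carrier (itw_space K \<gg> (fst X) (fst Y) q)"
      using juxt_linear_left[OF graded_lie gr[OF X] gr[OF Y] gr[OF Z]] that
          by (simp add: itw_space_simps(1))
    show "juxt \<gg> (fst X) (fst Z) p q g \<in>
      linear_maps K (itw_space K \<gg> (fst X) (fst Y) q) (itw_space K \<gg> (fst X) (fst Z) (p + q))"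
      if "g \<in> carrier (itw_space K \<gg> (fst Y) (fst Z) p)"
      using juxt_linear_right[OF graded_lie gr[OF X] gr[OF Y] gr[OF Z]] that
          by (simp add: itw_space_simps(1))
    show "itw_diff K \<gg> l X Z (p + q) (juxt \<gg> (fst X) (fst Z) p q g f) =
      juxt \<gg> (fst X) (fst Z) (p + 1) q (itw_diff K \<gg> l Y Z p g) f
        \<oplus>\<^bsub>itw_space K \<gg> (fst X) (fst Z) (p + q + 1)\<^esub>
      ([(neg1 p)] \<cdot>\<^bsub>itw_space K \<gg> (fst X) (fst Z) (p + q + 1)\<^esub>
        juxt \<gg> (fst X) (fst Z) p (q + 1) g (itw_diff K \<gg> l X Y q f))"
      if "g \<in> carrier (itw_space K \<gg> (fst Y) (fst Z) p)" "f \<in> carrier (itw_space K \<gg> (fst X) (fst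
          Y) q)"
      using itw_diff_juxt[of "fst X" "snd X" "fst Y" "snd Y" "fst Z" "snd Z"] X Y Z that
      by (simp add: itw_space_simps(1))
    show "juxt \<gg> (fst X) (fst Y) 0 q (itw_id \<gg> (fst Y)) f = f"
      if "f \<in> carrier (itw_space K \<gg> (fst X) (fst Y) q)"
      using juxt_id_left[OF graded_lie gr[OF X] gr[OF Y]] that by (simp add: itw_space_simps(1))
    show "juxt \<gg> (fst X) (fst Y) q 0 f (itw_id \<gg> (fst X)) = f"
      if "f \<in> carrier (itw_space K \<gg> (fst X) (fst Y) q)"
      using juxt_id_right[OF graded_lie gr[OF X] gr[OF Y]] that by (simp add: itw_space_simps(1))
    assume T: "representation K \<gg> l T"
    show "juxt \<gg> (fst X) (fst T) (r + p) q (juxt \<gg> (fst Y) (fst T) r p h g) f =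
      juxt \<gg> (fst X) (fst T) r (p + q) h (juxt \<gg> (fst X) (fst Z) p q g f)"
      if "h \<in> carrier (itw_space K \<gg> (fst Z) (fst T) r)" "g \<in> carrier (itw_space K \<gg> (fst Y) (fst
          Z) p)"
        "f \<in> carrier (itw_space K \<gg> (fst X) (fst Y) q)"
      using juxt_assoc[OF graded_lie gr[OF X] gr[OF Y] gr[OF Z] gr[OF T]] that
          by (simp add: itw_space_simps(1))
  qed
qed

end
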